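(* Let $H$ be a bialgebra over a field $k$. The monoidal category $\mathcal{LR}(H)$ (defined in the context) is a prebraided category, with braiding defined, for all $M,N\in\mathcal{LR}(H)$, $m\in M$, $n\in N$, by $$c_{M,N}:M\otimes N\to N\otimes M,\qquad c_{M,N}(m\otimes n)=m^{(-1)}\cdot n^{<0>}\otimes m^{(0)}\cdot n^{<1>}.$$ If $H$ has a skew antipode $S^{-1}$, then $\mathcal{LR}(H)$ is braided, the inverse of $c$ being given by $$c_{M,N}^{-1}:N\otimes M\to M\otimes N,\qquad c_{M,N}^{-1}(n\otimes m)=m^{(0)}\cdot S^{-1}(n^{<1>})\otimes S^{-1}(m^{(-1)})\cdot n^{<0>}.$$
   Context: Everything is over a field $k$, $\otimes=\otimes_k$. For a bialgebra $H$ write $\Delta(h)=h_1\otimes h_2$ and $\varepsilon$ for its counit. **The category $\mathcal{LR}(H)$.** Objects are vector spaces $M$ endowed with $H$-bimodule and $H$-bicomodule structures, denoted $h\otimes m\mapsto h\cdot m$, $m\otimes h\mapsto m\cdot h$, $m\mapsto m^{(-1)}\otimes m^{(0)}\in H\otimes M$ (left coaction), $m\mapsto m^{<0>}\otimes m^{<1>}\in M\otimes H$ (right coaction), such that for all $h\in H$, $m\in M$: - $(h_1\cdot m)^{(-1)}h_2\otimes(h_1\cdot m)^{(0)}=h_1m^{(-1)}\otimes h_2\cdot m^{(0)}$, - $(h\cdot m)^{<0>}\otimes(h\cdot m)^{<1>}=h\cdot m^{<0>}\otimes m^{<1>}$, - $(m\cdot h_2)^{<0>}\otimes h_1(m\cdot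 h_2)^{<1>}=m^{<0>}\cdot h_1\otimes m^{<1>}h_2$, - $(m\cdot h)^{(-1)}\otimes(m\cdot h)^{(0)}=m^{(-1)}\otimes m^{(0)}\cdot h$. Morphisms are the $H$-bilinear $H$-bicolinear maps. $\mathcal{LR}(H)$ is a (strict) monoidal category with unit $k$ (with the usual $H$-bimodule and $H$-bicomodule structures given by $\varepsilon$ and $1_H$) and tensor product $M\otimes N$ with structures - $h\cdot(m\otimes n)=h_1\cdot m\otimes h_2\cdot n$, $\ (m\otimes n)\cdot h=m\cdot h_1\otimes n\cdot h_2$, - $(m\otimes n)^{(-1)}\otimes(m\otimes n)^{(0)}=m^{(-1)}n^{(-1)}\otimes(m^{(0)}\otimes n^{(0)})$, - $(m\otimes n)^{<0>}\otimes(m\otimes n)^{<1>}=(m^{<0>}\otimes n^{<0>})\otimes m^{<1>}n^{<1>}$. **Conventions.** A prebraiding on a monoidal category is a natural family of morphisms $c_{M,N}:M\otimes N\to N\otimes M$ satisfying the two hexagon identities (and compatible with the unit object), not required to be invertible; a braiding is a prebraiding all of whose components are isomorphisms. A skew antipode of $H$ is a linear map $S^{-1}:H\to H$ (the notation does not presuppose an antipode $S$) with $S^{-1}(h_2)h_1=\varepsilon(h)1_H=h_2S^{-1}(h_1)$ for all $h\in H$. *)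

theory Defs
  imports "HOL-Library.Infinite_Typeclass" "HOL-Algebra.Module"
begin

section \<open>Monoidal, prebraided and braided categories\<close>

record ('o, 'a) category =
  Ob :: "'o set"
  Hom :: "'o \<Rightarrow> 'o \<Rightarrow> 'a set"
  Id :: "'o \<Rightarrow> 'a"
  Comp :: "'a \<Rightarrow> 'a \<Rightarrow> 'a"  (infixr \<open>\<bullet>\<index>\<close> 60)

record ('o, 'a) monoidal_category = "('o, 'a) category" +
  TensO :: "'o \<Rightarrow> 'o \<Rightarrow> 'o"  (infixr \<open>\<odot>\<^sub>o\<index>\<close> 75)
  TensA :: "'a \<Rightarrow> 'a \<Rightarrow> 'a"  (infixr \<open>\<odot>\<^sub>a\<index>\<close> 75)
  Unit :: 'o
  Assoc :: "'o \<Rightarrow> 'o \<Rightarrow> 'o \<Rightarrow> 'a"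
  Lunit :: "'o \<Rightarrow> 'a"
  Runit :: "'o \<Rightarrow> 'a"

locale category =
  fixes C (structure)
  assumes Id_Hom: "A \<in> Ob C \<Longrightarrow> Id C A \<in> Hom C A A"
    and Comp_Hom: "\<lbrakk>A \<in> Ob C; B \<in> Ob C; D \<in> Ob C; f \<in> Hom C A B; g \<in> Hom C B D\<rbrakk>
      \<Longrightarrow> g \<bullet> f \<in> Hom C A D"
    and Comp_Id: "\<lbrakk>A \<in> Ob C; B \<in> Ob C; f \<in> Hom C A B\<rbrakk> \<Longrightarrow> f \<bullet> Id C A = f"
    and Id_Comp: "\<lbrakk>A \<in> Ob C; B \<in> Ob C; f \<in> Hom C A B\<rbrakk> \<Longrightarrow> Id C B \<bullet> f = f"
    and Comp_assoc: "\<lbrakk>A \<in> Ob C; B \<in> Ob C; D \<in> Ob C; E \<in> Ob C;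
      f \<in> Hom C A B; g \<in> Hom C B D; h \<in> Hom C D E\<rbrakk> \<Longrightarrow> (h \<bullet> g) \<bullet> f = h \<bullet> (g \<bullet> f)"
    and Hom_disjoint: "\<lbrakk>A \<in> Ob C; B \<in> Ob C; A' \<in> Ob C; B' \<in> Ob C;
      f \<in> Hom C A B; f \<in> Hom C A' B'\<rbrakk> \<Longrightarrow> A = A' \<and> B = B'"

definition inverse_arrows :: "('o, 'a, 'z) category_scheme \<Rightarrow> 'o \<Rightarrow> 'o \<Rightarrow> 'a \<Rightarrow> 'a \<Rightarrow> bool" where
  "inverse_arrows C A B f g \<longleftrightarrow> f \<in> Hom C A B \<and> g \<in> Hom C B A \<and>
     g \<bullet>\<^bsub>C\<^esub> f = Id C A \<and> f \<bullet>\<^bsub>C\<^esub> g = Id C B"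

definition iso_arrow :: "('o, 'a, 'z) category_scheme \<Rightarrow> 'o \<Rightarrow> 'o \<Rightarrow> 'a \<Rightarrow> bool" where
  "iso_arrow C A B f \<longleftrightarrow> (\<exists>g. inverse_arrows C A B f g)"

definition inv_arrow :: "('o, 'a, 'z) category_scheme \<Rightarrow> 'o \<Rightarrow> 'o \<Rightarrow> 'a \<Rightarrow> 'a" where
  "inv_arrow C A B f = (THE g. inverse_arrows C A B f g)"

abbreviation Assoc_inv :: "('o, 'a, 'z) monoidal_category_scheme \<Rightarrow> 'o \<Rightarrow> 'o \<Rightarrow> 'o \<Rightarrow> 'a" where
  "Assoc_inv C L M N \<equiv> inv_arrow C ((L \<odot>\<^sub>o\<^bsub>C\<^esub> M) \<odot>\<^sub>o\<^bsub>C\<^esub> N) (L \<odot>\<^sub>o\<^bsub>C\<^esub> (M \<odot>\<^sub>o\<^bsub>C\<^esub> N)) (Assoc C L M N)"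

locale monoidal_category = category C for C (structure) +
  assumes Unit_Ob: "Unit C \<in> Ob C"
    and TensO_Ob: "\<lbrakk>M \<in> Ob C; N \<in> Ob C\<rbrakk> \<Longrightarrow> M \<odot>\<^sub>o N \<in> Ob C"
    and TensA_Hom: "\<lbrakk>M \<in> Ob C; M' \<in> Ob C; N \<in> Ob C; N' \<in> Ob C; f \<in> Hom C M M'; g \<in> Hom C N N'\<rbrakk>
      \<Longrightarrow> f \<odot>\<^sub>a g \<in> Hom C (M \<odot>\<^sub>o N) (M' \<odot>\<^sub>o N')"
    and TensA_Id: "\<lbrakk>M \<in> Ob C; N \<in> Ob C\<rbrakk> \<Longrightarrow> Id C M \<odot>\<^sub>a Id C N = Id C (M \<odot>\<^sub>o N)"
    and TensA_Comp: "\<lbrakk>M \<in> Ob C; M' \<in> Ob C; M'' \<in> Ob C; N \<in> Ob C; N' \<in> Ob C; N'' \<in> Ob C;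
      f \<in> Hom C M M'; f' \<in> Hom C M' M''; g \<in> Hom C N N'; g' \<in> Hom C N' N''\<rbrakk>
      \<Longrightarrow> (f' \<bullet> f) \<odot>\<^sub>a (g' \<bullet> g) = (f' \<odot>\<^sub>a g') \<bullet> (f \<odot>\<^sub>a g)"
    and Assoc_iso: "\<lbrakk>L \<in> Ob C; M \<in> Ob C; N \<in> Ob C\<rbrakk>
      \<Longrightarrow> iso_arrow C ((L \<odot>\<^sub>o M) \<odot>\<^sub>o N) (L \<odot>\<^sub>o (M \<odot>\<^sub>o N)) (Assoc C L M N)"
    and Assoc_natural: "\<lbrakk>L \<in> Ob C; M \<in> Ob C; N \<in> Ob C; L' \<in> Ob C; M' \<in> Ob C; N' \<in> Ob C;
      f \<in> Hom C L L'; g \<in> Hom C M M'; h \<in> Hom C N N'\<rbrakk>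
      \<Longrightarrow> Assoc C L' M' N' \<bullet> ((f \<odot>\<^sub>a g) \<odot>\<^sub>a h) = (f \<odot>\<^sub>a (g \<odot>\<^sub>a h)) \<bullet> Assoc C L M N"
    and Lunit_iso: "M \<in> Ob C \<Longrightarrow> iso_arrow C (Unit C \<odot>\<^sub>o M) M (Lunit C M)"
    and Lunit_natural: "\<lbrakk>M \<in> Ob C; M' \<in> Ob C; f \<in> Hom C M M'\<rbrakk>
      \<Longrightarrow> Lunit C M' \<bullet> (Id C (Unit C) \<odot>\<^sub>a f) = f \<bullet> Lunit C M"
    and Runit_iso: "M \<in> Ob C \<Longrightarrow> iso_arrow C (M \<odot>\<^sub>o Unit C) M (Runit C M)"
    and Runit_natural: "\<lbrakk>M \<in> Ob C; M' \<in> Ob C; f \<in> Hom C M M'\<rbrakk>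
      \<Longrightarrow> Runit C M' \<bullet> (f \<odot>\<^sub>a Id C (Unit C)) = f \<bullet> Runit C M"
    and pentagon: "\<lbrakk>L \<in> Ob C; M \<in> Ob C; N \<in> Ob C; P \<in> Ob C\<rbrakk>
      \<Longrightarrow> (Id C L \<odot>\<^sub>a Assoc C M N P) \<bullet> Assoc C L (M \<odot>\<^sub>o N) P \<bullet> (Assoc C L M N \<odot>\<^sub>a Id C P)
        = Assoc C L M (N \<odot>\<^sub>o P) \<bullet> Assoc C (L \<odot>\<^sub>o M) N P"
    and triangle: "\<lbrakk>M \<in> Ob C; N \<in> Ob C\<rbrakk>
      \<Longrightarrow> (Id C M \<odot>\<^sub>a Lunit C N) \<bullet> Assoc C M (Unit C) N = Runit C M \<odot>\<^sub>a Id C N"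

locale prebraided_category = monoidal_category C for C (structure) +
  fixes c
  assumes c_Hom: "\<lbrakk>M \<in> Ob C; N \<in> Ob C\<rbrakk> \<Longrightarrow> c M N \<in> Hom C (M \<odot>\<^sub>o N) (N \<odot>\<^sub>o M)"
    and c_natural: "\<lbrakk>M \<in> Ob C; M' \<in> Ob C; N \<in> Ob C; N' \<in> Ob C; f \<in> Hom C M M'; g \<in> Hom C N N'\<rbrakk>
      \<Longrightarrow> c M' N' \<bullet> (f \<odot>\<^sub>a g) = (g \<odot>\<^sub>a f) \<bullet> c M N"
    and hexagon1: "\<lbrakk>M \<in> Ob C; N \<in> Ob C; P \<in> Ob C\<rbrakk>
      \<Longrightarrow> Assoc C N P M \<bullet> c M (N \<odot>\<^sub>o P) \<bullet> Assoc C M N P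
        = (Id C N \<odot>\<^sub>a c M P) \<bullet> Assoc C N M P \<bullet> (c M N \<odot>\<^sub>a Id C P)"
    and hexagon2: "\<lbrakk>M \<in> Ob C; N \<in> Ob C; P \<in> Ob C\<rbrakk>
      \<Longrightarrow> Assoc_inv C P M N \<bullet> c (M \<odot>\<^sub>o N) P \<bullet> Assoc_inv C M N P
        = (c M P \<odot>\<^sub>a Id C N) \<bullet> Assoc_inv C M P N \<bullet> (Id C M \<odot>\<^sub>a c N P)"
    and c_Unit_left: "M \<in> Ob C \<Longrightarrow> Runit C M \<bullet> c (Unit C) M = Lunit C M"
    and c_Unit_right: "M \<in> Ob C \<Longrightarrow> Lunit C M \<bullet> c M (Unit C) = Runit C M"

locale braided_category = prebraided_category C c for C (structure) and c +
  assumes c_iso: "\<lbrakk>M \<in> Ob C; N \<in> Ob C\<rbrakk> \<Longrightarrow> iso_arrow C (M \<odot>\<^sub>o N) (N \<odot>\<^sub>o M) (c M N)"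


section \<open>Tensor products of vector spaces\<close>

text \<open>
  All vector spaces, including the ground field \<open>K\<close> and the bialgebra \<open>H\<close>, have as carrier a subset
  of one infinite type \<open>'u\<close>, which plays the role of a universe of small sets; given any field,
  bialgebra and family of vector spaces, \<open>'u\<close> can be chosen large enough to contain copies of all of
  them. An injection of formal sums \<open>m\<^sub>1 \<otimes> n\<^sub>1 + \<dots> + m\<^sub>r \<otimes> n\<^sub>r\<close>, represented as lists of pairs, into
  \<open>'u\<close> makes the universe closed under tensor products, so that the vector spaces in it form the
  objects of a monoidal category.
\<close>

definition encode :: "('u::infinite \<times> 'u) list \<Rightarrow> 'u" where
  "encode = (SOME f. inj f)"

definition decode :: "'u::infinite \<Rightarrow> ('u \<times> 'u) list" where
  "decode = inv_into UNIV encode"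

lemma inj_encode: "inj (encode :: ('u::infinite \<times> 'u) list \<Rightarrow> 'u)"
proof -
  include cardinal_syntax
  have inf: "infinite (UNIV :: 'u set)" by (rule infinite_UNIV)
  have "|(UNIV :: 'u set) \<times> (UNIV :: 'u set)| \<le>o |UNIV :: 'u set|"
    using card_of_Times_same_infinite[OF inf] ordIso_iff_ordLeq by blast
  then obtain p :: "'u \<times> 'u \<Rightarrow> 'u" where p: "inj p"
    unfolding card_of_ordLeq[symmetric] by auto
  fix z :: 'u
  obtain s :: "'u \<Rightarrow> 'u" where "bij_betw s UNIV (UNIV - {z})"
    using infinite_imp_bij_betw[OF inf] by blast
  then have s: "inj s" "\<And>x. s x \<noteq> z" by (auto simp: bij_betw_def)
  define f :: "('u \<times> 'u) list \<Rightarrow> 'u" where "f = rec_list z (\<lambda>x _ r. s (p (p x, r)))"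
  have f: "f [] = z" "\<And>x xs. f (x # xs) = s (p (p x, f xs))" by (simp_all add: f_def)
  have "f xs = f ys \<Longrightarrow> xs = ys" for xs ys
  proof (induction xs arbitrary: ys)
    case Nil
    then show ?case using s(2) by (cases ys) (simp_all add: f, metis)
  next
    case (Cons x xs)
    then obtain y ys' where ys: "ys = y # ys'" using s(2) by (cases ys) (simp_all add: f)
    then have "p x = p y" "f xs = f ys'"
      using Cons.prems p s(1) by (auto simp: f inj_eq)
    then show ?case using Cons.IH ys p by (auto simp: inj_eq)
  qed
  then have "inj f" by (rule injI)
  then show ?thesis unfolding encode_def by (rule someI[of inj])
qed

record 'u bialg = "('u, 'u) module" +
  comult :: "'u \<Rightarrow> 'u"
  counit :: "'u \<Rightarrow> 'u"

text \<open>\<open>lact M h m\<close> is \<open>h \<cdot> m\<close> and \<open>ract M m h\<close> is \<open>m \<cdot> h\<close>.\<close>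

record 'u lr_module = "('u, 'u) module" +
  lact :: "'u \<Rightarrow> 'u \<Rightarrow> 'u"
  ract :: "'u \<Rightarrow> 'u \<Rightarrow> 'u"
  lcoact :: "'u \<Rightarrow> 'u"
  rcoact :: "'u \<Rightarrow> 'u"

record 'u lr_arrow =
  src :: "'u lr_module"
  fn :: "'u \<Rightarrow> 'u"
  tgt :: "'u lr_module"

context
  fixes K :: "'u::infinite ring"
begin

inductive tensor_rel ::
    "('u, 'u, 'x) module_scheme \<Rightarrow> ('u, 'u, 'y) module_scheme \<Rightarrow> ('u \<times> 'u) list \<Rightarrow> ('u \<times> 'u) list \<Rightarrow> bool"
  for M :: "('u, 'u, 'x) module_scheme" and N :: "('u, 'u, 'y) module_scheme"
where
  refl: "tensor_rel M N xs xs"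
| sym: "tensor_rel M N xs ys \<Longrightarrow> tensor_rel M N ys xs"
| trans: "tensor_rel M N xs ys \<Longrightarrow> tensor_rel M N ys zs \<Longrightarrow> tensor_rel M N xs zs"
| append: "tensor_rel M N xs xs' \<Longrightarrow> tensor_rel M N ys ys' \<Longrightarrow> tensor_rel M N (xs @ ys) (xs' @ ys')"
| comm: "tensor_rel M N (xs @ ys) (ys @ xs)"
| zero: "n \<in> carrier N \<Longrightarrow> tensor_rel M N [(\<zero>\<^bsub>M\<^esub>, n)] []"
| add_left: "\<lbrakk>m \<in> carrier M; m' \<in> carrier M; n \<in> carrier N\<rbrakk>
    \<Longrightarrow> tensor_rel M N [(m \<oplus>\<^bsub>M\<^esub> m', n)] [(m, n), (m', n)]"
| add_right: "\<lbrakk>m \<in> carrier M; n \<in> carrier N; n' \<in> carrier N\<rbrakk>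
    \<Longrightarrow> tensor_rel M N [(m, n \<oplus>\<^bsub>N\<^esub> n')] [(m, n), (m, n')]"
| smult: "\<lbrakk>a \<in> carrier K; m \<in> carrier M; n \<in> carrier N\<rbrakk>
    \<Longrightarrow> tensor_rel M N [(a \<odot>\<^bsub>M\<^esub> m, n)] [(m, a \<odot>\<^bsub>N\<^esub> n)]"

text \<open>
  The code of a canonical representative of the class of a formal sum: two formal sums represent the
  same tensor iff they are related by \<open>tensor_rel\<close>.
\<close>

definition tensor_class ::
    "('u, 'u, 'x) module_scheme \<Rightarrow> ('u, 'u, 'y) module_scheme \<Rightarrow> ('u \<times> 'u) list \<Rightarrow> 'u" where
  "tensor_class M N xs =
     encode (SOME ys. ys \<in> lists (carrier M \<times> carrier N) \<and> tensor_rel M N xs ys)"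

text \<open>The fields \<open>mult\<close> and \<open>one\<close> of a module record carry no meaning.\<close>

definition tensor ::
    "('u, 'u, 'x) module_scheme \<Rightarrow> ('u, 'u, 'y) module_scheme \<Rightarrow> ('u, 'u) module"
    (infixr \<open>\<otimes>\<^sub>k\<close> 75) where
  "M \<otimes>\<^sub>k N =
    \<lparr>carrier = tensor_class M N ` lists (carrier M \<times> carrier N),
     mult = undefined,
     one = undefined,
     zero = tensor_class M N [],
     add = (\<lambda>s t. tensor_class M N (decode s @ decode t)),
     smult = (\<lambda>a t. tensor_class M N (map (\<lambda>(m, n). (a \<odot>\<^bsub>M\<^esub> m, n)) (decode t)))\<rparr>"

definition pure ::
    "('u, 'u, 'x) module_scheme \<Rightarrow> ('u, 'u, 'y) module_scheme \<Rightarrow> 'u \<Rightarrow> 'u \<Rightarrow> 'u" where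
  "pure M N m n = tensor_class M N [(m, n)]"

text \<open>
  Sweedler sums: if \<open>t\<close> is the tensor \<open>m\<^sub>1 \<otimes> n\<^sub>1 + \<dots> + m\<^sub>r \<otimes> n\<^sub>r\<close>, then \<open>tsum P t f\<close> is the element
  \<open>f m\<^sub>1 n\<^sub>1 + \<dots> + f m\<^sub>r n\<^sub>r\<close> of \<open>P\<close>. It does not depend on the representation of \<open>t\<close> when \<open>f\<close> is
  bilinear, which is the only way it is used below.
\<close>

definition tsum :: "('u, 'u, 'x) module_scheme \<Rightarrow> 'u \<Rightarrow> ('u \<Rightarrow> 'u \<Rightarrow> 'u) \<Rightarrow> 'u" where
  "tsum P t f = foldr (\<lambda>(m, n) s. f m n \<oplus>\<^bsub>P\<^esub> s) (decode t) \<zero>\<^bsub>P\<^esub>"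

definition ground :: "('u, 'u) module" where
  "ground = \<lparr>carrier = carrier K, mult = mult K, one = one K, zero = zero K, add = add K,
             smult = mult K\<rparr>"

definition lin ::
    "('u, 'u, 'x) module_scheme \<Rightarrow> ('u, 'u, 'y) module_scheme \<Rightarrow> ('u \<Rightarrow> 'u) \<Rightarrow> bool" where
  "lin M N f \<longleftrightarrow> f \<in> carrier M \<rightarrow> carrier N \<and>
     (\<forall>x\<in>carrier M. \<forall>y\<in>carrier M. f (x \<oplus>\<^bsub>M\<^esub> y) = f x \<oplus>\<^bsub>N\<^esub> f y) \<and>
     (\<forall>a\<in>carrier K. \<forall>x\<in>carrier M. f (a \<odot>\<^bsub>M\<^esub> x) = a \<odot>\<^bsub>N\<^esub> f x)"

definition bilin ::
    "('u, 'u, 'x) module_scheme \<Rightarrow> ('u, 'u, 'y) module_scheme \<Rightarrow> ('u, 'u, 'z) module_scheme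
     \<Rightarrow> ('u \<Rightarrow> 'u \<Rightarrow> 'u) \<Rightarrow> bool" where
  "bilin M N P f \<longleftrightarrow> (\<forall>n\<in>carrier N. lin M P (\<lambda>m. f m n)) \<and> (\<forall>m\<in>carrier M. lin N P (f m))"


section \<open>Bialgebras\<close>

text \<open>
  Identities between elements of triple tensor products are stated in the bracketing
  \<open>A \<otimes> (B \<otimes> C)\<close>.
\<close>

context
  fixes H :: "'u bialg"
begin

definition coalgebra :: bool where
  "coalgebra \<longleftrightarrow> module K H \<and> lin H (H \<otimes>\<^sub>k H) (comult H) \<and> lin H ground (counit H) \<and>
     (\<forall>h\<in>carrier H.
       tsum (H \<otimes>\<^sub>k H \<otimes>\<^sub>k H) (comult H h) (\<lambda>h1 h2.
         tsum (H \<otimes>\<^sub>k H \<otimes>\<^sub>k H) (comult H h1) (\<lambda>h11 h12.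
           pure H (H \<otimes>\<^sub>k H) h11 (pure H H h12 h2)))
       = tsum (H \<otimes>\<^sub>k H \<otimes>\<^sub>k H) (comult H h) (\<lambda>h1 h2. pure H (H \<otimes>\<^sub>k H) h1 (comult H h2))) \<and>
     (\<forall>h\<in>carrier H.
       tsum H (comult H h) (\<lambda>h1 h2. counit H h1 \<odot>\<^bsub>H\<^esub> h2) = h \<and>
       tsum H (comult H h) (\<lambda>h1 h2. counit H h2 \<odot>\<^bsub>H\<^esub> h1) = h)"

definition bialgebra :: bool where
  "bialgebra \<longleftrightarrow> field K \<and> module K H \<and> ring H \<and> bilin H H H (mult H) \<and> coalgebra \<and>
     (\<forall>g\<in>carrier H. \<forall>h\<in>carrier H.
       comult H (g \<otimes>\<^bsub>H\<^esub> h)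
       = tsum (H \<otimes>\<^sub>k H) (comult H g) (\<lambda>g1 g2.
           tsum (H \<otimes>\<^sub>k H) (comult H h) (\<lambda>h1 h2. pure H H (g1 \<otimes>\<^bsub>H\<^esub> h1) (g2 \<otimes>\<^bsub>H\<^esub> h2)))) \<and>
     comult H \<one>\<^bsub>H\<^esub> = pure H H \<one>\<^bsub>H\<^esub> \<one>\<^bsub>H\<^esub> \<and>
     (\<forall>g\<in>carrier H. \<forall>h\<in>carrier H. counit H (g \<otimes>\<^bsub>H\<^esub> h) = counit H g \<otimes>\<^bsub>K\<^esub> counit H h) \<and>
     counit H \<one>\<^bsub>H\<^esub> = \<one>\<^bsub>K\<^esub>"

definition skew_antipode :: "('u \<Rightarrow> 'u) \<Rightarrow> bool" where
  "skew_antipode T \<longleftrightarrow> lin H H T \<and>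
     (\<forall>h\<in>carrier H.
       tsum H (comult H h) (\<lambda>h1 h2. T h2 \<otimes>\<^bsub>H\<^esub> h1) = counit H h \<odot>\<^bsub>H\<^esub> \<one>\<^bsub>H\<^esub> \<and>
       tsum H (comult H h) (\<lambda>h1 h2. h2 \<otimes>\<^bsub>H\<^esub> T h1) = counit H h \<odot>\<^bsub>H\<^esub> \<one>\<^bsub>H\<^esub>)"


section \<open>The category \<open>LR(H)\<close>\<close>

definition H_bimodule :: "'u lr_module \<Rightarrow> bool" where
  "H_bimodule M \<longleftrightarrow> module K M \<and> bilin H M M (lact M) \<and> bilin M H M (ract M) \<and>
     (\<forall>m\<in>carrier M. lact M \<one>\<^bsub>H\<^esub> m = m \<and> ract M m \<one>\<^bsub>H\<^esub> = m) \<and>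
     (\<forall>g\<in>carrier H. \<forall>h\<in>carrier H. \<forall>m\<in>carrier M.
       lact M (g \<otimes>\<^bsub>H\<^esub> h) m = lact M g (lact M h m) \<and>
       ract M m (g \<otimes>\<^bsub>H\<^esub> h) = ract M (ract M m g) h \<and>
       ract M (lact M g m) h = lact M g (ract M m h))"

definition H_bicomodule :: "'u lr_module \<Rightarrow> bool" where
  "H_bicomodule M \<longleftrightarrow> module K M \<and> lin M (H \<otimes>\<^sub>k M) (lcoact M) \<and> lin M (M \<otimes>\<^sub>k H) (rcoact M) \<and>
     (\<forall>m\<in>carrier M.
       tsum M (lcoact M m) (\<lambda>a x. counit H a \<odot>\<^bsub>M\<^esub> x) = m \<and>
       tsum M (rcoact M m) (\<lambda>x b. counit H b \<odot>\<^bsub>M\<^esub> x) = m \<and>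
       tsum (H \<otimes>\<^sub>k H \<otimes>\<^sub>k M) (lcoact M m) (\<lambda>a x.
         tsum (H \<otimes>\<^sub>k H \<otimes>\<^sub>k M) (comult H a) (\<lambda>a1 a2. pure H (H \<otimes>\<^sub>k M) a1 (pure H M a2 x)))
       = tsum (H \<otimes>\<^sub>k H \<otimes>\<^sub>k M) (lcoact M m) (\<lambda>a x. pure H (H \<otimes>\<^sub>k M) a (lcoact M x)) \<and>
       tsum (M \<otimes>\<^sub>k H \<otimes>\<^sub>k H) (rcoact M m) (\<lambda>x b.
         tsum (M \<otimes>\<^sub>k H \<otimes>\<^sub>k H) (rcoact M x) (\<lambda>y a. pure M (H \<otimes>\<^sub>k H) y (pure H H a b)))
       = tsum (M \<otimes>\<^sub>k H \<otimes>\<^sub>k H) (rcoact M m) (\<lambda>x b. pure M (H \<otimes>\<^sub>k H) x (comult H b)) \<and>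
       tsum (H \<otimes>\<^sub>k M \<otimes>\<^sub>k H) (rcoact M m) (\<lambda>x b.
         tsum (H \<otimes>\<^sub>k M \<otimes>\<^sub>k H) (lcoact M x) (\<lambda>a y. pure H (M \<otimes>\<^sub>k H) a (pure M H y b)))
       = tsum (H \<otimes>\<^sub>k M \<otimes>\<^sub>k H) (lcoact M m) (\<lambda>a x. pure H (M \<otimes>\<^sub>k H) a (rcoact M x)))"

definition lr_object :: "'u lr_module \<Rightarrow> bool" where
  "lr_object M \<longleftrightarrow> H_bimodule M \<and> H_bicomodule M \<and>
     (\<forall>h\<in>carrier H. \<forall>m\<in>carrier M.
       tsum (H \<otimes>\<^sub>k M) (comult H h) (\<lambda>h1 h2.
         tsum (H \<otimes>\<^sub>k M) (lcoact M (lact M h1 m)) (\<lambda>a x. pure H M (a \<otimes>\<^bsub>H\<^esub> h2) x))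
       = tsum (H \<otimes>\<^sub>k M) (comult H h) (\<lambda>h1 h2.
           tsum (H \<otimes>\<^sub>k M) (lcoact M m) (\<lambda>a x. pure H M (h1 \<otimes>\<^bsub>H\<^esub> a) (lact M h2 x))) \<and>
       rcoact M (lact M h m)
       = tsum (M \<otimes>\<^sub>k H) (rcoact M m) (\<lambda>x b. pure M H (lact M h x) b) \<and>
       tsum (M \<otimes>\<^sub>k H) (comult H h) (\<lambda>h1 h2.
         tsum (M \<otimes>\<^sub>k H) (rcoact M (ract M m h2)) (\<lambda>x b. pure M H x (h1 \<otimes>\<^bsub>H\<^esub> b)))
       = tsum (M \<otimes>\<^sub>k H) (comult H h) (\<lambda>h1 h2.
           tsum (M \<otimes>\<^sub>k H) (rcoact M m) (\<lambda>x b. pure M H (ract M x h1) (b \<otimes>\<^bsub>H\<^esub> h2))) \<and>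
       lcoact M (ract M m h)
       = tsum (H \<otimes>\<^sub>k M) (lcoact M m) (\<lambda>a x. pure H M a (ract M x h)))"

definition lr_morphism :: "'u lr_module \<Rightarrow> 'u lr_module \<Rightarrow> ('u \<Rightarrow> 'u) \<Rightarrow> bool" where
  "lr_morphism M N f \<longleftrightarrow> lin M N f \<and>
     (\<forall>h\<in>carrier H. \<forall>m\<in>carrier M.
       f (lact M h m) = lact N h (f m) \<and> f (ract M m h) = ract N (f m) h) \<and>
     (\<forall>m\<in>carrier M.
       lcoact N (f m) = tsum (H \<otimes>\<^sub>k N) (lcoact M m) (\<lambda>a x. pure H N a (f x)) \<and>
       rcoact N (f m) = tsum (N \<otimes>\<^sub>k H) (rcoact M m) (\<lambda>x b. pure N H (f x) b))"

definition lr_hom :: "'u lr_module \<Rightarrow> 'u lr_module \<Rightarrow> 'u lr_arrow set" where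
  "lr_hom M N =
     {\<phi>. src \<phi> = M \<and> tgt \<phi> = N \<and> fn \<phi> \<in> extensional (carrier M) \<and> lr_morphism M N (fn \<phi>)}"

definition lr_unit :: "'u lr_module" where
  "lr_unit = module.extend ground (lr_module.fields
     (\<lambda>h x. counit H h \<otimes>\<^bsub>K\<^esub> x)
     (\<lambda>x h. x \<otimes>\<^bsub>K\<^esub> counit H h)
     (\<lambda>x. pure H ground \<one>\<^bsub>H\<^esub> x)
     (\<lambda>x. pure ground H x \<one>\<^bsub>H\<^esub>))"

definition lr_tensor :: "'u lr_module \<Rightarrow> 'u lr_module \<Rightarrow> 'u lr_module" (infixr \<open>\<otimes>\<^sub>L\<^sub>R\<close> 75) where
  "M \<otimes>\<^sub>L\<^sub>R N = module.extend (M \<otimes>\<^sub>k N) (lr_module.fields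
     (\<lambda>h t. tsum (M \<otimes>\<^sub>k N) (comult H h) (\<lambda>h1 h2.
        tsum (M \<otimes>\<^sub>k N) t (\<lambda>m n. pure M N (lact M h1 m) (lact N h2 n))))
     (\<lambda>t h. tsum (M \<otimes>\<^sub>k N) (comult H h) (\<lambda>h1 h2.
        tsum (M \<otimes>\<^sub>k N) t (\<lambda>m n. pure M N (ract M m h1) (ract N n h2))))
     (\<lambda>t. tsum (H \<otimes>\<^sub>k M \<otimes>\<^sub>k N) t (\<lambda>m n.
        tsum (H \<otimes>\<^sub>k M \<otimes>\<^sub>k N) (lcoact M m) (\<lambda>a x.
          tsum (H \<otimes>\<^sub>k M \<otimes>\<^sub>k N) (lcoact N n) (\<lambda>b y.
            pure H (M \<otimes>\<^sub>k N) (a \<otimes>\<^bsub>H\<^esub> b) (pure M N x y)))))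
     (\<lambda>t. tsum ((M \<otimes>\<^sub>k N) \<otimes>\<^sub>k H) t (\<lambda>m n.
        tsum ((M \<otimes>\<^sub>k N) \<otimes>\<^sub>k H) (rcoact M m) (\<lambda>x a.
          tsum ((M \<otimes>\<^sub>k N) \<otimes>\<^sub>k H) (rcoact N n) (\<lambda>y b.
            pure (M \<otimes>\<^sub>k N) H (pure M N x y) (a \<otimes>\<^bsub>H\<^esub> b))))))"

definition arrow :: "'u lr_module \<Rightarrow> 'u lr_module \<Rightarrow> ('u \<Rightarrow> 'u) \<Rightarrow> 'u lr_arrow" where
  "arrow M N f = \<lparr>src = M, fn = restrict f (carrier M), tgt = N\<rparr>"

definition LR :: "('u lr_module, 'u lr_arrow) monoidal_category" where
  "LR =
    \<lparr>Ob = {M. lr_object M},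
     Hom = lr_hom,
     Id = (\<lambda>M. arrow M M (\<lambda>m. m)),
     Comp = (\<lambda>\<psi> \<phi>. arrow (src \<phi>) (tgt \<psi>) (fn \<psi> \<circ> fn \<phi>)),
     TensO = (\<otimes>\<^sub>L\<^sub>R),
     TensA = (\<lambda>\<phi> \<psi>. arrow (src \<phi> \<otimes>\<^sub>L\<^sub>R src \<psi>) (tgt \<phi> \<otimes>\<^sub>L\<^sub>R tgt \<psi>)
       (\<lambda>t. tsum (tgt \<phi> \<otimes>\<^sub>k tgt \<psi>) t (\<lambda>m n. pure (tgt \<phi>) (tgt \<psi>) (fn \<phi> m) (fn \<psi> n)))),
     Unit = lr_unit,
     Assoc = (\<lambda>L M N. arrow ((L \<otimes>\<^sub>L\<^sub>R M) \<otimes>\<^sub>L\<^sub>R N) (L \<otimes>\<^sub>L\<^sub>R (M \<otimes>\<^sub>L\<^sub>R N))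
       (\<lambda>t. tsum (L \<otimes>\<^sub>k M \<otimes>\<^sub>k N) t (\<lambda>s n. tsum (L \<otimes>\<^sub>k M \<otimes>\<^sub>k N) s (\<lambda>l m.
          pure L (M \<otimes>\<^sub>k N) l (pure M N m n))))),
     Lunit = (\<lambda>M. arrow (lr_unit \<otimes>\<^sub>L\<^sub>R M) M (\<lambda>t. tsum M t (\<lambda>a m. a \<odot>\<^bsub>M\<^esub> m))),
     Runit = (\<lambda>M. arrow (M \<otimes>\<^sub>L\<^sub>R lr_unit) M (\<lambda>t. tsum M t (\<lambda>m a. a \<odot>\<^bsub>M\<^esub> m)))\<rparr>"

text \<open>The right hand sides of the formulas for \<open>c(m \<otimes> n)\<close> and, with \<open>T\<close> for the skew antipode,
  \<open>c\<^sup>-\<^sup>1(n \<otimes> m)\<close>, and the maps on tensor products which they define.\<close>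

definition lr_braid_pure :: "'u lr_module \<Rightarrow> 'u lr_module \<Rightarrow> 'u \<Rightarrow> 'u \<Rightarrow> 'u" where
  "lr_braid_pure M N m n =
     tsum (N \<otimes>\<^sub>k M) (lcoact M m) (\<lambda>a m0.
       tsum (N \<otimes>\<^sub>k M) (rcoact N n) (\<lambda>n0 b.
         pure N M (lact N a n0) (ract M m0 b)))"

definition lr_braid :: "'u lr_module \<Rightarrow> 'u lr_module \<Rightarrow> 'u lr_arrow" where
  "lr_braid M N =
     arrow (M \<otimes>\<^sub>L\<^sub>R N) (N \<otimes>\<^sub>L\<^sub>R M) (\<lambda>t. tsum (N \<otimes>\<^sub>k M) t (lr_braid_pure M N))"

definition lr_braid_inv_pure ::
    "('u \<Rightarrow> 'u) \<Rightarrow> 'u lr_module \<Rightarrow> 'u lr_module \<Rightarrow> 'u \<Rightarrow> 'u \<Rightarrow> 'u" where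
  "lr_braid_inv_pure T M N n m =
     tsum (M \<otimes>\<^sub>k N) (lcoact M m) (\<lambda>a m0.
       tsum (M \<otimes>\<^sub>k N) (rcoact N n) (\<lambda>n0 b.
         pure M N (ract M m0 (T b)) (lact N (T a) n0)))"

definition lr_braid_inv :: "('u \<Rightarrow> 'u) \<Rightarrow> 'u lr_module \<Rightarrow> 'u lr_module \<Rightarrow> 'u lr_arrow" where
  "lr_braid_inv T M N =
     arrow (N \<otimes>\<^sub>L\<^sub>R M) (M \<otimes>\<^sub>L\<^sub>R N) (\<lambda>t. tsum (M \<otimes>\<^sub>k N) t (lr_braid_inv_pure T M N))"

end

end

end

theory Submission
  imports Defs
begin

text \<open>
  An identity between tensors is the same as the family of its images under all multilinear maps, so
  every axiom is turned into a rule for Sweedler sums with an arbitrary multilinear summand, and every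
  equation between linear maps out of a tensor product is checked on pure tensors.

  For \<open>c\<^bsub>M,N\<^esub>\<close>, left \<open>H\<close>-linearity combines the Yetter-Drinfeld
  condition relating left action and left coaction on \<open>M\<close> with the Long condition relating left action
  and right coaction on \<open>N\<close>; left colinearity, right linearity and right colinearity are analogous.
  The hexagons amount to coassociativity of the left coaction of \<open>M\<close> and of the right coaction of the
  last factor. After the Long conditions and coassociativity, \<open>c\<^sup>-\<^sup>1 c\<close> and \<open>c c\<^sup>-\<^sup>1\<close> each contain one
  skew antipode identity for each coaction.
\<close>

section \<open>Tensor products\<close>

text \<open>Why a skew antipode: in c^{-1} c the second map coacts anew on m^(0), so T is applied to
  the factor h_2 of h = m^(-1), while h_1 has already acted on N; the left actions compose to T(h_2)
  h_1. For h = n^<1> the second map sees h_1 and the right actions compose to h_2 T(h_1). In c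
  c^{-1} the same two identities occur with the roles of M and N exchanged. That c^{-1} is a
  morphism is never computed, since the inverse of a bijective morphism is one. The obstacle is
  formal. A Sweedler sum is evaluated on a chosen list, so nearly every rewriting step carries
  multilinearity conditions under binders; the rules are arranged so that the simplifier settles
  them. The interchange of sums has no natural direction and is applied in instances that name the
  two tensors and thereby decide which sum moves inwards. Rules whose summand is applied to a
  product in H lie outside higher-order patterns, so that the summand is given explicitly.\<close>

definition lsum ::
    "('u, 'u, 'x) module_scheme \<Rightarrow> ('u, 'u, 'y) module_scheme \<Rightarrow> ('u, 'u, 'z) module_scheme
     \<Rightarrow> ('u \<Rightarrow> 'u \<Rightarrow> 'u) \<Rightarrow> ('u \<times> 'u) list \<Rightarrow> 'u" where
  "lsum A B P f xs = foldr (\<lambda>(m, n) s.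
     if m \<in> carrier A \<and> n \<in> carrier B \<and> f m n \<in> carrier P then f m n \<oplus>\<^bsub>P\<^esub> s else s) xs \<zero>\<^bsub>P\<^esub>"

text \<open>
  In contrast to \<open>tsum\<close>, terms outside of the carriers are dropped. This makes the congruence rule and
  the interchange of two sums unconditional in the tensors and summands; \<open>tsum_TS\<close> relates the two.
\<close>

definition TS ::
    "('u::infinite, 'u, 'x) module_scheme \<Rightarrow> ('u, 'u, 'y) module_scheme \<Rightarrow> ('u, 'u, 'z) module_scheme
     \<Rightarrow> 'u \<Rightarrow> ('u \<Rightarrow> 'u \<Rightarrow> 'u) \<Rightarrow> 'u" where
  "TS A B P t f = lsum A B P f (decode t)"

lemma decode_encode [simp]: "decode (encode xs) = xs"
  unfolding decode_def by (rule inv_into_f_f[OF inj_encode]) simp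

lemma lsum_Nil [simp]: "lsum A B P f [] = \<zero>\<^bsub>P\<^esub>"
  by (simp add: lsum_def)

lemma lsum_Cons: "lsum A B P f ((m, n) # xs) =
    (if m \<in> carrier A \<and> n \<in> carrier B \<and> f m n \<in> carrier P
     then f m n \<oplus>\<^bsub>P\<^esub> lsum A B P f xs else lsum A B P f xs)"
  by (simp add: lsum_def)

lemma lsum_cong:
  "(\<And>a b. a \<in> carrier A \<Longrightarrow> b \<in> carrier B \<Longrightarrow> f a b = g a b) \<Longrightarrow> lsum A B P f xs = lsum A B P g xs"
  by (induction xs) (auto simp: lsum_Cons)

text \<open>As a congruence rule it lets the simplifier assume, inside a Sweedler sum, that the
  bound variables lie in their carriers. The closure and linearity premises of the later rules are
  discharged from this.\<close>

lemma TS_cong [cong]: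
  "A = A' \<Longrightarrow> B = B' \<Longrightarrow> P = P' \<Longrightarrow> t = t' \<Longrightarrow>
   (\<And>a b. a \<in> carrier A' \<Longrightarrow> b \<in> carrier B' \<Longrightarrow> f a b = g a b) \<Longrightarrow>
   TS A B P t f = TS A' B' P' t' g"
  unfolding TS_def by (auto intro: lsum_cong)

section \<open>Finite sums indexed by formal sums\<close>

locale vector_spaces =
  fixes K :: "'u::infinite ring"
  assumes cring_K: "cring K"
begin

lemma module_abelian_group: "module K P \<Longrightarrow> abelian_group P"
  by (simp add: module_def)

lemma zero_closed [simp]: "module K P \<Longrightarrow> \<zero>\<^bsub>P\<^esub> \<in> carrier P"
  and add_closed [simp]:
    "module K P \<Longrightarrow> x \<in> carrier P \<Longrightarrow> y \<in> carrier P \<Longrightarrow> x \<oplus>\<^bsub>P\<^esub> y \<in> carrier P"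
  and smult_closed [simp]:
    "module K P \<Longrightarrow> a \<in> carrier K \<Longrightarrow> x \<in> carrier P \<Longrightarrow> a \<odot>\<^bsub>P\<^esub> x \<in> carrier P"
  by (simp_all add: module_abelian_group abelian_groupE(1,2) module.smult_closed)

lemma lsum_closed [simp]: "module K P \<Longrightarrow> lsum A B P f xs \<in> carrier P"
  by (induction xs) (auto simp: lsum_Cons)

lemma TS_closed [simp]: "module K P \<Longrightarrow> TS A B P t f \<in> carrier P"
  by (simp add: TS_def)

lemma lsum_append:
  assumes "module K P"
  shows "lsum A B P f (xs @ ys) = lsum A B P f xs \<oplus>\<^bsub>P\<^esub> lsum A B P f ys"
proof -
  interpret abelian_group P using assms by (rule module_abelian_group)
  show ?thesis using assms by (induction xs) (auto simp: lsum_Cons a_assoc)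
qed

lemma lsum_zero: "module K P \<Longrightarrow> lsum A B P (\<lambda>_ _. \<zero>\<^bsub>P\<^esub>) xs = \<zero>\<^bsub>P\<^esub>"
  by (induction xs) (auto simp: lsum_Cons abelian_monoid.l_zero module_abelian_group abelian_group.axioms)

lemma lsum_add:
  assumes P: "module K P"
    and f: "\<And>a b. a \<in> carrier A \<Longrightarrow> b \<in> carrier B \<Longrightarrow> f a b \<in> carrier P"
    and g: "\<And>a b. a \<in> carrier A \<Longrightarrow> b \<in> carrier B \<Longrightarrow> g a b \<in> carrier P"
  shows "lsum A B P (\<lambda>a b. f a b \<oplus>\<^bsub>P\<^esub> g a b) xs = lsum A B P f xs \<oplus>\<^bsub>P\<^esub> lsum A B P g xs"
proof -
  interpret abelian_group P using P by (rule module_abelian_group)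
  show ?thesis using P f g by (induction xs) (auto simp: lsum_Cons a_ac)
qed

lemma lsum_swap:
  assumes P: "module K P"
  shows "lsum A B P (\<lambda>a b. lsum C D P (f a b) ys) xs = lsum C D P (\<lambda>c d. lsum A B P (\<lambda>a b. f a b c d) xs) ys"
proof -
  interpret abelian_group P using P by (rule module_abelian_group)
  show ?thesis
  proof (induction xs)
    case Nil
    show ?case using P by (simp add: lsum_zero)
  next
    case (Cons x xs)
    obtain a b where x: "x = (a, b)" by force
    show ?case
    proof (cases "a \<in> carrier A \<and> b \<in> carrier B")
      case True
      \<comment> \<open>The head \<open>(a, b)\<close> contributes \<open>f a b c d\<close> to every
        inner sum on the right; a second induction, on \<open>ys\<close>, collects these
        contributions. Values outside of \<open>P\<close> are dropped on both sides.\<close>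
      have "lsum C D P (\<lambda>c d. lsum A B P (\<lambda>a b. f a b c d) ((a, b) # xs)) ys
        = lsum C D P (f a b) ys \<oplus>\<^bsub>P\<^esub> lsum C D P (\<lambda>c d. lsum A B P (\<lambda>a b. f a b c d) xs) ys"
        using True P by (induction ys) (auto simp: lsum_Cons a_ac)
      then show ?thesis using True Cons.IH P by (simp add: x lsum_Cons)
    next
      case False
      then have "lsum A B P g ((a, b) # xs) = lsum A B P g xs" for g
        by (auto simp: lsum_Cons)
      then show ?thesis using Cons.IH by (simp add: x)
    qed
  qed
qed

lemma TS_swap:
  assumes "module K P"
  shows "TS A B P s (\<lambda>a b. TS C D P t (f a b)) = TS C D P t (\<lambda>c d. TS A B P s (\<lambda>a b. f a b c d))"
  unfolding TS_def by (rule lsum_swap[OF assms])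

lemma TS_add:
  assumes "module K P"
    and "\<And>a b. a \<in> carrier A \<Longrightarrow> b \<in> carrier B \<Longrightarrow> f a b \<in> carrier P"
    and "\<And>a b. a \<in> carrier A \<Longrightarrow> b \<in> carrier B \<Longrightarrow> g a b \<in> carrier P"
  shows "TS A B P t (\<lambda>a b. f a b \<oplus>\<^bsub>P\<^esub> g a b) = TS A B P t f \<oplus>\<^bsub>P\<^esub> TS A B P t g"
  unfolding TS_def by (rule lsum_add[OF assms])

section \<open>Linear and bilinear maps\<close>

lemma linI:
  assumes "\<And>x. x \<in> carrier M \<Longrightarrow> f x \<in> carrier N"
    and "\<And>x y. x \<in> carrier M \<Longrightarrow> y \<in> carrier M \<Longrightarrow> f (x \<oplus>\<^bsub>M\<^esub> y) = f x \<oplus>\<^bsub>N\<^esub> f y"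
    and "\<And>a x. a \<in> carrier K \<Longrightarrow> x \<in> carrier M \<Longrightarrow> f (a \<odot>\<^bsub>M\<^esub> x) = a \<odot>\<^bsub>N\<^esub> f x"
  shows "lin K M N f"
  using assms by (auto simp: lin_def)

lemma lin_closed: "lin K M N f \<Longrightarrow> x \<in> carrier M \<Longrightarrow> f x \<in> carrier N"
  and lin_add: "lin K M N f \<Longrightarrow> x \<in> carrier M \<Longrightarrow> y \<in> carrier M \<Longrightarrow> f (x \<oplus>\<^bsub>M\<^esub> y) = f x \<oplus>\<^bsub>N\<^esub> f y"
  and lin_smult: "lin K M N f \<Longrightarrow> a \<in> carrier K \<Longrightarrow> x \<in> carrier M \<Longrightarrow> f (a \<odot>\<^bsub>M\<^esub> x) = a \<odot>\<^bsub>N\<^esub> f x"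
  by (auto simp: lin_def)

lemma lin_zero:
  assumes "module K M" "module K N" "lin K M N f"
  shows "f \<zero>\<^bsub>M\<^esub> = \<zero>\<^bsub>N\<^esub>"
proof -
  interpret M: module K M by fact
  interpret N: module K N by fact
  have "f \<zero>\<^bsub>M\<^esub> \<oplus>\<^bsub>N\<^esub> f \<zero>\<^bsub>M\<^esub> = f (\<zero>\<^bsub>M\<^esub> \<oplus>\<^bsub>M\<^esub> \<zero>\<^bsub>M\<^esub>)"
    using lin_add[OF assms(3) M.M.zero_closed M.M.zero_closed] by simp
  then show ?thesis
    using lin_closed[OF assms(3) M.M.zero_closed] by (simp add: N.M.add.l_cancel_one)
qed

lemma lin_lsum:
  assumes "module K P" "module K Q" "lin K P Q g"
    and f: "\<And>a b. a \<in> carrier A \<Longrightarrow> b \<in> carrier B \<Longrightarrow> f a b \<in> carrier P"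
  shows "g (lsum A B P f xs) = lsum A B Q (\<lambda>a b. g (f a b)) xs"
proof (induction xs)
  case Nil
  show ?case using lin_zero[OF assms(1-3)] by simp
next
  case (Cons x xs)
  then show ?case
    using f lin_closed[OF assms(3)] lin_add[OF assms(3)] assms(1)
    by (cases x) (simp add: lsum_Cons)
qed

lemma lin_TS:
  assumes "module K P" "module K Q" "lin K P Q g"
    and "\<And>a b. a \<in> carrier A \<Longrightarrow> b \<in> carrier B \<Longrightarrow> f a b \<in> carrier P"
  shows "g (TS A B P t f) = TS A B Q t (\<lambda>a b. g (f a b))"
  unfolding TS_def by (rule lin_lsum[OF assms])

lemma bilin_D1: "bilin K M N P f \<Longrightarrow> n \<in> carrier N \<Longrightarrow> lin K M P (\<lambda>m. f m n)"
  and bilin_D2: "bilin K M N P f \<Longrightarrow> m \<in> carrier M \<Longrightarrow> lin K N P (f m)"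
  and bilinI: "(\<And>n. n \<in> carrier N \<Longrightarrow> lin K M P (\<lambda>m. f m n)) \<Longrightarrow>
    (\<And>m. m \<in> carrier M \<Longrightarrow> lin K N P (f m)) \<Longrightarrow> bilin K M N P f"
  by (auto simp: bilin_def)

text \<open>The universal property at the level of formal sums: each generator of
  \<open>tensor_rel\<close> is matched by a law of addition in \<open>P\<close> or by a bilinearity
  law of \<open>f\<close>. The lists may be arbitrary, since \<open>lsum\<close> ignores the pairs
  outside of the carriers that \<open>refl\<close> and \<open>comm\<close> admit.\<close>

lemma lsum_tensor_rel:
  assumes M: "module K M" and N: "module K N" and P: "module K P" and f: "bilin K M N P f"
  shows "tensor_rel K M N xs ys \<Longrightarrow> lsum M N P f xs = lsum M N P f ys"
proof (induction rule: tensor_rel.induct)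
  case (append xs xs' ys ys')
  then show ?case using P by (simp add: lsum_append)
next
  case (comm xs ys)
  interpret P: module K P by fact
  show ?case using P by (simp add: lsum_append P.a_comm)
next
  case (zero n)
  interpret P: module K P by fact
  show ?case using zero M P lin_zero[OF M P bilin_D1[OF f zero]] by (simp add: lsum_Cons)
next
  case (add_left m m' n)
  interpret P: module K P by fact
  note l = bilin_D1[OF f \<open>n \<in> carrier N\<close>]
  show ?case using add_left M P lin_add[OF l] lin_closed[OF l] by (simp add: lsum_Cons P.a_assoc)
next
  case (add_right m n n')
  interpret P: module K P by fact
  note l = bilin_D2[OF f \<open>m \<in> carrier M\<close>]
  show ?case using add_right N P lin_add[OF l] lin_closed[OF l] by (simp add: lsum_Cons P.a_assoc)
next
  case (smult a m n)
  note l = bilin_D2[OF f \<open>m \<in> carrier M\<close>] and l' = bilin_D1[OF f \<open>n \<in> carrier N\<close>]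
  show ?case using smult M N P lin_smult[OF l] lin_closed[OF l]  lin_smult[OF l'] lin_closed[OF l']
    by (simp add: lsum_Cons)
qed simp_all

section \<open>Classes of formal sums and their module structure\<close>

lemma tensor_class_eqI:
  assumes "tensor_rel K M N xs ys"
  shows "tensor_class K M N xs = tensor_class K M N ys"
proof -
  \<comment> \<open>Related lists have the same relatives, so the choice in
    \<open>tensor_class\<close> is made from the same set and gives the same list.\<close>
  have "tensor_rel K M N xs zs \<longleftrightarrow> tensor_rel K M N ys zs" for zs
    using assms tensor_rel.trans tensor_rel.sym by metis
  then show ?thesis by (simp add: tensor_class_def)
qed

lemma decode_tensor_class:
  assumes "xs \<in> lists (carrier M \<times> carrier N)"
  shows "decode (tensor_class K M N xs) \<in> lists (carrier M \<times> carrier N)"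
    and "tensor_rel K M N xs (decode (tensor_class K M N xs))"
proof -
  have "decode (tensor_class K M N xs) \<in> lists (carrier M \<times> carrier N)
    \<and> tensor_rel K M N xs (decode (tensor_class K M N xs))"
    unfolding tensor_class_def decode_encode
    by (rule someI[of _ xs]) (use assms tensor_rel.refl in blast)
  then show "decode (tensor_class K M N xs) \<in> lists (carrier M \<times> carrier N)"
    and "tensor_rel K M N xs (decode (tensor_class K M N xs))" by (simp_all only:)
qed

abbreviation cls where "cls M N \<equiv> tensor_class K M N"
abbreviation tens (infixr \<open>\<boxtimes>\<close> 75) where "M \<boxtimes> N \<equiv> tensor K M N"

lemma carrier_tensor: "carrier (M \<boxtimes> N) = cls M N ` lists (carrier M \<times> carrier N)"
  and zero_tensor: "\<zero>\<^bsub>M \<boxtimes> N\<^esub> = cls M N []"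
  by (simp_all add: tensor_def)

lemma decode_in_lists:
  "t \<in> carrier (M \<boxtimes> N) \<Longrightarrow> decode t \<in> lists (carrier M \<times> carrier N)"
  unfolding carrier_tensor by (erule imageE) (simp only: decode_tensor_class(1))

lemma class_decode: "t \<in> carrier (M \<boxtimes> N) \<Longrightarrow> cls M N (decode t) = t"
  unfolding carrier_tensor
  by (erule imageE) (simp only: tensor_class_eqI[OF decode_tensor_class(2), symmetric])

lemma add_class:
  assumes "xs \<in> lists (carrier M \<times> carrier N)" "ys \<in> lists (carrier M \<times> carrier N)"
  shows "cls M N xs \<oplus>\<^bsub>M \<boxtimes> N\<^esub> cls M N ys = cls M N (xs @ ys)"
  by (simp add: tensor_def, rule tensor_class_eqI[symmetric],
      intro tensor_rel.append decode_tensor_class(2) assms)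

lemma tensor_rel_map_smult:
  assumes M: "module K M" and N: "module K N" and a: "a \<in> carrier K"
  shows "tensor_rel K M N xs ys \<Longrightarrow>
    tensor_rel K M N (map (\<lambda>(m, n). (a \<odot>\<^bsub>M\<^esub> m, n)) xs) (map (\<lambda>(m, n). (a \<odot>\<^bsub>M\<^esub> m, n)) ys)"
proof (induction rule: tensor_rel.induct)
  case (trans xs ys zs)
  then show ?case by (blast intro: tensor_rel.trans)
next
  case (zero n)
  then show ?case using a by (simp add: module.smult_r_null[OF M] tensor_rel.zero)
next
  case (add_left m m' n)
  then show ?case using a M by (simp add: module.smult_r_distr[OF M] tensor_rel.add_left)
next
  case (add_right m n n')
  then show ?case using a M by (simp add: tensor_rel.add_right)
next
  case (smult b m n)
  \<comment> \<open>The scalar \<open>b\<close> must be outermost to cross the tensor sign;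
    commutativity of \<open>K\<close> brings it there.\<close>
  have "a \<odot>\<^bsub>M\<^esub> (b \<odot>\<^bsub>M\<^esub> m) = b \<odot>\<^bsub>M\<^esub> (a \<odot>\<^bsub>M\<^esub> m)"
    using smult a by (metis M module.smult_assoc1 cring.cring_simprules(14) cring_K)
  then show ?case using smult a M by (simp add: tensor_rel.smult)
qed (auto intro: tensor_rel.intros)

lemma smult_class:
  assumes M: "module K M" and N: "module K N" and a: "a \<in> carrier K"
    and xs: "xs \<in> lists (carrier M \<times> carrier N)"
  shows "a \<odot>\<^bsub>M \<boxtimes> N\<^esub> cls M N xs = cls M N (map (\<lambda>(m, n). (a \<odot>\<^bsub>M\<^esub> m, n)) xs)"
  by (simp add: tensor_def, rule tensor_class_eqI[symmetric],
      intro tensor_rel_map_smult[OF M N a] decode_tensor_class(2) xs)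

lemma tensor_rel_Cons: "tensor_rel K M N ys zs \<Longrightarrow> tensor_rel K M N (x # ys) (x # zs)"
  using tensor_rel.append[OF tensor_rel.refl, of K M N ys zs "[x]"] by simp

text \<open>The inductive step for (a + b) t = a t + b t on lists: the head splits in two, and its
  second half has to travel past \<open>xs\<close> to the front of the second list.\<close>

lemma tensor_rel_Cons_Cons:
  assumes "tensor_rel K M N [x] [y, z]"
  shows "tensor_rel K M N (x # xs @ ys) ((y # xs) @ (z # ys))"
proof -
  have "tensor_rel K M N ([x] @ xs @ ys) ([y, z] @ xs @ ys)"
    by (rule tensor_rel.append[OF assms tensor_rel.refl])
  moreover have "tensor_rel K M N ([y] @ (([z] @ xs) @ ys)) ([y] @ ((xs @ [z]) @ ys))"
    by (intro tensor_rel.append tensor_rel.refl tensor_rel.comm)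
  ultimately show ?thesis using tensor_rel.trans by fastforce
qed

text \<open>Every axiom is checked on representing lists, where addition is concatenation and
  scaling acts on the left entries. Most axioms are then equalities of lists; commutativity,
  distributivity over sums of scalars and the existence of negatives go through
  \<open>tensor_rel\<close>.\<close>

lemma tensor_module [simp]:
  assumes M: "module K M" and N: "module K N"
  shows "module K (M \<boxtimes> N)"
proof -
  interpret M: module K M by fact
  interpret N: module K N by fact
  let ?L = "lists (carrier M \<times> carrier N)"
  let ?s = "\<lambda>a. map (\<lambda>(m, n). (a \<odot>\<^bsub>M\<^esub> m, n))"
  have s: "a \<in> carrier K \<Longrightarrow> xs \<in> ?L \<Longrightarrow> ?s a xs \<in> ?L" for a xs
    by (induction xs) auto
  have app: "xs \<in> ?L \<Longrightarrow> ys \<in> ?L \<Longrightarrow> xs @ ys \<in> ?L" for xs ys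
    by simp
  have cl: "xs \<in> ?L \<Longrightarrow> cls M N xs \<in> carrier (M \<boxtimes> N)" for xs
    by (simp add: carrier_tensor)
  note sc = smult_class[OF M N]
  have distr: "tensor_rel K M N (?s (a \<oplus>\<^bsub>K\<^esub> b) xs) (?s a xs @ ?s b xs)"
    if "a \<in> carrier K" "b \<in> carrier K" "xs \<in> ?L" for a b xs
    using that(3)
  proof (induction xs)
    case Nil
    then show ?case by (simp add: tensor_rel.refl)
  next
    case (Cons x xs)
    obtain m n where x: "x = (m, n)" "m \<in> carrier M" "n \<in> carrier N"
      using Cons.hyps by auto
    have "tensor_rel K M N [((a \<oplus>\<^bsub>K\<^esub> b) \<odot>\<^bsub>M\<^esub> m, n)] [(a \<odot>\<^bsub>M\<^esub> m, n), (b \<odot>\<^bsub>M\<^esub> m, n)]"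
      using that x by (simp add: M.smult_l_distr tensor_rel.add_left)
    from tensor_rel_Cons_Cons[OF this] show ?case
      using tensor_rel.trans[OF tensor_rel_Cons[OF Cons.IH]] x(1) by simp
  qed
  have z0: "tensor_rel K M N (?s \<zero>\<^bsub>K\<^esub> xs) []" if "xs \<in> ?L" for xs
    using that
  proof (induction xs)
    case (Cons x xs)
    then show ?case using tensor_rel.append[OF tensor_rel.zero, of _ N K M "?s \<zero>\<^bsub>K\<^esub> xs" "[]"] by auto
  qed (simp add: tensor_rel.refl)
  have s1: "xs \<in> ?L \<Longrightarrow> ?s \<one>\<^bsub>K\<^esub> xs = xs" for xs
    by (induction xs) auto
  have ss: "a \<in> carrier K \<Longrightarrow> b \<in> carrier K \<Longrightarrow> xs \<in> ?L \<Longrightarrow> ?s (a \<otimes>\<^bsub>K\<^esub> b) xs = ?s a (?s b xs)" for a b xs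
    by (induction xs) (auto simp: M.smult_assoc1)
  note ac = add_class[of _ M N]
  have ag: "abelian_group (M \<boxtimes> N)"
  proof (rule abelian_groupI)
    fix x y assume "x \<in> carrier (M \<boxtimes> N)" "y \<in> carrier (M \<boxtimes> N)"
    then obtain xs ys where x: "x = cls M N xs" "xs \<in> ?L" and y: "y = cls M N ys" "ys \<in> ?L"
      by (auto simp: carrier_tensor)
    show "x \<oplus>\<^bsub>M \<boxtimes> N\<^esub> y \<in> carrier (M \<boxtimes> N)"
      unfolding x(1) y(1) ac[OF x(2) y(2)] by (rule cl[OF app[OF x(2) y(2)]])
    show "x \<oplus>\<^bsub>M \<boxtimes> N\<^esub> y = y \<oplus>\<^bsub>M \<boxtimes> N\<^esub> x"
      unfolding x(1) y(1) ac[OF x(2) y(2)] ac[OF y(2) x(2)]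
      by (rule tensor_class_eqI[OF tensor_rel.comm])
    fix z assume "z \<in> carrier (M \<boxtimes> N)"
    then obtain zs where z: "z = cls M N zs" "zs \<in> ?L" by (auto simp: carrier_tensor)
    show "x \<oplus>\<^bsub>M \<boxtimes> N\<^esub> y \<oplus>\<^bsub>M \<boxtimes> N\<^esub> z = x \<oplus>\<^bsub>M \<boxtimes> N\<^esub> (y \<oplus>\<^bsub>M \<boxtimes> N\<^esub> z)"
      unfolding x(1) y(1) z(1) ac[OF x(2) y(2)] ac[OF y(2) z(2)]
        ac[OF x(2) app[OF y(2) z(2)]] ac[OF app[OF x(2) y(2)] z(2)] by simp
  next
    show "\<zero>\<^bsub>M \<boxtimes> N\<^esub> \<in> carrier (M \<boxtimes> N)" unfolding zero_tensor by (rule cl) simp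
  next
    fix x assume "x \<in> carrier (M \<boxtimes> N)"
    then obtain xs where x: "x = cls M N xs" "xs \<in> ?L" by (auto simp: carrier_tensor)
    show "\<zero>\<^bsub>M \<boxtimes> N\<^esub> \<oplus>\<^bsub>M \<boxtimes> N\<^esub> x = x"
      unfolding x(1) zero_tensor using ac[OF lists.Nil x(2)] by simp
    \<comment> \<open>The negative is the multiple by -1: \<open>distr\<close> merges the two lists
      into one scaled by -1 + 1, and \<open>z0\<close> shows that a list scaled by zero is related
      to the empty one.\<close>
    let ?y = "?s (\<ominus>\<^bsub>K\<^esub> \<one>\<^bsub>K\<^esub>) xs"
    have y: "?y \<in> ?L" by (rule s[OF _ x(2)]) simp
    have "tensor_rel K M N (?y @ xs) (?s (\<ominus>\<^bsub>K\<^esub> \<one>\<^bsub>K\<^esub> \<oplus>\<^bsub>K\<^esub> \<one>\<^bsub>K\<^esub>) xs)"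
      using tensor_rel.sym[OF distr[OF _ _ x(2), of "\<ominus>\<^bsub>K\<^esub> \<one>\<^bsub>K\<^esub>" "\<one>\<^bsub>K\<^esub>"]] s1[OF x(2)] by simp
    then have "tensor_rel K M N (?y @ xs) []"
      using tensor_rel.trans[OF _ z0[OF x(2)]] by (simp add: M.R.l_neg)
    then show "\<exists>y\<in>carrier (M \<boxtimes> N). y \<oplus>\<^bsub>M \<boxtimes> N\<^esub> x = \<zero>\<^bsub>M \<boxtimes> N\<^esub>"
      using cl[OF y] ac[OF y x(2)] tensor_class_eqI unfolding x(1) zero_tensor by metis
  qed
  show ?thesis
  proof (rule moduleI[OF cring_K ag])
    fix a x assume a: "a \<in> carrier K" and "x \<in> carrier (M \<boxtimes> N)"
    then obtain xs where x: "x = cls M N xs" "xs \<in> ?L" by (auto simp: carrier_tensor)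
    show "a \<odot>\<^bsub>M \<boxtimes> N\<^esub> x \<in> carrier (M \<boxtimes> N)"
      unfolding x(1) sc[OF a x(2)] by (rule cl[OF s[OF a x(2)]])
    {
      fix b assume b: "b \<in> carrier K"
      show "(a \<oplus>\<^bsub>K\<^esub> b) \<odot>\<^bsub>M \<boxtimes> N\<^esub> x = a \<odot>\<^bsub>M \<boxtimes> N\<^esub> x \<oplus>\<^bsub>M \<boxtimes> N\<^esub> b \<odot>\<^bsub>M \<boxtimes> N\<^esub> x"
        unfolding x(1) sc[OF a x(2)] sc[OF b x(2)] sc[OF M.R.add.m_closed[OF a b] x(2)]
          ac[OF s[OF a x(2)] s[OF b x(2)]]
        by (rule tensor_class_eqI[OF distr[OF a b x(2)]])
      show "(a \<otimes>\<^bsub>K\<^esub> b) \<odot>\<^bsub>M \<boxtimes> N\<^esub> x = a \<odot>\<^bsub>M \<boxtimes> N\<^esub> (b \<odot>\<^bsub>M \<boxtimes> N\<^esub> x)"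
        unfolding x(1) sc[OF b x(2)] sc[OF a s[OF b x(2)]] sc[OF M.R.m_closed[OF a b] x(2)]
          ss[OF a b x(2)] ..
    }
    fix y assume "y \<in> carrier (M \<boxtimes> N)"
    then obtain ys where y: "y = cls M N ys" "ys \<in> ?L" by (auto simp: carrier_tensor)
    show "a \<odot>\<^bsub>M \<boxtimes> N\<^esub> (x \<oplus>\<^bsub>M \<boxtimes> N\<^esub> y) = a \<odot>\<^bsub>M \<boxtimes> N\<^esub> x \<oplus>\<^bsub>M \<boxtimes> N\<^esub> a \<odot>\<^bsub>M \<boxtimes> N\<^esub> y"
      unfolding x(1) y(1) ac[OF x(2) y(2)] sc[OF a x(2)] sc[OF a y(2)] sc[OF a app[OF x(2) y(2)]]
        ac[OF s[OF a x(2)] s[OF a y(2)]] by simp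
  next
    fix x assume "x \<in> carrier (M \<boxtimes> N)"
    then obtain xs where x: "x = cls M N xs" "xs \<in> ?L" by (auto simp: carrier_tensor)
    show "\<one>\<^bsub>K\<^esub> \<odot>\<^bsub>M \<boxtimes> N\<^esub> x = x"
      unfolding x(1) sc[OF M.R.one_closed x(2)] s1[OF x(2)] ..
  qed
qed

abbreviation pr where "pr M N \<equiv> pure K M N"

lemma pure_closed [simp]:
  "m \<in> carrier M \<Longrightarrow> n \<in> carrier N \<Longrightarrow> pr M N m n \<in> carrier (M \<boxtimes> N)"
  by (auto simp: pure_def carrier_tensor)

lemma bilin_pure:
  assumes M: "module K M" and N: "module K N"
  shows "bilin K M N (M \<boxtimes> N) (pr M N)"
proof (intro bilinI linI)
  fix n assume n: "n \<in> carrier N"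
  fix x assume x: "x \<in> carrier M"
  show "pr M N x n \<in> carrier (M \<boxtimes> N)" using n x by simp
  { fix y assume y: "y \<in> carrier M"
    show "pr M N (x \<oplus>\<^bsub>M\<^esub> y) n = pr M N x n \<oplus>\<^bsub>M \<boxtimes> N\<^esub> pr M N y n"
      using n x y add_class[of "[(x, n)]" M N "[(y, n)]"] tensor_class_eqI[OF tensor_rel.add_left, of x M y n N]
      by (simp add: pure_def) }
  fix a assume a: "a \<in> carrier K"
  show "pr M N (a \<odot>\<^bsub>M\<^esub> x) n = a \<odot>\<^bsub>M \<boxtimes> N\<^esub> pr M N x n"
    using smult_class[OF M N a, of "[(x, n)]"] n x by (simp add: pure_def)
next
  fix m assume m: "m \<in> carrier M"
  fix x assume x: "x \<in> carrier N"
  show "pr M N m x \<in> carrier (M \<boxtimes> N)" using m x by simp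
  { fix y assume y: "y \<in> carrier N"
    show "pr M N m (x \<oplus>\<^bsub>N\<^esub> y) = pr M N m x \<oplus>\<^bsub>M \<boxtimes> N\<^esub> pr M N m y"
      using m x y add_class[of "[(m, x)]" M N "[(m, y)]"] tensor_class_eqI[OF tensor_rel.add_right, of m M x N y]
      by (simp add: pure_def) }
  fix a assume a: "a \<in> carrier K"
  \<comment> \<open>Scaling in \<open>tensor\<close> acts on the left factors, so the rule
    \<open>smult\<close> has to carry the scalar across.\<close>
  show "pr M N m (a \<odot>\<^bsub>N\<^esub> x) = a \<odot>\<^bsub>M \<boxtimes> N\<^esub> pr M N m x"
    using smult_class[OF M N a, of "[(m, x)]"] m x tensor_class_eqI[OF tensor_rel.smult[OF a m x]]
    by (simp add: pure_def)
qed

section \<open>The universal property of the tensor product\<close>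

lemma TS_class:
  assumes "module K M" "module K N" "module K P" "bilin K M N P f" "xs \<in> lists (carrier M \<times> carrier N)"
  shows "TS M N P (cls M N xs) f = lsum M N P f xs"
  unfolding TS_def by (rule lsum_tensor_rel[OF assms(1-4) tensor_rel.sym[OF decode_tensor_class(2)[OF assms(5)]]])

lemma TS_pure_bilin:
  assumes "module K M" "module K N" "module K P" "bilin K M N P f" "m \<in> carrier M" "n \<in> carrier N"
  shows "TS M N P (pr M N m n) f = f m n"
proof -
  interpret P: module K P by fact
  have "f m n \<in> carrier P" using lin_closed[OF bilin_D2[OF assms(4,5)] assms(6)] .
  then show ?thesis using TS_class[OF assms(1-4), of "[(m, n)]"] assms(5,6)
    by (simp add: pure_def lsum_Cons)
qed

text \<open>The existence half of the universal property: this is the linear map induced by the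
  bilinear map \<open>f\<close>.\<close>

lemma lin_TS_arg_bilin:
  assumes M: "module K M" and N: "module K N" and P: "module K P" and f: "bilin K M N P f"
  shows "lin K (M \<boxtimes> N) P (\<lambda>t. TS M N P t f)"
proof (rule linI)
  fix x assume "x \<in> carrier (M \<boxtimes> N)"
  then obtain xs where x: "x = cls M N xs" "xs \<in> lists (carrier M \<times> carrier N)"
    by (auto simp: carrier_tensor)
  note tc = TS_class[OF assms]
  { fix y assume "y \<in> carrier (M \<boxtimes> N)"
    then obtain ys where y: "y = cls M N ys" "ys \<in> lists (carrier M \<times> carrier N)"
      by (auto simp: carrier_tensor)
    have xy: "xs @ ys \<in> lists (carrier M \<times> carrier N)" using x(2) y(2) by simp
    show "TS M N P (x \<oplus>\<^bsub>M \<boxtimes> N\<^esub> y) f = TS M N P x f \<oplus>\<^bsub>P\<^esub> TS M N P y f"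
      unfolding x(1) y(1) add_class[OF x(2) y(2)] tc[OF x(2)] tc[OF y(2)] tc[OF xy]
      by (rule lsum_append[OF P]) }
  fix a assume a: "a \<in> carrier K"
  interpret P: module K P by fact
  let ?s = "map (\<lambda>(m, n). (a \<odot>\<^bsub>M\<^esub> m, n))"
  have "?s xs \<in> lists (carrier M \<times> carrier N) \<and> lsum M N P f (?s xs) = a \<odot>\<^bsub>P\<^esub> lsum M N P f xs"
    using x(2)
  proof (induction xs)
    case (Cons x xs)
    obtain m n where x: "x = (m, n)" "m \<in> carrier M" "n \<in> carrier N"
      using Cons.hyps by auto
    have "f (a \<odot>\<^bsub>M\<^esub> m) n = a \<odot>\<^bsub>P\<^esub> f m n" "f m n \<in> carrier P"
      using lin_smult[OF bilin_D1[OF f x(3)] a x(2)] lin_closed[OF bilin_D1[OF f x(3)] x(2)] .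
    then show ?case using Cons.IH x a M P by (simp add: lsum_Cons P.smult_r_distr)
  qed (simp add: a)
  then show "TS M N P (a \<odot>\<^bsub>M \<boxtimes> N\<^esub> x) f = a \<odot>\<^bsub>P\<^esub> TS M N P x f"
    using x smult_class[OF M N a x(2)] tc by simp
qed (simp add: P)

lemma tensor_expand:
  assumes M: "module K M" and N: "module K N" and t: "t \<in> carrier (M \<boxtimes> N)"
  shows "TS M N (M \<boxtimes> N) t (pr M N) = t"
proof -
  have "lsum M N (M \<boxtimes> N) (pr M N) xs = cls M N xs" if "xs \<in> lists (carrier M \<times> carrier N)" for xs
    using that
  proof (induction xs)
    case Nil
    then show ?case by (simp add: zero_tensor)
  next
    case (Cons x xs)
    obtain m n where x: "x = (m, n)" "m \<in> carrier M" "n \<in> carrier N"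
      using Cons.hyps by auto
    show ?case using x Cons add_class[of "[(m, n)]" M N xs]
      by (simp add: lsum_Cons) (simp add: pure_def)
  qed
  then show ?thesis using decode_in_lists[OF t] class_decode[OF t] by (simp add: TS_def)
qed

text \<open>The uniqueness half of the universal property. By \<open>tensor_expand\<close> a tensor
  is a sum of pure ones, and a linear map passes through this sum, so its values on pure tensors
  determine it.\<close>

lemma tensor_ext:
  assumes M: "module K M" and N: "module K N" and P: "module K P"
    and f: "lin K (M \<boxtimes> N) P f" and g: "lin K (M \<boxtimes> N) P g"
    and eq: "\<And>m n. m \<in> carrier M \<Longrightarrow> n \<in> carrier N \<Longrightarrow> f (pr M N m n) = g (pr M N m n)"
    and t: "t \<in> carrier (M \<boxtimes> N)"
  shows "f t = g t"
proof -
  have MN: "module K (M \<boxtimes> N)" using M N by simp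
  have "h t = TS M N P t (\<lambda>m n. h (pr M N m n))" if "lin K (M \<boxtimes> N) P h" for h
    using lin_TS[OF MN P that, of M N "pr M N" t] tensor_expand[OF M N t] by simp
  from this[OF f] this[OF g] show ?thesis by (simp add: eq)
qed

lemma tsum_TS:
  assumes t: "t \<in> carrier (M \<boxtimes> N)"
    and f: "\<And>m n. m \<in> carrier M \<Longrightarrow> n \<in> carrier N \<Longrightarrow> f m n \<in> carrier P"
  shows "tsum P t f = TS M N P t f"
proof -
  have "foldr (\<lambda>(m, n) s. f m n \<oplus>\<^bsub>P\<^esub> s) xs \<zero>\<^bsub>P\<^esub> = lsum M N P f xs"
    if "xs \<in> lists (carrier M \<times> carrier N)" for xs
    using that by (induction xs) (auto simp: lsum_Cons f)
  then show ?thesis using decode_in_lists[OF t] by (simp add: tsum_def TS_def)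
qed

end

text \<open>
  \<open>lr_tensor K H M N\<close> and \<open>tensor K M N\<close> are records of different types with the same module
  structure, and likewise \<open>lr_unit K H\<close> and \<open>ground K\<close>.
\<close>

definition same_module ::
    "('u, 'u, 'x) module_scheme \<Rightarrow> ('u, 'u, 'y) module_scheme \<Rightarrow> bool" where
  "same_module M M' \<longleftrightarrow> carrier M = carrier M' \<and> zero M = zero M' \<and> add M = add M' \<and>
     smult M = smult M'"

section \<open>Transfer between records with the same module structure\<close>

context vector_spaces
begin

lemma module_same_imp:
  assumes M: "module K M" and s: "same_module M M'" shows "module K M'"
proof -
  interpret module K M by fact
  have f: "carrier M' = carrier M" "zero M' = zero M" "add M' = add M" "smult M' = smult M"
    using s by (simp_all add: same_module_def)
  have "abelian_group M'"
    by (rule abelian_groupI) (auto simp: f M.a_ac intro: M.l_neg M.a_inv_closed)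
  then show ?thesis
    by (rule moduleI[OF cring_K])
      (simp_all add: f smult_l_distr smult_r_distr smult_assoc1)
qed

lemma same_module_sym: "same_module M M' \<Longrightarrow> same_module M' M"
  by (simp add: same_module_def)

lemma module_same: "same_module M M' \<Longrightarrow> module K M = module K M'"
  by (rule iffI) (erule (1) module_same_imp, erule module_same_imp, erule same_module_sym)

lemma tensor_rel_same_imp:
  assumes "tensor_rel K M N xs ys" "same_module M M'" "same_module N N'"
  shows "tensor_rel K M' N' xs ys"
  using assms(1)
proof (induction rule: tensor_rel.induct)
  case (trans xs ys zs)
  then show ?case by (blast intro: tensor_rel.trans)
qed (use assms(2,3) in \<open>auto simp: same_module_def intro: tensor_rel.intros\<close>)

lemma tensor_rel_same:
  assumes s: "same_module M M'" "same_module N N'"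
  shows "tensor_rel K M N = tensor_rel K M' N'"
  using tensor_rel_same_imp[OF _ s] tensor_rel_same_imp[OF _ s[THEN same_module_sym]]
  by (intro ext iffI)

lemma
  assumes s: "same_module M M'" "same_module N N'"
  shows tensor_same: "M \<boxtimes> N = M' \<boxtimes> N'" and pure_same: "pr M N = pr M' N'"
proof -
  have "cls M N = cls M' N'"
    using tensor_rel_same[OF s] s by (intro ext) (simp add: tensor_class_def same_module_def)
  then show "M \<boxtimes> N = M' \<boxtimes> N'" "pr M N = pr M' N'"
    using s by (simp_all add: tensor_def pure_def[abs_def] same_module_def)
qed

lemma lin_same: "same_module M M' \<Longrightarrow> same_module N N' \<Longrightarrow> lin K M N = lin K M' N'"
  by (intro ext) (simp add: lin_def same_module_def)

lemma TS_same:
  "same_module A A' \<Longrightarrow> same_module B B' \<Longrightarrow> same_module P P' \<Longrightarrow> TS A B P = TS A' B' P'"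
  by (intro ext) (simp add: TS_def lsum_def same_module_def cong: if_cong)

lemma tsum_same: "same_module P P' \<Longrightarrow> tsum P = tsum P'"
  by (intro ext) (simp add: tsum_def same_module_def)

lemma same_module_refl: "same_module M M"
  by (simp add: same_module_def)

text \<open>Instantiated below as simp rules that replace \<open>lr_tensor\<close> by
  \<open>tensor\<close>, and \<open>lr_unit\<close> by \<open>ground\<close>, wherever only the
  module structure matters. Actions and coactions keep the larger record as their argument.\<close>

lemma same_moduleD:
  assumes "same_module M M'"
  shows "carrier M = carrier M'" "zero M = zero M'" "add M = add M'" "smult M = smult M'"
    "module K M = module K M'"
    "M \<boxtimes> N = M' \<boxtimes> N" "N \<boxtimes> M = N \<boxtimes> M'" "pr M N = pr M' N" "pr N M = pr N M'"
    "lin K M N = lin K M' N" "lin K N M = lin K N M'"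
    "TS M A B = TS M' A B" "TS A M B = TS A M' B" "TS A B M = TS A B M'" "tsum M = tsum M'"
proof -
  show "carrier M = carrier M'" "zero M = zero M'" "add M = add M'" "smult M = smult M'"
    using assms by (simp_all add: same_module_def)
qed (rule assms same_module_refl tensor_same pure_same lin_same TS_same tsum_same module_same)+

lemma module_ground [simp]: "module K (ground K)"
proof -
  interpret cring K by (rule cring_K)
  have "abelian_group (ground K)"
    by (rule abelian_groupI) (auto simp: ground_def a_ac intro: l_neg)
  then show ?thesis
    by (rule moduleI[OF cring_K]) (simp_all add: ground_def l_distr r_distr m_assoc)
qed

lemma carrier_ground: "carrier (ground K) = carrier K"
  by (simp add: ground_def)

text \<open>
  The simplifier does not normalize the premises of conditions, so \<open>carrier (ground K)\<close>, which arises
  from sums over \<open>ground K\<close>, has to be the normal form.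
\<close>

lemma carrier_K_iff [simp]: "x \<in> carrier K \<longleftrightarrow> x \<in> carrier (ground K)"
  by (simp add: carrier_ground)

lemma ground_sel [simp]: "\<zero>\<^bsub>ground K\<^esub> = \<zero>\<^bsub>K\<^esub>"
  "add (ground K) = add K" "smult (ground K) = mult K"
  by (simp_all add: ground_def)

section \<open>Linearity rules and the calculus of Sweedler sums\<close>

lemma lin_id: "lin K M M (\<lambda>x. x)"
  by (simp add: lin_def)

lemma lin_comp:
  assumes "lin K N P f" "lin K M N g"
  shows "lin K M P (\<lambda>x. f (g x))"
  using assms by (auto simp: lin_def Pi_iff)

lemma lin_cong:
  assumes "module K M" "\<And>x. x \<in> carrier M \<Longrightarrow> f x = g x"
  shows "lin K M N f = lin K M N g"
  using assms by (simp add: lin_def Pi_iff)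

lemma lin_eqI:
  assumes "lin K M N g" "module K M" "\<And>x. x \<in> carrier M \<Longrightarrow> f x = g x"
  shows "lin K M N f"
  using lin_cong[OF assms(2), of f g N] assms(1,3) by simp

lemma lin_pure1: "lin K X A g \<Longrightarrow> b \<in> carrier B \<Longrightarrow> module K A \<Longrightarrow> module K B \<Longrightarrow>
    lin K X (A \<boxtimes> B) (\<lambda>x. pr A B (g x) b)"
  and lin_pure2: "lin K X B g' \<Longrightarrow> a \<in> carrier A \<Longrightarrow> module K A \<Longrightarrow> module K B \<Longrightarrow>
    lin K X (A \<boxtimes> B) (\<lambda>x. pr A B a (g' x))"
  by (erule lin_comp[rotated], rule bilin_D1[OF bilin_pure] bilin_D2[OF bilin_pure], assumption+)+

text \<open>For a parameter of the summand; \<open>lin_TS_arg\<close> treats a parameter of the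
  tensor. Once declared as simp rules, these two and the rules for pure tensors, actions and
  coactions follow the structure of a nested sum and so decide multilinearity in one variable at a
  time.\<close>

lemma lin_TS_fun:
  assumes X: "module K X" and P: "module K P"
    and f: "\<And>a b. a \<in> carrier A \<Longrightarrow> b \<in> carrier B \<Longrightarrow> lin K X P (\<lambda>x. f x a b)"
  shows "lin K X P (\<lambda>x. TS A B P t (\<lambda>a b. f x a b))"
proof (rule linI)
  fix x assume x: "x \<in> carrier X"
  show "TS A B P t (f x) \<in> carrier P" using P by simp
  { fix y assume y: "y \<in> carrier X"
    have "TS A B P t (f (x \<oplus>\<^bsub>X\<^esub> y)) = TS A B P t (\<lambda>a b. f x a b \<oplus>\<^bsub>P\<^esub> f y a b)"
      by (rule TS_cong[OF HOL.refl HOL.refl HOL.refl HOL.refl]) (rule lin_add[OF f]; (assumption | rule x y))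
    also have "\<dots> = TS A B P t (f x) \<oplus>\<^bsub>P\<^esub> TS A B P t (f y)"
      by (rule TS_add[OF P]) (rule lin_closed[OF f]; (assumption | rule x y))+
    finally show "TS A B P t (f (x \<oplus>\<^bsub>X\<^esub> y)) = TS A B P t (f x) \<oplus>\<^bsub>P\<^esub> TS A B P t (f y)" . }
  fix a assume a: "a \<in> carrier K"
  have "lin K P P (smult P a)"
    using P a cring_K by (intro linI) (auto simp: module.smult_r_distr[OF P] module.smult_assoc1[OF P, symmetric] cring.cring_simprules(14))
  from lin_TS[OF P P this, of A B "f x" t]
  show "TS A B P t (f (a \<odot>\<^bsub>X\<^esub> x)) = a \<odot>\<^bsub>P\<^esub> TS A B P t (f x)"
    using x a lin_closed[OF f] lin_smult[OF f] by simp
qed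

lemma lin_TS_arg:
  assumes "lin K X (A \<boxtimes> B) g" "module K A" "module K B" "module K P"
    and "\<And>a. a \<in> carrier A \<Longrightarrow> lin K B P (\<lambda>b. f a b)"
    and "\<And>b. b \<in> carrier B \<Longrightarrow> lin K A P (\<lambda>a. f a b)"
  shows "lin K X P (\<lambda>x. TS A B P (g x) f)"
  by (rule lin_comp[OF lin_TS_arg_bilin assms(1)]) (simp_all add: assms bilin_def)

lemma lin_smult1:
  assumes "module K P" "lin K X (ground K) g" "p \<in> carrier P"
  shows "lin K X P (\<lambda>x. g x \<odot>\<^bsub>P\<^esub> p)"
  using assms(1,3) lin_closed[OF assms(2)] lin_add[OF assms(2)] lin_smult[OF assms(2)]
  by (intro linI) (simp_all add: module.smult_l_distr module.smult_assoc1)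

lemma lin_smult2:
  assumes P: "module K P" and g: "lin K X P g" and a: "a \<in> carrier (ground K)"
  shows "lin K X P (\<lambda>x. a \<odot>\<^bsub>P\<^esub> g x)"
proof -
  have "lin K P P (\<lambda>x. a \<odot>\<^bsub>P\<^esub> x)"
    using P a cring_K by (intro linI) (auto simp: module.smult_r_distr[OF P] module.smult_assoc1[OF P, symmetric] cring.cring_simprules(14))
  from lin_comp[OF this g] show ?thesis .
qed

lemma TS_pure:
  assumes "m \<in> carrier M" "n \<in> carrier N" "module K M" "module K N" "module K P"
    and "\<And>a. a \<in> carrier M \<Longrightarrow> lin K N P (\<lambda>b. f a b)"
    and "\<And>b. b \<in> carrier N \<Longrightarrow> lin K M P (\<lambda>a. f a b)"
  shows "TS M N P (pr M N m n) (\<lambda>a b. f a b) = f m n"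
  by (rule TS_pure_bilin) (simp_all add: assms bilin_def)

lemma TS_TS:
  assumes "module K M" "module K N" "module K P"
    and "\<And>a. a \<in> carrier M \<Longrightarrow> lin K N P (\<lambda>b. f a b)"
    and "\<And>b. b \<in> carrier N \<Longrightarrow> lin K M P (\<lambda>a. f a b)"
    and "\<And>a b. a \<in> carrier A \<Longrightarrow> b \<in> carrier B \<Longrightarrow> g a b \<in> carrier (M \<boxtimes> N)"
  shows "TS M N P (TS A B (M \<boxtimes> N) t (\<lambda>a b. g a b)) (\<lambda>a b. f a b) = TS A B P t (\<lambda>a b. TS M N P (g a b) f)"
  by (rule lin_TS[OF _ _ lin_TS_arg_bilin]) (simp_all add: assms bilin_def)

lemma pure_TS1:
  assumes "module K M" "module K N" "n \<in> carrier N"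
    and "\<And>a b. a \<in> carrier A \<Longrightarrow> b \<in> carrier B \<Longrightarrow> g a b \<in> carrier M"
  shows "pr M N (TS A B M t (\<lambda>a b. g a b)) n = TS A B (M \<boxtimes> N) t (\<lambda>a b. pr M N (g a b) n)"
  by (rule lin_TS[where g = "\<lambda>x. pr M N x n"]) (simp_all add: assms lin_pure1[OF lin_id])

lemma pure_TS2:
  assumes "module K M" "module K N" "m \<in> carrier M"
    and "\<And>a b. a \<in> carrier A \<Longrightarrow> b \<in> carrier B \<Longrightarrow> g a b \<in> carrier N"
  shows "pr M N m (TS A B N t (\<lambda>a b. g a b)) = TS A B (M \<boxtimes> N) t (\<lambda>a b. pr M N m (g a b))"
  by (rule lin_TS[where g = "\<lambda>x. pr M N m x"]) (simp_all add: assms lin_pure2[OF lin_id])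

lemma pure_smult1:
  assumes "module K M" "module K N" "m \<in> carrier M" "n \<in> carrier N" "a \<in> carrier (ground K)"
  shows "pr M N (a \<odot>\<^bsub>M\<^esub> m) n = a \<odot>\<^bsub>M \<boxtimes> N\<^esub> pr M N m n"
  by (rule lin_smult[OF lin_pure1[OF lin_id]]) (use assms in simp_all)

lemma pure_smult2:
  assumes "module K M" "module K N" "m \<in> carrier M" "n \<in> carrier N" "a \<in> carrier (ground K)"
  shows "pr M N m (a \<odot>\<^bsub>N\<^esub> n) = a \<odot>\<^bsub>M \<boxtimes> N\<^esub> pr M N m n"
  by (rule lin_smult[OF lin_pure2[OF lin_id]]) (use assms in simp_all)

lemma TS_smult:
  assumes P: "module K P" and a: "a \<in> carrier (ground K)"
    and "\<And>x y. x \<in> carrier A \<Longrightarrow> y \<in> carrier B \<Longrightarrow> f x y \<in> carrier P"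
  shows "TS A B P t (\<lambda>x y. a \<odot>\<^bsub>P\<^esub> f x y) = a \<odot>\<^bsub>P\<^esub> TS A B P t (\<lambda>x y. f x y)"
  by (rule lin_TS[symmetric, OF P P lin_smult2[OF P lin_id a]]) (rule assms(3))

lemma smult_TS1:
  assumes "module K M" "m \<in> carrier M"
    and "\<And>a b. a \<in> carrier A \<Longrightarrow> b \<in> carrier B \<Longrightarrow> g a b \<in> carrier (ground K)"
  shows "TS A B (ground K) t (\<lambda>a b. g a b) \<odot>\<^bsub>M\<^esub> m = TS A B M t (\<lambda>a b. g a b \<odot>\<^bsub>M\<^esub> m)"
  by (rule lin_TS[where g = "\<lambda>x. x \<odot>\<^bsub>M\<^esub> m"]) (simp_all add: assms lin_smult1[OF _ lin_id])

lemma TS_arg_smult: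
  assumes "module K M" "module K N" "module K P" "t \<in> carrier (M \<boxtimes> N)" "a \<in> carrier (ground K)"
    and "\<And>a. a \<in> carrier M \<Longrightarrow> lin K N P (\<lambda>b. f a b)"
    and "\<And>b. b \<in> carrier N \<Longrightarrow> lin K M P (\<lambda>a. f a b)"
  shows "TS M N P (a \<odot>\<^bsub>M \<boxtimes> N\<^esub> t) (\<lambda>a b. f a b) = a \<odot>\<^bsub>P\<^esub> TS M N P t (\<lambda>a b. f a b)"
  by (rule lin_smult[OF lin_TS_arg_bilin]) (use assms in \<open>simp_all add: bilin_def\<close>)

end

section \<open>Sweedler calculus in a bialgebra\<close>

lemma lr_tensor_same: "same_module (lr_tensor K H M N) (tensor K M N)"
  by (simp add: same_module_def lr_tensor_def module.extend_def lr_module.fields_def)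

lemma lr_unit_same: "same_module (lr_unit K H) (ground K)"
  by (simp add: same_module_def lr_unit_def module.extend_def lr_module.fields_def)

lemma same_module_cong: "same_module M M' \<Longrightarrow> same_module M N = same_module M' N"
  "same_module M M' \<Longrightarrow> same_module N M = same_module N M'"
  by (auto simp: same_module_def)

locale bialgebra_lr =
  fixes K :: "'u::infinite ring" and H :: "'u bialg"
  assumes bialgebra: "bialgebra K H"

sublocale bialgebra_lr \<subseteq> vector_spaces K
  using bialgebra by (intro vector_spaces.intro) (simp add: bialgebra_def module_def)

context bialgebra_lr
begin

lemmas lr_simps [simp] =
  same_moduleD[OF lr_tensor_same] same_moduleD[OF lr_unit_same]
  same_module_cong[OF lr_tensor_same] same_module_cong[OF lr_unit_same]
  same_module_refl

lemma module_H [simp]: "module K H"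
  using bialgebra by (simp only: bialgebra_def)

lemma ring_H: "ring H"
  using bialgebra by (simp only: bialgebra_def)

lemma coalgebra_H: "coalgebra K H"
  using bialgebra by (simp only: bialgebra_def)

lemma H_closed [simp]:
  "g \<in> carrier H \<Longrightarrow> h \<in> carrier H \<Longrightarrow> g \<otimes>\<^bsub>H\<^esub> h \<in> carrier H"
  "\<one>\<^bsub>H\<^esub> \<in> carrier H"
  using ring_H by (simp_all add: ring.ring_simprules(5,6))

lemma H_mult [simp]:
  "g \<in> carrier H \<Longrightarrow> h \<in> carrier H \<Longrightarrow> k \<in> carrier H \<Longrightarrow>
     (g \<otimes>\<^bsub>H\<^esub> h) \<otimes>\<^bsub>H\<^esub> k = g \<otimes>\<^bsub>H\<^esub> (h \<otimes>\<^bsub>H\<^esub> k)"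
  "h \<in> carrier H \<Longrightarrow> \<one>\<^bsub>H\<^esub> \<otimes>\<^bsub>H\<^esub> h = h"
  "h \<in> carrier H \<Longrightarrow> h \<otimes>\<^bsub>H\<^esub> \<one>\<^bsub>H\<^esub> = h"
  by (simp_all add: ring_H ring.ring_simprules monoid.r_one ring.is_monoid)

lemma bilin_mult: "bilin K H H H (mult H)"
  using bialgebra by (simp only: bialgebra_def)

lemma lin_mult1 [simp]:
  "lin K X H g \<Longrightarrow> h \<in> carrier H \<Longrightarrow> lin K X H (\<lambda>x. g x \<otimes>\<^bsub>H\<^esub> h)"
  and lin_mult2 [simp]:
  "lin K X H g \<Longrightarrow> h \<in> carrier H \<Longrightarrow> lin K X H (\<lambda>x. h \<otimes>\<^bsub>H\<^esub> g x)"
  by (erule lin_comp[rotated], erule bilin_D1[OF bilin_mult] bilin_D2[OF bilin_mult])+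

lemma lin_comult: "lin K H (H \<boxtimes> H) (comult H)"
  and lin_counit: "lin K H (ground K) (counit H)"
  using coalgebra_H by (simp_all only: coalgebra_def)

lemma comult_closed [simp]: "h \<in> carrier H \<Longrightarrow> comult H h \<in> carrier (H \<boxtimes> H)"
  and counit_closed [simp]: "h \<in> carrier H \<Longrightarrow> counit H h \<in> carrier (ground K)"
  using lin_closed[OF lin_comult] lin_closed[OF lin_counit] by simp_all

lemma lin_comult' [simp]: "lin K X H g \<Longrightarrow> lin K X (H \<boxtimes> H) (\<lambda>x. comult H (g x))"
  and lin_counit' [simp]: "lin K X H g \<Longrightarrow> lin K X (ground K) (\<lambda>x. counit H (g x))"
  by (rule lin_comp[OF lin_comult] lin_comp[OF lin_counit], assumption)+

lemma lin_K_mult [simp]: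
  "lin K X (ground K) g \<Longrightarrow> a \<in> carrier K \<Longrightarrow> lin K X (ground K) (\<lambda>x. g x \<otimes>\<^bsub>K\<^esub> a)"
  "lin K X (ground K) g \<Longrightarrow> a \<in> carrier K \<Longrightarrow> lin K X (ground K) (\<lambda>x. a \<otimes>\<^bsub>K\<^esub> g x)"
  using lin_smult1[OF module_ground, of X g a] lin_smult2[OF module_ground, of X g a] by simp_all

declare lin_id [simp] lin_pure1 [simp] lin_pure2 [simp] lin_TS_fun [simp] lin_TS_arg [simp]
  lin_smult1 [simp] lin_smult2 [simp]

lemma tsum_comult:
  "h \<in> carrier H \<Longrightarrow> (\<And>a b. a \<in> carrier H \<Longrightarrow> b \<in> carrier H \<Longrightarrow> f a b \<in> carrier P) \<Longrightarrow>
   tsum P (comult H h) f = TS H H P (comult H h) f"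
  by (rule tsum_TS) simp_all

abbreviation obj where "obj M \<equiv> lr_object K H M"

text \<open>
  The part of \<open>lr_object\<close> which suffices for all linearity side conditions; it has to be available for
  tensor products before they are known to be objects.
\<close>

definition preobj :: "'u lr_module \<Rightarrow> bool" where
  "preobj M \<longleftrightarrow> module K M \<and> bilin K H M M (lact M) \<and> bilin K M H M (ract M) \<and>
     lin K M (H \<boxtimes> M) (lcoact M) \<and> lin K M (M \<boxtimes> H) (rcoact M)"

lemma obj_preobj [simp]: "obj M \<Longrightarrow> preobj M"
  by (simp only: lr_object_def H_bimodule_def H_bicomodule_def preobj_def)

lemma obj_module [simp]: "preobj M \<Longrightarrow> module K M"
  by (simp add: preobj_def)

lemma
  assumes "preobj M"
  shows obj_bilin_lact: "bilin K H M M (lact M)" and obj_bilin_ract: "bilin K M H M (ract M)"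
    and obj_lin_lcoact: "lin K M (H \<boxtimes> M) (lcoact M)" and obj_lin_rcoact: "lin K M (M \<boxtimes> H) (rcoact M)"
  using assms by (simp_all add: preobj_def)

text \<open>\<open>P\<close> is kept apart from \<open>M\<close> because simplification turns the
  carrier of an \<open>lr_tensor\<close> into that of a \<open>tensor\<close>, while the action
  still refers to the \<open>lr_tensor\<close>. The premise \<open>same_module P M\<close> bridges
  the two; later rules on actions have it for the same reason.\<close>

lemma act_closed [simp]:
  assumes "preobj M" "m \<in> carrier M"
  shows "same_module P M \<Longrightarrow> h \<in> carrier H \<Longrightarrow> lact M h m \<in> carrier P"
    "same_module P M \<Longrightarrow> h \<in> carrier H \<Longrightarrow> ract M m h \<in> carrier P"
    "same_module P (H \<boxtimes> M) \<Longrightarrow> lcoact M m \<in> carrier P"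
    "same_module P (M \<boxtimes> H) \<Longrightarrow> rcoact M m \<in> carrier P"
  using assms lin_closed[OF bilin_D1[OF obj_bilin_lact[OF assms(1)] assms(2)]]
    lin_closed[OF bilin_D2[OF obj_bilin_ract[OF assms(1)] assms(2)]]
    lin_closed[OF obj_lin_lcoact[OF assms(1)] assms(2)]
    lin_closed[OF obj_lin_rcoact[OF assms(1)] assms(2)]
  by (simp_all add: same_moduleD(1))

lemma act_simps [simp]:
  assumes "obj M" "m \<in> carrier M"
  shows "lact M \<one>\<^bsub>H\<^esub> m = m" "ract M m \<one>\<^bsub>H\<^esub> = m"
    "g \<in> carrier H \<Longrightarrow> h \<in> carrier H \<Longrightarrow> lact M (g \<otimes>\<^bsub>H\<^esub> h) m = lact M g (lact M h m)"
    "g \<in> carrier H \<Longrightarrow> h \<in> carrier H \<Longrightarrow> ract M m (g \<otimes>\<^bsub>H\<^esub> h) = ract M (ract M m g) h"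
    "g \<in> carrier H \<Longrightarrow> h \<in> carrier H \<Longrightarrow> ract M (lact M g m) h = lact M g (ract M m h)"
  using assms by (simp_all only: lr_object_def H_bimodule_def)

lemma lin_act [simp]:
  assumes "same_module P M" "preobj M"
  shows "lin K X H g \<Longrightarrow> m \<in> carrier M \<Longrightarrow> lin K X P (\<lambda>x. lact M (g x) m)"
    "lin K X M f \<Longrightarrow> h \<in> carrier H \<Longrightarrow> lin K X P (\<lambda>x. lact M h (f x))"
    "lin K X H g \<Longrightarrow> m \<in> carrier M \<Longrightarrow> lin K X P (\<lambda>x. ract M m (g x))"
    "lin K X M f \<Longrightarrow> h \<in> carrier H \<Longrightarrow> lin K X P (\<lambda>x. ract M (f x) h)"
  unfolding same_moduleD[OF assms(1)]
  by (erule lin_comp[rotated],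
      erule bilin_D1[OF obj_bilin_lact[OF assms(2)]] bilin_D2[OF obj_bilin_lact[OF assms(2)]]
        bilin_D1[OF obj_bilin_ract[OF assms(2)]] bilin_D2[OF obj_bilin_ract[OF assms(2)]])+

lemma lin_coact [simp]:
  assumes "preobj M"
  shows "same_module P (H \<boxtimes> M) \<Longrightarrow> lin K X M f \<Longrightarrow> lin K X P (\<lambda>x. lcoact M (f x))"
    "same_module P (M \<boxtimes> H) \<Longrightarrow> lin K X M f \<Longrightarrow> lin K X P (\<lambda>x. rcoact M (f x))"
  using lin_comp[OF obj_lin_lcoact[OF assms]] lin_comp[OF obj_lin_rcoact[OF assms]]
  by (simp_all add: same_moduleD)

lemma tsum_coact:
  assumes "preobj M" "m \<in> carrier M"
  shows "(\<And>a b. a \<in> carrier H \<Longrightarrow> b \<in> carrier M \<Longrightarrow> f a b \<in> carrier P) \<Longrightarrow>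
      tsum P (lcoact M m) f = TS H M P (lcoact M m) f"
    "(\<And>a b. a \<in> carrier M \<Longrightarrow> b \<in> carrier H \<Longrightarrow> g a b \<in> carrier P) \<Longrightarrow>
      tsum P (rcoact M m) g = TS M H P (rcoact M m) g"
  using assms by (auto intro!: tsum_TS)

lemma mult_TS:
  assumes "\<And>a b. a \<in> carrier A \<Longrightarrow> b \<in> carrier B \<Longrightarrow> f a b \<in> carrier H" "h \<in> carrier H"
  shows "TS A B H t (\<lambda>a b. f a b) \<otimes>\<^bsub>H\<^esub> h = TS A B H t (\<lambda>a b. f a b \<otimes>\<^bsub>H\<^esub> h)"
    "h \<otimes>\<^bsub>H\<^esub> TS A B H t (\<lambda>a b. f a b) = TS A B H t (\<lambda>a b. h \<otimes>\<^bsub>H\<^esub> f a b)"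
  by (rule lin_TS[where g = "\<lambda>x. x \<otimes>\<^bsub>H\<^esub> h"] lin_TS[where g = "\<lambda>x. h \<otimes>\<^bsub>H\<^esub> x"]; simp add: assms)+

lemma comult_TS:
  assumes "\<And>a b. a \<in> carrier A \<Longrightarrow> b \<in> carrier B \<Longrightarrow> f a b \<in> carrier H"
  shows "comult H (TS A B H t (\<lambda>a b. f a b)) = TS A B (H \<boxtimes> H) t (\<lambda>a b. comult H (f a b))"
    "counit H (TS A B H t (\<lambda>a b. f a b)) = TS A B (ground K) t (\<lambda>a b. counit H (f a b))"
  by (rule lin_TS[where g = "comult H"] lin_TS[where g = "counit H"]; simp add: assms lin_comult lin_counit)+

lemma act_TS:
  assumes "preobj M" "same_module P M"
  shows
   "(\<And>a b. a \<in> carrier A \<Longrightarrow> b \<in> carrier B \<Longrightarrow> f a b \<in> carrier H) \<Longrightarrow> m \<in> carrier M \<Longrightarrow>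
     lact M (TS A B H t (\<lambda>a b. f a b)) m = TS A B M t (\<lambda>a b. lact M (f a b) m)"
   "(\<And>a b. a \<in> carrier A \<Longrightarrow> b \<in> carrier B \<Longrightarrow> f a b \<in> carrier H) \<Longrightarrow> m \<in> carrier M \<Longrightarrow>
     ract M m (TS A B H t (\<lambda>a b. f a b)) = TS A B M t (\<lambda>a b. ract M m (f a b))"
   "(\<And>a b. a \<in> carrier A \<Longrightarrow> b \<in> carrier B \<Longrightarrow> f a b \<in> carrier M) \<Longrightarrow> h \<in> carrier H \<Longrightarrow>
     lact M h (TS A B P t (\<lambda>a b. f a b)) = TS A B P t (\<lambda>a b. lact M h (f a b))"
   "(\<And>a b. a \<in> carrier A \<Longrightarrow> b \<in> carrier B \<Longrightarrow> f a b \<in> carrier M) \<Longrightarrow> h \<in> carrier H \<Longrightarrow>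
     ract M (TS A B P t (\<lambda>a b. f a b)) h = TS A B P t (\<lambda>a b. ract M (f a b) h)"
   "(\<And>a b. a \<in> carrier A \<Longrightarrow> b \<in> carrier B \<Longrightarrow> f a b \<in> carrier M) \<Longrightarrow>
     lcoact M (TS A B P t (\<lambda>a b. f a b)) = TS A B (H \<boxtimes> M) t (\<lambda>a b. lcoact M (f a b))"
   "(\<And>a b. a \<in> carrier A \<Longrightarrow> b \<in> carrier B \<Longrightarrow> f a b \<in> carrier M) \<Longrightarrow>
     rcoact M (TS A B P t (\<lambda>a b. f a b)) = TS A B (M \<boxtimes> H) t (\<lambda>a b. rcoact M (f a b))"
  unfolding same_moduleD[OF assms(2)]
  by (rule lin_TS[where g = "\<lambda>x. lact M x m"] lin_TS[where g = "\<lambda>x. ract M m x"]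
      lin_TS[where g = "\<lambda>x. lact M h x"] lin_TS[where g = "\<lambda>x. ract M x h"]
      lin_TS[where g = "lcoact M"] lin_TS[where g = "rcoact M"];
      simp add: assms(1) obj_lin_lcoact obj_lin_rcoact)+

lemma act_smult:
  assumes "preobj M" "same_module P M" "h \<in> carrier H" "m \<in> carrier M" "a \<in> carrier (ground K)"
  shows "lact M h (a \<odot>\<^bsub>P\<^esub> m) = a \<odot>\<^bsub>P\<^esub> lact M h m" "ract M (a \<odot>\<^bsub>P\<^esub> m) h = a \<odot>\<^bsub>P\<^esub> ract M m h"
    "lact M (a \<odot>\<^bsub>H\<^esub> h) m = a \<odot>\<^bsub>M\<^esub> lact M h m" "ract M m (a \<odot>\<^bsub>H\<^esub> h) = a \<odot>\<^bsub>M\<^esub> ract M m h"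
  unfolding same_moduleD[OF assms(2)]
  by (rule lin_smult[where f = "\<lambda>x. lact M h x"] lin_smult[where f = "\<lambda>x. ract M x h"]
      lin_smult[where f = "\<lambda>x. lact M x m"] lin_smult[where f = "\<lambda>x. ract M m x"];
      simp add: assms)+

lemma mult_smult:
  assumes "a \<in> carrier (ground K)" "g \<in> carrier H" "h \<in> carrier H"
  shows "(a \<odot>\<^bsub>H\<^esub> g) \<otimes>\<^bsub>H\<^esub> h = a \<odot>\<^bsub>H\<^esub> (g \<otimes>\<^bsub>H\<^esub> h)" "g \<otimes>\<^bsub>H\<^esub> (a \<odot>\<^bsub>H\<^esub> h) = a \<odot>\<^bsub>H\<^esub> (g \<otimes>\<^bsub>H\<^esub> h)"
  by (rule lin_smult[where f = "\<lambda>x. x \<otimes>\<^bsub>H\<^esub> h"] lin_smult[where f = "\<lambda>x. g \<otimes>\<^bsub>H\<^esub> x"];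
      simp add: assms)+

text \<open>
  The identity \<open>eq\<close> is mapped by the linear map on \<open>A \<otimes> (B \<otimes> C)\<close> induced by \<open>F\<close>. All coassociativity
  axioms have this shape.
\<close>

lemma TS_triple:
  assumes eq: "tsum (A \<boxtimes> B \<boxtimes> C) s (\<lambda>x c. tsum (A \<boxtimes> B \<boxtimes> C) (p x) (\<lambda>a b. pr A (B \<boxtimes> C) a (pr B C b c)))
      = tsum (A \<boxtimes> B \<boxtimes> C) t (\<lambda>a y. pr A (B \<boxtimes> C) a (q y))"
    and m [simp]: "module K A" "module K B" "module K C" "module K X" "module K Y" "module K P"
    and s: "s \<in> carrier (X \<boxtimes> C)" and t: "t \<in> carrier (A \<boxtimes> Y)"
    and p: "\<And>x. x \<in> carrier X \<Longrightarrow> p x \<in> carrier (A \<boxtimes> B)"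
    and q: "\<And>x. x \<in> carrier Y \<Longrightarrow> q x \<in> carrier (B \<boxtimes> C)"
    and F [simp]: "\<And>b c. b \<in> carrier B \<Longrightarrow> c \<in> carrier C \<Longrightarrow> lin K A P (\<lambda>a. F a b c)"
      "\<And>a c. a \<in> carrier A \<Longrightarrow> c \<in> carrier C \<Longrightarrow> lin K B P (\<lambda>b. F a b c)"
      "\<And>a b. a \<in> carrier A \<Longrightarrow> b \<in> carrier B \<Longrightarrow> lin K C P (\<lambda>c. F a b c)"
  shows "TS X C P s (\<lambda>x c. TS A B P (p x) (\<lambda>a b. F a b c))
    = TS A Y P t (\<lambda>a y. TS B C P (q y) (\<lambda>b c. F a b c))"
proof -
  let ?\<Phi> = "\<lambda>z. TS A (B \<boxtimes> C) P z (\<lambda>a t. TS B C P t (\<lambda>b c. F a b c))"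
  have 1: "tsum (A \<boxtimes> B \<boxtimes> C) (p x) (\<lambda>a b. pr A (B \<boxtimes> C) a (pr B C b c))
     = TS A B (A \<boxtimes> B \<boxtimes> C) (p x) (\<lambda>a b. pr A (B \<boxtimes> C) a (pr B C b c))"
    if "x \<in> carrier X" "c \<in> carrier C" for x c
    by (rule tsum_TS) (use p that in simp_all)
  have 2: "tsum (A \<boxtimes> B \<boxtimes> C) s (\<lambda>x c. tsum (A \<boxtimes> B \<boxtimes> C) (p x) (\<lambda>a b. pr A (B \<boxtimes> C) a (pr B C b c)))
     = TS X C (A \<boxtimes> B \<boxtimes> C) s (\<lambda>x c. TS A B (A \<boxtimes> B \<boxtimes> C) (p x) (\<lambda>a b. pr A (B \<boxtimes> C) a (pr B C b c)))"
    by (subst tsum_TS[OF s]) (use p in \<open>simp_all add: 1\<close>)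
  have 3: "tsum (A \<boxtimes> B \<boxtimes> C) t (\<lambda>a y. pr A (B \<boxtimes> C) a (q y))
     = TS A Y (A \<boxtimes> B \<boxtimes> C) t (\<lambda>a y. pr A (B \<boxtimes> C) a (q y))"
    by (rule tsum_TS[OF t]) (use q in simp_all)
  have "?\<Phi> (TS X C (A \<boxtimes> B \<boxtimes> C) s (\<lambda>x c. TS A B (A \<boxtimes> B \<boxtimes> C) (p x) (\<lambda>a b. pr A (B \<boxtimes> C) a (pr B C b c))))
     = ?\<Phi> (TS A Y (A \<boxtimes> B \<boxtimes> C) t (\<lambda>a y. pr A (B \<boxtimes> C) a (q y)))"
    using eq unfolding 2 3 by simp
  then show ?thesis
    using p q by (simp add: TS_TS TS_pure)
qed

section \<open>The axioms as rules for multilinear summands\<close>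

lemma comult_coassoc:
  assumes "h \<in> carrier H" "module K P"
    and "\<And>b c. b \<in> carrier H \<Longrightarrow> c \<in> carrier H \<Longrightarrow> lin K H P (\<lambda>a. F a b c)"
      "\<And>a c. a \<in> carrier H \<Longrightarrow> c \<in> carrier H \<Longrightarrow> lin K H P (\<lambda>b. F a b c)"
      "\<And>a b. a \<in> carrier H \<Longrightarrow> b \<in> carrier H \<Longrightarrow> lin K H P (\<lambda>c. F a b c)"
  shows "TS H H P (comult H h) (\<lambda>x c. TS H H P (comult H x) (\<lambda>a b. F a b c))
    = TS H H P (comult H h) (\<lambda>a y. TS H H P (comult H y) (\<lambda>b c. F a b c))"
  by (rule TS_triple) (use coalgebra_H assms(1) in \<open>simp only: coalgebra_def; blast\<close>, simp_all add: assms)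

lemma
  assumes "obj M" "m \<in> carrier M" "module K P"
  shows lcoact_coassoc: "(\<And>b c. b \<in> carrier H \<Longrightarrow> c \<in> carrier M \<Longrightarrow> lin K H P (\<lambda>a. F a b c)) \<Longrightarrow>
      (\<And>a c. a \<in> carrier H \<Longrightarrow> c \<in> carrier M \<Longrightarrow> lin K H P (\<lambda>b. F a b c)) \<Longrightarrow>
      (\<And>a b. a \<in> carrier H \<Longrightarrow> b \<in> carrier H \<Longrightarrow> lin K M P (\<lambda>c. F a b c)) \<Longrightarrow>
      TS H M P (lcoact M m) (\<lambda>x c. TS H H P (comult H x) (\<lambda>a b. F a b c))
      = TS H M P (lcoact M m) (\<lambda>a y. TS H M P (lcoact M y) (\<lambda>b c. F a b c))"
    and rcoact_coassoc: "(\<And>b c. b \<in> carrier H \<Longrightarrow> c \<in> carrier H \<Longrightarrow> lin K M P (\<lambda>a. G a b c)) \<Longrightarrow>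
      (\<And>a c. a \<in> carrier M \<Longrightarrow> c \<in> carrier H \<Longrightarrow> lin K H P (\<lambda>b. G a b c)) \<Longrightarrow>
      (\<And>a b. a \<in> carrier M \<Longrightarrow> b \<in> carrier H \<Longrightarrow> lin K H P (\<lambda>c. G a b c)) \<Longrightarrow>
      TS M H P (rcoact M m) (\<lambda>x c. TS M H P (rcoact M x) (\<lambda>a b. G a b c))
      = TS M H P (rcoact M m) (\<lambda>a y. TS H H P (comult H y) (\<lambda>b c. G a b c))"
    and coact_bicomodule: "(\<And>b c. b \<in> carrier M \<Longrightarrow> c \<in> carrier H \<Longrightarrow> lin K H P (\<lambda>a. E a b c)) \<Longrightarrow>
      (\<And>a c. a \<in> carrier H \<Longrightarrow> c \<in> carrier H \<Longrightarrow> lin K M P (\<lambda>b. E a b c)) \<Longrightarrow>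
      (\<And>a b. a \<in> carrier H \<Longrightarrow> b \<in> carrier M \<Longrightarrow> lin K H P (\<lambda>c. E a b c)) \<Longrightarrow>
      TS M H P (rcoact M m) (\<lambda>x c. TS H M P (lcoact M x) (\<lambda>a b. E a b c))
      = TS H M P (lcoact M m) (\<lambda>a y. TS M H P (rcoact M y) (\<lambda>b c. E a b c))"
  by (rule TS_triple, use assms(1,2) in \<open>simp only: lr_object_def H_bicomodule_def; blast\<close>, simp_all add: assms)+

lemma comult_counit:
  assumes "h \<in> carrier H" "module K P" "lin K H P f"
  shows "TS H H P (comult H h) (\<lambda>x y. counit H x \<odot>\<^bsub>P\<^esub> f y) = f h"
    "TS H H P (comult H h) (\<lambda>x y. counit H y \<odot>\<^bsub>P\<^esub> f x) = f h"
proof -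
  have "TS H H H (comult H h) (\<lambda>x y. counit H x \<odot>\<^bsub>H\<^esub> y) = h"
    "TS H H H (comult H h) (\<lambda>x y. counit H y \<odot>\<^bsub>H\<^esub> x) = h"
    using coalgebra_H assms(1) by (simp_all only: coalgebra_def tsum_comult[OF assms(1), symmetric] counit_closed smult_closed module_H carrier_K_iff)
  note this[THEN arg_cong[where f = f]]
  then show "TS H H P (comult H h) (\<lambda>x y. counit H x \<odot>\<^bsub>P\<^esub> f y) = f h"
    "TS H H P (comult H h) (\<lambda>x y. counit H y \<odot>\<^bsub>P\<^esub> f x) = f h"
    using assms by (simp_all add: lin_TS[of H P f] lin_smult[of H P f])
qed

lemma coact_counit:
  assumes "obj M" "m \<in> carrier M" "module K P" "lin K M P f"
  shows "TS H M P (lcoact M m) (\<lambda>x y. counit H x \<odot>\<^bsub>P\<^esub> f y) = f m"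
    "TS M H P (rcoact M m) (\<lambda>x y. counit H y \<odot>\<^bsub>P\<^esub> f x) = f m"
proof -
  have "TS H M M (lcoact M m) (\<lambda>x y. counit H x \<odot>\<^bsub>M\<^esub> y) = m"
    "TS M H M (rcoact M m) (\<lambda>x y. counit H y \<odot>\<^bsub>M\<^esub> x) = m"
    using assms(1,2) unfolding lr_object_def H_bicomodule_def
    by (simp_all add: tsum_coact[OF obj_preobj[OF assms(1)] assms(2), symmetric] assms(1))
  note this[THEN arg_cong[where f = f]]
  then show "TS H M P (lcoact M m) (\<lambda>x y. counit H x \<odot>\<^bsub>P\<^esub> f y) = f m"
    "TS M H P (rcoact M m) (\<lambda>x y. counit H y \<odot>\<^bsub>P\<^esub> f x) = f m"
    using assms by (simp_all add: lin_TS[of M P f] lin_smult[of M P f])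
qed

lemma comult_mult:
  "g \<in> carrier H \<Longrightarrow> h \<in> carrier H \<Longrightarrow> comult H (g \<otimes>\<^bsub>H\<^esub> h) =
    TS H H (H \<boxtimes> H) (comult H g) (\<lambda>g1 g2. TS H H (H \<boxtimes> H) (comult H h) (\<lambda>h1 h2.
      pr H H (g1 \<otimes>\<^bsub>H\<^esub> h1) (g2 \<otimes>\<^bsub>H\<^esub> h2)))"
  and comult_one: "comult H \<one>\<^bsub>H\<^esub> = pr H H \<one>\<^bsub>H\<^esub> \<one>\<^bsub>H\<^esub>"
  and counit_mult: "g \<in> carrier H \<Longrightarrow> h \<in> carrier H \<Longrightarrow>
    counit H (g \<otimes>\<^bsub>H\<^esub> h) = counit H g \<otimes>\<^bsub>K\<^esub> counit H h"
  and counit_one: "counit H \<one>\<^bsub>H\<^esub> = \<one>\<^bsub>K\<^esub>"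
proof -
  assume gh: "g \<in> carrier H" "h \<in> carrier H"
  then have "comult H (g \<otimes>\<^bsub>H\<^esub> h) = tsum (H \<boxtimes> H) (comult H g) (\<lambda>g1 g2.
           tsum (H \<boxtimes> H) (comult H h) (\<lambda>h1 h2. pr H H (g1 \<otimes>\<^bsub>H\<^esub> h1) (g2 \<otimes>\<^bsub>H\<^esub> h2)))"
    using bialgebra by (simp only: bialgebra_def)
  with gh show "comult H (g \<otimes>\<^bsub>H\<^esub> h) =
    TS H H (H \<boxtimes> H) (comult H g) (\<lambda>g1 g2. TS H H (H \<boxtimes> H) (comult H h) (\<lambda>h1 h2.
      pr H H (g1 \<otimes>\<^bsub>H\<^esub> h1) (g2 \<otimes>\<^bsub>H\<^esub> h2)))"
    by (simp add: tsum_comult)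
qed (use bialgebra in \<open>simp_all only: bialgebra_def\<close>)

lemma rcoact_lact:
  "obj M \<Longrightarrow> h \<in> carrier H \<Longrightarrow> m \<in> carrier M \<Longrightarrow>
    rcoact M (lact M h m) = TS M H (M \<boxtimes> H) (rcoact M m) (\<lambda>x b. pr M H (lact M h x) b)"
  and lcoact_ract:
  "obj M \<Longrightarrow> h \<in> carrier H \<Longrightarrow> m \<in> carrier M \<Longrightarrow>
    lcoact M (ract M m h) = TS H M (H \<boxtimes> M) (lcoact M m) (\<lambda>a x. pr H M a (ract M x h))"
proof -
  assume a: "obj M" "h \<in> carrier H" "m \<in> carrier M"
  then have "rcoact M (lact M h m) = tsum (M \<boxtimes> H) (rcoact M m) (\<lambda>x b. pr M H (lact M h x) b)"
    "lcoact M (ract M m h) = tsum (H \<boxtimes> M) (lcoact M m) (\<lambda>a x. pr H M a (ract M x h))"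
    by (simp_all only: lr_object_def)
  with a show "rcoact M (lact M h m) = TS M H (M \<boxtimes> H) (rcoact M m) (\<lambda>x b. pr M H (lact M h x) b)"
    "lcoact M (ract M m h) = TS H M (H \<boxtimes> M) (lcoact M m) (\<lambda>a x. pr H M a (ract M x h))"
    by (simp_all add: tsum_coact)
qed

text \<open>The Yetter-Drinfeld condition. \<open>G\<close> is applied to a product, which
  higher-order pattern matching cannot invert; therefore the later proofs name \<open>G\<close> and
  store the instance in a local equation \<open>Y\<close>. The same holds for
  \<open>rcoact_ract\<close>.\<close>

lemma lcoact_lact:
  assumes M: "obj M" and h: "h \<in> carrier H" and m: "m \<in> carrier M" and P: "module K P"
    and G: "\<And>x. x \<in> carrier M \<Longrightarrow> lin K H P (\<lambda>a. G a x)" "\<And>a. a \<in> carrier H \<Longrightarrow> lin K M P (\<lambda>x. G a x)"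
  shows "TS H H P (comult H h) (\<lambda>h1 h2. TS H M P (lcoact M (lact M h1 m)) (\<lambda>a x. G (a \<otimes>\<^bsub>H\<^esub> h2) x))
    = TS H H P (comult H h) (\<lambda>h1 h2. TS H M P (lcoact M m) (\<lambda>a x. G (h1 \<otimes>\<^bsub>H\<^esub> a) (lact M h2 x)))"
proof -
  have ax: "tsum (H \<boxtimes> M) (comult H h) (\<lambda>h1 h2.
         tsum (H \<boxtimes> M) (lcoact M (lact M h1 m)) (\<lambda>a x. pr H M (a \<otimes>\<^bsub>H\<^esub> h2) x))
       = tsum (H \<boxtimes> M) (comult H h) (\<lambda>h1 h2.
           tsum (H \<boxtimes> M) (lcoact M m) (\<lambda>a x. pr H M (h1 \<otimes>\<^bsub>H\<^esub> a) (lact M h2 x)))"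
    using M h m by (simp only: lr_object_def)
  have "TS H H (H \<boxtimes> M) (comult H h) (\<lambda>h1 h2.
      TS H M (H \<boxtimes> M) (lcoact M (lact M h1 m)) (\<lambda>a x. pr H M (a \<otimes>\<^bsub>H\<^esub> h2) x))
    = TS H H (H \<boxtimes> M) (comult H h) (\<lambda>h1 h2.
      TS H M (H \<boxtimes> M) (lcoact M m) (\<lambda>a x. pr H M (h1 \<otimes>\<^bsub>H\<^esub> a) (lact M h2 x)))"
    using ax M h m by (simp add: tsum_comult tsum_coact)
  from arg_cong[where f = "\<lambda>z. TS H M P z (\<lambda>a x. G a x)", OF this] show ?thesis
    using M h m P G by (simp add: TS_TS TS_pure)
qed

lemma rcoact_ract:
  assumes M: "obj M" and h: "h \<in> carrier H" and m: "m \<in> carrier M" and P: "module K P"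
    and G: "\<And>x. x \<in> carrier M \<Longrightarrow> lin K H P (\<lambda>a. G x a)" "\<And>a. a \<in> carrier H \<Longrightarrow> lin K M P (\<lambda>x. G x a)"
  shows "TS H H P (comult H h) (\<lambda>h1 h2. TS M H P (rcoact M (ract M m h2)) (\<lambda>x b. G x (h1 \<otimes>\<^bsub>H\<^esub> b)))
    = TS H H P (comult H h) (\<lambda>h1 h2. TS M H P (rcoact M m) (\<lambda>x b. G (ract M x h1) (b \<otimes>\<^bsub>H\<^esub> h2)))"
proof -
  have ax: "tsum (M \<boxtimes> H) (comult H h) (\<lambda>h1 h2.
         tsum (M \<boxtimes> H) (rcoact M (ract M m h2)) (\<lambda>x b. pr M H x (h1 \<otimes>\<^bsub>H\<^esub> b)))
       = tsum (M \<boxtimes> H) (comult H h) (\<lambda>h1 h2.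
           tsum (M \<boxtimes> H) (rcoact M m) (\<lambda>x b. pr M H (ract M x h1) (b \<otimes>\<^bsub>H\<^esub> h2)))"
    using M h m by (simp only: lr_object_def)
  have "TS H H (M \<boxtimes> H) (comult H h) (\<lambda>h1 h2.
      TS M H (M \<boxtimes> H) (rcoact M (ract M m h2)) (\<lambda>x b. pr M H x (h1 \<otimes>\<^bsub>H\<^esub> b)))
    = TS H H (M \<boxtimes> H) (comult H h) (\<lambda>h1 h2.
      TS M H (M \<boxtimes> H) (rcoact M m) (\<lambda>x b. pr M H (ract M x h1) (b \<otimes>\<^bsub>H\<^esub> h2)))"
    using ax M h m by (simp add: tsum_comult tsum_coact)
  from arg_cong[where f = "\<lambda>z. TS M H P z (\<lambda>a x. G a x)", OF this] show ?thesis
    using M h m P G by (simp add: TS_TS TS_pure)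
qed

section \<open>Objects\<close>

text \<open>Directed so that sums move outwards past products, actions, coactions and tensor signs,
  and scalars move out of tensors. What is left are iterated sums over coactions and
  comultiplications, which differ by the order of summation and by the axioms added at each call.
  Coassociativity and \<open>TS_swap\<close> are absent, being needed in both directions.\<close>

lemmas sweedler_simps = TS_TS TS_pure pure_TS1 pure_TS2 pure_smult1 pure_smult2 TS_smult smult_TS1 TS_arg_smult
  mult_TS comult_TS act_TS act_smult mult_smult rcoact_lact lcoact_ract
  comult_mult comult_one counit_mult counit_one

text \<open>The passage from \<open>tsum\<close> to \<open>TS\<close> needs closure conditions that
  \<open>preobj\<close> supplies. It is made here once, so that the proofs for tensor products and
  for the unit compute with \<open>TS\<close> alone.\<close>

lemma lr_objectI:
  assumes p: "preobj M"
    and one: "\<And>m. m \<in> carrier M \<Longrightarrow> lact M \<one>\<^bsub>H\<^esub> m = m" "\<And>m. m \<in> carrier M \<Longrightarrow> ract M m \<one>\<^bsub>H\<^esub> = m"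
    and act: "\<And>g h m. \<lbrakk>g \<in> carrier H; h \<in> carrier H; m \<in> carrier M\<rbrakk> \<Longrightarrow>
         lact M (g \<otimes>\<^bsub>H\<^esub> h) m = lact M g (lact M h m)"
      "\<And>g h m. \<lbrakk>g \<in> carrier H; h \<in> carrier H; m \<in> carrier M\<rbrakk> \<Longrightarrow>
         ract M m (g \<otimes>\<^bsub>H\<^esub> h) = ract M (ract M m g) h"
      "\<And>g h m. \<lbrakk>g \<in> carrier H; h \<in> carrier H; m \<in> carrier M\<rbrakk> \<Longrightarrow>
         ract M (lact M g m) h = lact M g (ract M m h)"
    and counit: "\<And>m. m \<in> carrier M \<Longrightarrow> TS H M M (lcoact M m) (\<lambda>a x. counit H a \<odot>\<^bsub>M\<^esub> x) = m"
      "\<And>m. m \<in> carrier M \<Longrightarrow> TS M H M (rcoact M m) (\<lambda>x b. counit H b \<odot>\<^bsub>M\<^esub> x) = m"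
    and coact: "\<And>m. m \<in> carrier M \<Longrightarrow> TS H M (H \<boxtimes> H \<boxtimes> M) (lcoact M m) (\<lambda>a x.
         TS H H (H \<boxtimes> H \<boxtimes> M) (comult H a) (\<lambda>a1 a2. pr H (H \<boxtimes> M) a1 (pr H M a2 x)))
       = TS H M (H \<boxtimes> H \<boxtimes> M) (lcoact M m) (\<lambda>a x. pr H (H \<boxtimes> M) a (lcoact M x))"
      "\<And>m. m \<in> carrier M \<Longrightarrow> TS M H (M \<boxtimes> H \<boxtimes> H) (rcoact M m) (\<lambda>x b.
         TS M H (M \<boxtimes> H \<boxtimes> H) (rcoact M x) (\<lambda>y a. pr M (H \<boxtimes> H) y (pr H H a b)))
       = TS M H (M \<boxtimes> H \<boxtimes> H) (rcoact M m) (\<lambda>x b. pr M (H \<boxtimes> H) x (comult H b))"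
      "\<And>m. m \<in> carrier M \<Longrightarrow> TS M H (H \<boxtimes> M \<boxtimes> H) (rcoact M m) (\<lambda>x b.
         TS H M (H \<boxtimes> M \<boxtimes> H) (lcoact M x) (\<lambda>a y. pr H (M \<boxtimes> H) a (pr M H y b)))
       = TS H M (H \<boxtimes> M \<boxtimes> H) (lcoact M m) (\<lambda>a x. pr H (M \<boxtimes> H) a (rcoact M x))"
    and compat: "\<And>h m. \<lbrakk>h \<in> carrier H; m \<in> carrier M\<rbrakk> \<Longrightarrow> TS H H (H \<boxtimes> M) (comult H h) (\<lambda>h1 h2.
         TS H M (H \<boxtimes> M) (lcoact M (lact M h1 m)) (\<lambda>a x. pr H M (a \<otimes>\<^bsub>H\<^esub> h2) x))
       = TS H H (H \<boxtimes> M) (comult H h) (\<lambda>h1 h2.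
           TS H M (H \<boxtimes> M) (lcoact M m) (\<lambda>a x. pr H M (h1 \<otimes>\<^bsub>H\<^esub> a) (lact M h2 x)))"
      "\<And>h m. \<lbrakk>h \<in> carrier H; m \<in> carrier M\<rbrakk> \<Longrightarrow> rcoact M (lact M h m)
       = TS M H (M \<boxtimes> H) (rcoact M m) (\<lambda>x b. pr M H (lact M h x) b)"
      "\<And>h m. \<lbrakk>h \<in> carrier H; m \<in> carrier M\<rbrakk> \<Longrightarrow> TS H H (M \<boxtimes> H) (comult H h) (\<lambda>h1 h2.
         TS M H (M \<boxtimes> H) (rcoact M (ract M m h2)) (\<lambda>x b. pr M H x (h1 \<otimes>\<^bsub>H\<^esub> b)))
       = TS H H (M \<boxtimes> H) (comult H h) (\<lambda>h1 h2.
           TS M H (M \<boxtimes> H) (rcoact M m) (\<lambda>x b. pr M H (ract M x h1) (b \<otimes>\<^bsub>H\<^esub> h2)))"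
      "\<And>h m. \<lbrakk>h \<in> carrier H; m \<in> carrier M\<rbrakk> \<Longrightarrow> lcoact M (ract M m h)
       = TS H M (H \<boxtimes> M) (lcoact M m) (\<lambda>a x. pr H M a (ract M x h))"
  shows "obj M"
  unfolding lr_object_def H_bimodule_def H_bicomodule_def
  apply (intro conjI ballI)
  subgoal using p by (simp only: preobj_def)
  subgoal using p by (simp only: preobj_def)
  subgoal using p by (simp only: preobj_def)
  subgoal using one by blast
  subgoal using one by blast
  subgoal using act by blast
  subgoal using act by blast
  subgoal using act by blast
  subgoal using p by (simp only: preobj_def)
  subgoal using p by (simp only: preobj_def)
  subgoal using p by (simp only: preobj_def)
  subgoal using counit p by (simp add: tsum_coact)
  subgoal using counit p by (simp add: tsum_coact)
  subgoal using coact(1) p by (simp add: tsum_coact tsum_comult)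
  subgoal using coact(2) p by (simp add: tsum_coact tsum_comult)
  subgoal using coact(3) p by (simp add: tsum_coact tsum_comult)
  subgoal using compat(1) p by (simp add: tsum_coact tsum_comult)
  subgoal using compat(2) p by (simp add: tsum_coact tsum_comult)
  subgoal using compat(3) p by (simp add: tsum_coact tsum_comult)
  subgoal using compat(4) p by (simp add: tsum_coact tsum_comult)
  done

abbreviation lr_tens (infixr \<open>\<boxdot>\<close> 75) where "M \<boxdot> N \<equiv> lr_tensor K H M N"

lemma lr_tensor_ops:
  assumes "preobj M" "preobj N" "t \<in> carrier (M \<boxtimes> N)"
  shows "h \<in> carrier H \<Longrightarrow> lact (M \<boxdot> N) h t = TS H H (M \<boxtimes> N) (comult H h) (\<lambda>h1 h2.
        TS M N (M \<boxtimes> N) t (\<lambda>m n. pr M N (lact M h1 m) (lact N h2 n)))"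
    "h \<in> carrier H \<Longrightarrow> ract (M \<boxdot> N) t h = TS H H (M \<boxtimes> N) (comult H h) (\<lambda>h1 h2.
        TS M N (M \<boxtimes> N) t (\<lambda>m n. pr M N (ract M m h1) (ract N n h2)))"
    "lcoact (M \<boxdot> N) t = TS M N (H \<boxtimes> M \<boxtimes> N) t (\<lambda>m n.
        TS H M (H \<boxtimes> M \<boxtimes> N) (lcoact M m) (\<lambda>a x.
          TS H N (H \<boxtimes> M \<boxtimes> N) (lcoact N n) (\<lambda>b y.
            pr H (M \<boxtimes> N) (a \<otimes>\<^bsub>H\<^esub> b) (pr M N x y))))"
    "rcoact (M \<boxdot> N) t = TS M N ((M \<boxtimes> N) \<boxtimes> H) t (\<lambda>m n.
        TS M H ((M \<boxtimes> N) \<boxtimes> H) (rcoact M m) (\<lambda>x a.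
          TS N H ((M \<boxtimes> N) \<boxtimes> H) (rcoact N n) (\<lambda>y b.
            pr (M \<boxtimes> N) H (pr M N x y) (a \<otimes>\<^bsub>H\<^esub> b))))"
  using assms by (simp_all add: lr_tensor_def module.extend_def lr_module.fields_def
      tsum_comult tsum_coact tsum_TS[OF assms(3)])

text \<open>By \<open>lr_tensor_ops\<close> each structure map agrees on the carrier with an
  explicit \<open>TS\<close> expression, whose linearity the simp rules recognize.\<close>

lemma lr_tensor_preobj [simp]:
  assumes "preobj M" "preobj N"
  shows "preobj (M \<boxdot> N)"
proof -
  note [simp] = assms
  have "bilin K H (M \<boxtimes> N) (M \<boxtimes> N) (lact (M \<boxdot> N))"
    by (intro bilinI; rule lin_eqI[rotated 2], rule lr_tensor_ops; simp)
  moreover have "bilin K (M \<boxtimes> N) H (M \<boxtimes> N) (ract (M \<boxdot> N))"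
    by (intro bilinI; rule lin_eqI[rotated 2], rule lr_tensor_ops; simp)
  moreover have "lin K (M \<boxtimes> N) (H \<boxtimes> M \<boxtimes> N) (lcoact (M \<boxdot> N))"
    by (rule lin_eqI[rotated 2], rule lr_tensor_ops; simp)
  moreover have "lin K (M \<boxtimes> N) ((M \<boxtimes> N) \<boxtimes> H) (rcoact (M \<boxdot> N))"
    by (rule lin_eqI[rotated 2], rule lr_tensor_ops; simp)
  ultimately show ?thesis
    by (simp only: preobj_def) (simp add: bilin_def)
qed

lemma lr_tensor_pure:
  assumes "preobj M" "preobj N" "m \<in> carrier M" "n \<in> carrier N" "same_module A M" "same_module B N"
  shows "h \<in> carrier H \<Longrightarrow> lact (M \<boxdot> N) h (pr A B m n) = TS H H (M \<boxtimes> N) (comult H h) (\<lambda>h1 h2.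
        pr M N (lact M h1 m) (lact N h2 n))"
    "h \<in> carrier H \<Longrightarrow> ract (M \<boxdot> N) (pr A B m n) h = TS H H (M \<boxtimes> N) (comult H h) (\<lambda>h1 h2.
        pr M N (ract M m h1) (ract N n h2))"
    "lcoact (M \<boxdot> N) (pr A B m n) =
        TS H M (H \<boxtimes> M \<boxtimes> N) (lcoact M m) (\<lambda>a x.
          TS H N (H \<boxtimes> M \<boxtimes> N) (lcoact N n) (\<lambda>b y.
            pr H (M \<boxtimes> N) (a \<otimes>\<^bsub>H\<^esub> b) (pr M N x y)))"
    "rcoact (M \<boxdot> N) (pr A B m n) =
        TS M H ((M \<boxtimes> N) \<boxtimes> H) (rcoact M m) (\<lambda>x a.
          TS N H ((M \<boxtimes> N) \<boxtimes> H) (rcoact N n) (\<lambda>y b.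
            pr (M \<boxtimes> N) H (pr M N x y) (a \<otimes>\<^bsub>H\<^esub> b)))"
  unfolding same_moduleD[OF assms(5)] same_moduleD[OF assms(6)]
  using assms(1-4) by (simp_all add: lr_tensor_ops TS_pure)

abbreviation DS where "DS P h F \<equiv> TS H H P (comult H h) F"
abbreviation LS where "LS M P m F \<equiv> TS H M P (lcoact M m) F"
abbreviation RS where "RS M P m F \<equiv> TS M H P (rcoact M m) F"

lemma smult_assoc:
  "module K P \<Longrightarrow> a \<in> carrier K \<Longrightarrow> b \<in> carrier K \<Longrightarrow> x \<in> carrier P \<Longrightarrow>
    (a \<otimes>\<^bsub>K\<^esub> b) \<odot>\<^bsub>P\<^esub> x = a \<odot>\<^bsub>P\<^esub> (b \<odot>\<^bsub>P\<^esub> x)"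
  by (rule module.smult_assoc1)

text \<open>The Yetter-Drinfeld condition of a tensor product on pure tensors, in the normal form
  produced by simplification. With the iterated coproduct of h written h_1 \<otimes> h_2 \<otimes>
  h_3, the condition for N is used on (h_2, h_3) and then that for M on (h_1, h_2). N comes first
  because its coaction stands next to h_3. Coassociativity regroups the three factors, and the swaps
  make the required pair of sums adjacent.\<close>

lemma lcoact_lact_tensor:
  assumes [simp]: "obj M" "obj N" "m \<in> carrier M" "n \<in> carrier N" "h \<in> carrier H"
  shows "DS (H \<boxtimes> M \<boxtimes> N) h (\<lambda>x h3. DS (H \<boxtimes> M \<boxtimes> N) x (\<lambda>h1 h2.
      LS M (H \<boxtimes> M \<boxtimes> N) (lact M h1 m) (\<lambda>a y. LS N (H \<boxtimes> M \<boxtimes> N) (lact N h2 n) (\<lambda>b z.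
        pr H (M \<boxtimes> N) (a \<otimes>\<^bsub>H\<^esub> (b \<otimes>\<^bsub>H\<^esub> h3)) (pr M N y z)))))
    = DS (H \<boxtimes> M \<boxtimes> N) h (\<lambda>h1 x. LS M (H \<boxtimes> M \<boxtimes> N) m (\<lambda>a y. LS N (H \<boxtimes> M \<boxtimes> N) n (\<lambda>b z.
      DS (H \<boxtimes> M \<boxtimes> N) x (\<lambda>h2 h3.
        pr H (M \<boxtimes> N) (h1 \<otimes>\<^bsub>H\<^esub> (a \<otimes>\<^bsub>H\<^esub> b)) (pr M N (lact M h2 y) (lact N h3 z))))))"
proof -
  let ?P = "H \<boxtimes> M \<boxtimes> N"
  have Y1: "DS ?P x (\<lambda>h1 h2. LS M ?P (lact M h1 m) (\<lambda>a y. pr H (M \<boxtimes> N) (a \<otimes>\<^bsub>H\<^esub> (h2 \<otimes>\<^bsub>H\<^esub> b)) (pr M N y z)))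
    = DS ?P x (\<lambda>h1 h2. LS M ?P m (\<lambda>a y. pr H (M \<boxtimes> N) (h1 \<otimes>\<^bsub>H\<^esub> (a \<otimes>\<^bsub>H\<^esub> b)) (pr M N (lact M h2 y) z)))"
    if "b \<in> carrier H" "z \<in> carrier N" "x \<in> carrier H" for b z x
    using lcoact_lact[where M = M and m = m and h = x and P = ?P and
        G = "\<lambda>a y. pr H (M \<boxtimes> N) (a \<otimes>\<^bsub>H\<^esub> b) (pr M N y z)"] that by simp
  have Y2: "DS ?P x (\<lambda>h1 h2. LS N ?P (lact N h1 n) (\<lambda>b z. pr H (M \<boxtimes> N) (a \<otimes>\<^bsub>H\<^esub> (b \<otimes>\<^bsub>H\<^esub> h2)) (pr M N y z)))
    = DS ?P x (\<lambda>h1 h2. LS N ?P n (\<lambda>b z. pr H (M \<boxtimes> N) (a \<otimes>\<^bsub>H\<^esub> (h1 \<otimes>\<^bsub>H\<^esub> b)) (pr M N y (lact N h2 z))))"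
    if "a \<in> carrier H" "y \<in> carrier M" "x \<in> carrier H" for a y x
    using lcoact_lact[where M = N and m = n and h = x and P = ?P and
        G = "\<lambda>b z. pr H (M \<boxtimes> N) (a \<otimes>\<^bsub>H\<^esub> b) (pr M N y z)"] that by simp
  have "DS ?P h (\<lambda>x h3. DS ?P x (\<lambda>h1 h2.
      LS M ?P (lact M h1 m) (\<lambda>a y. LS N ?P (lact N h2 n) (\<lambda>b z.
        pr H (M \<boxtimes> N) (a \<otimes>\<^bsub>H\<^esub> (b \<otimes>\<^bsub>H\<^esub> h3)) (pr M N y z)))))
    = DS ?P h (\<lambda>h1 x. LS M ?P (lact M h1 m) (\<lambda>a y. DS ?P x (\<lambda>h2 h3. LS N ?P (lact N h2 n) (\<lambda>b z.
        pr H (M \<boxtimes> N) (a \<otimes>\<^bsub>H\<^esub> (b \<otimes>\<^bsub>H\<^esub> h3)) (pr M N y z)))))"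
    by (simp add: comult_coassoc TS_swap[where s = "comult H x" and t = "lcoact M y" for x y])
  also have "\<dots> = DS ?P h (\<lambda>h1 x. LS M ?P (lact M h1 m) (\<lambda>a y. DS ?P x (\<lambda>h2 h3. LS N ?P n (\<lambda>b z.
        pr H (M \<boxtimes> N) (a \<otimes>\<^bsub>H\<^esub> (h2 \<otimes>\<^bsub>H\<^esub> b)) (pr M N y (lact N h3 z))))))"
    by (simp add: Y2)
  also have "\<dots> = DS ?P h (\<lambda>h1 x. DS ?P x (\<lambda>h2 h3. LS M ?P (lact M h1 m) (\<lambda>a y. LS N ?P n (\<lambda>b z.
        pr H (M \<boxtimes> N) (a \<otimes>\<^bsub>H\<^esub> (h2 \<otimes>\<^bsub>H\<^esub> b)) (pr M N y (lact N h3 z))))))"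
    by (simp add: TS_swap[where s = "lcoact M y" and t = "comult H x" for x y])
  also have "\<dots> = DS ?P h (\<lambda>x h3. LS N ?P n (\<lambda>b z. DS ?P x (\<lambda>h1 h2. LS M ?P (lact M h1 m) (\<lambda>a y.
        pr H (M \<boxtimes> N) (a \<otimes>\<^bsub>H\<^esub> (h2 \<otimes>\<^bsub>H\<^esub> b)) (pr M N y (lact N h3 z))))))"
    by (simp add: comult_coassoc[symmetric] TS_swap[where s = "lcoact M y" and t = "lcoact N x" for x y]
      TS_swap[where s = "comult H y" and t = "lcoact N x" for x y])
  also have "\<dots> = DS ?P h (\<lambda>x h3. LS N ?P n (\<lambda>b z. DS ?P x (\<lambda>h1 h2. LS M ?P m (\<lambda>a y.
        pr H (M \<boxtimes> N) (h1 \<otimes>\<^bsub>H\<^esub> (a \<otimes>\<^bsub>H\<^esub> b)) (pr M N (lact M h2 y) (lact N h3 z))))))"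
    by (simp add: Y1)
  also have "\<dots> = DS ?P h (\<lambda>x h3. DS ?P x (\<lambda>h1 h2. LS M ?P m (\<lambda>a y. LS N ?P n (\<lambda>b z.
        pr H (M \<boxtimes> N) (h1 \<otimes>\<^bsub>H\<^esub> (a \<otimes>\<^bsub>H\<^esub> b)) (pr M N (lact M h2 y) (lact N h3 z))))))"
    by (simp add: TS_swap[where s = "lcoact N y" and t = "lcoact M x" for x y]
       TS_swap[where t = "comult H y" and s = "lcoact N x" for x y])
  also have "\<dots> = DS ?P h (\<lambda>h1 x. LS M ?P m (\<lambda>a y. LS N ?P n (\<lambda>b z. DS ?P x (\<lambda>h2 h3.
        pr H (M \<boxtimes> N) (h1 \<otimes>\<^bsub>H\<^esub> (a \<otimes>\<^bsub>H\<^esub> b)) (pr M N (lact M h2 y) (lact N h3 z))))))"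
    by (simp add: comult_coassoc TS_swap[where s = "lcoact M y" and t = "comult H x" for x y]
        TS_swap[where s = "lcoact N y" and t = "comult H x" for x y])
  finally show ?thesis .
qed

text \<open>The mirror image of \<open>lcoact_lact_tensor\<close>: here M comes first, on (h_1,
  h_2), because its coaction stands next to h_1, and N follows on (h_2, h_3).\<close>

lemma rcoact_ract_tensor:
  assumes [simp]: "obj M" "obj N" "m \<in> carrier M" "n \<in> carrier N" "h \<in> carrier H"
  shows "DS ((M \<boxtimes> N) \<boxtimes> H) h (\<lambda>h1 x. DS ((M \<boxtimes> N) \<boxtimes> H) x (\<lambda>h2 h3.
      RS M ((M \<boxtimes> N) \<boxtimes> H) (ract M m h2) (\<lambda>y a. RS N ((M \<boxtimes> N) \<boxtimes> H) (ract N n h3) (\<lambda>z b.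
        pr (M \<boxtimes> N) H (pr M N y z) (h1 \<otimes>\<^bsub>H\<^esub> (a \<otimes>\<^bsub>H\<^esub> b))))))
    = DS ((M \<boxtimes> N) \<boxtimes> H) h (\<lambda>x h3. RS M ((M \<boxtimes> N) \<boxtimes> H) m (\<lambda>y a. RS N ((M \<boxtimes> N) \<boxtimes> H) n (\<lambda>z b.
      DS ((M \<boxtimes> N) \<boxtimes> H) x (\<lambda>h1 h2.
        pr (M \<boxtimes> N) H (pr M N (ract M y h1) (ract N z h2)) (a \<otimes>\<^bsub>H\<^esub> (b \<otimes>\<^bsub>H\<^esub> h3))))))"
proof -
  let ?P = "(M \<boxtimes> N) \<boxtimes> H"
  have Y1: "DS ?P x (\<lambda>h1 h2. RS M ?P (ract M m h2) (\<lambda>y a. pr (M \<boxtimes> N) H (pr M N y z) (h1 \<otimes>\<^bsub>H\<^esub> (a \<otimes>\<^bsub>H\<^esub> b))))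
    = DS ?P x (\<lambda>h1 h2. RS M ?P m (\<lambda>y a. pr (M \<boxtimes> N) H (pr M N (ract M y h1) z) (a \<otimes>\<^bsub>H\<^esub> (h2 \<otimes>\<^bsub>H\<^esub> b))))"
    if "b \<in> carrier H" "z \<in> carrier N" "x \<in> carrier H" for b z x
    using rcoact_ract[where M = M and m = m and h = x and P = ?P and
        G = "\<lambda>y a. pr (M \<boxtimes> N) H (pr M N y z) (a \<otimes>\<^bsub>H\<^esub> b)"] that by simp
  have Y2: "DS ?P x (\<lambda>h1 h2. RS N ?P (ract N n h2) (\<lambda>z b. pr (M \<boxtimes> N) H (pr M N y z) (a \<otimes>\<^bsub>H\<^esub> (h1 \<otimes>\<^bsub>H\<^esub> b))))
    = DS ?P x (\<lambda>h1 h2. RS N ?P n (\<lambda>z b. pr (M \<boxtimes> N) H (pr M N y (ract N z h1)) (a \<otimes>\<^bsub>H\<^esub> (b \<otimes>\<^bsub>H\<^esub> h2))))"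
    if "a \<in> carrier H" "y \<in> carrier M" "x \<in> carrier H" for a y x
    using rcoact_ract[where M = N and m = n and h = x and P = ?P and
        G = "\<lambda>z b. pr (M \<boxtimes> N) H (pr M N y z) (a \<otimes>\<^bsub>H\<^esub> b)"] that by simp
  have "DS ?P h (\<lambda>h1 x. DS ?P x (\<lambda>h2 h3.
      RS M ?P (ract M m h2) (\<lambda>y a. RS N ?P (ract N n h3) (\<lambda>z b.
        pr (M \<boxtimes> N) H (pr M N y z) (h1 \<otimes>\<^bsub>H\<^esub> (a \<otimes>\<^bsub>H\<^esub> b))))))
    = DS ?P h (\<lambda>x h3. RS N ?P (ract N n h3) (\<lambda>z b. DS ?P x (\<lambda>h1 h2.
      RS M ?P (ract M m h2) (\<lambda>y a.
        pr (M \<boxtimes> N) H (pr M N y z) (h1 \<otimes>\<^bsub>H\<^esub> (a \<otimes>\<^bsub>H\<^esub> b))))))"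
    by (simp add: comult_coassoc[symmetric] TS_swap[where s = "rcoact M y" and t = "rcoact N x" for x y]
      TS_swap[where s = "comult H y" and t = "rcoact N x" for x y])
  also have "\<dots> = DS ?P h (\<lambda>x h3. RS N ?P (ract N n h3) (\<lambda>z b. DS ?P x (\<lambda>h1 h2.
      RS M ?P m (\<lambda>y a.
        pr (M \<boxtimes> N) H (pr M N (ract M y h1) z) (a \<otimes>\<^bsub>H\<^esub> (h2 \<otimes>\<^bsub>H\<^esub> b))))))"
    by (simp add: Y1)
  also have "\<dots> = DS ?P h (\<lambda>x h3. DS ?P x (\<lambda>h1 h2. RS M ?P m (\<lambda>y a. RS N ?P (ract N n h3) (\<lambda>z b.
        pr (M \<boxtimes> N) H (pr M N (ract M y h1) z) (a \<otimes>\<^bsub>H\<^esub> (h2 \<otimes>\<^bsub>H\<^esub> b))))))"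
    by (simp add: TS_swap[where t = "rcoact M y" and s = "rcoact N x" for x y]
      TS_swap[where t = "comult H y" and s = "rcoact N x" for x y])
  also have "\<dots> = DS ?P h (\<lambda>h1 x. RS M ?P m (\<lambda>y a. DS ?P x (\<lambda>h2 h3. RS N ?P (ract N n h3) (\<lambda>z b.
        pr (M \<boxtimes> N) H (pr M N (ract M y h1) z) (a \<otimes>\<^bsub>H\<^esub> (h2 \<otimes>\<^bsub>H\<^esub> b))))))"
    by (simp add: comult_coassoc TS_swap[where s = "comult H y" and t = "rcoact M x" for x y])
  also have "\<dots> = DS ?P h (\<lambda>h1 x. RS M ?P m (\<lambda>y a. DS ?P x (\<lambda>h2 h3. RS N ?P n (\<lambda>z b.
        pr (M \<boxtimes> N) H (pr M N (ract M y h1) (ract N z h2)) (a \<otimes>\<^bsub>H\<^esub> (b \<otimes>\<^bsub>H\<^esub> h3))))))"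
    by (simp add: Y2)
  also have "\<dots> = DS ?P h (\<lambda>h1 x. DS ?P x (\<lambda>h2 h3. RS M ?P m (\<lambda>y a. RS N ?P n (\<lambda>z b.
        pr (M \<boxtimes> N) H (pr M N (ract M y h1) (ract N z h2)) (a \<otimes>\<^bsub>H\<^esub> (b \<otimes>\<^bsub>H\<^esub> h3))))))"
    by (simp add: TS_swap[where t = "comult H y" and s = "rcoact M x" for x y])
  also have "\<dots> = DS ?P h (\<lambda>x h3. RS M ?P m (\<lambda>y a. RS N ?P n (\<lambda>z b. DS ?P x (\<lambda>h1 h2.
        pr (M \<boxtimes> N) H (pr M N (ract M y h1) (ract N z h2)) (a \<otimes>\<^bsub>H\<^esub> (b \<otimes>\<^bsub>H\<^esub> h3))))))"
    by (simp add: comult_coassoc[symmetric] TS_swap[where s = "rcoact M y" and t = "comult H x" for x y]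
        TS_swap[where s = "rcoact N y" and t = "comult H x" for x y])
  finally show ?thesis .
qed

text \<open>Multiplicativity of \<open>comult\<close> makes the diagonal actions associative and the
  diagonal coactions coassociative; multiplicativity of \<open>counit\<close> makes the latter
  counital. The bicomodule axiom and the Long conditions hold factor by factor. Only the two
  Yetter-Drinfeld conditions mix the factors, which is the content of the two preceding
  lemmas.\<close>

lemma lr_tensor_obj [simp]:
  assumes "obj M" "obj N"
  shows "obj (M \<boxdot> N)"
proof (rule lr_objectI)
  note [simp] = assms sweedler_simps lr_tensor_pure
  show "preobj (M \<boxdot> N)" by simp
  fix t assume "t \<in> carrier (M \<boxdot> N)"
  then have t: "t \<in> carrier (M \<boxtimes> N)" by simp
  show "lact (M \<boxdot> N) \<one>\<^bsub>H\<^esub> t = t"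
    by (rule tensor_ext[where t = t and P = "M \<boxtimes> N", OF _ _ _ _ _ _ t]) simp_all
  show "ract (M \<boxdot> N) t \<one>\<^bsub>H\<^esub> = t"
    by (rule tensor_ext[where t = t and P = "M \<boxtimes> N", OF _ _ _ _ _ _ t]) simp_all
  { fix g h assume [simp]: "g \<in> carrier H" "h \<in> carrier H"
    show "lact (M \<boxdot> N) (g \<otimes>\<^bsub>H\<^esub> h) t = lact (M \<boxdot> N) g (lact (M \<boxdot> N) h t)"
      by (rule tensor_ext[where t = t and P = "M \<boxtimes> N", OF _ _ _ _ _ _ t])
        (simp_all add: TS_swap[where s = "comult H g" and t = "comult H h"])
    show "ract (M \<boxdot> N) t (g \<otimes>\<^bsub>H\<^esub> h) = ract (M \<boxdot> N) (ract (M \<boxdot> N) t g) h"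
      by (rule tensor_ext[where t = t and P = "M \<boxtimes> N", OF _ _ _ _ _ _ t])
        (simp_all add: TS_swap[where s = "comult H g" and t = "comult H h"])
    show "ract (M \<boxdot> N) (lact (M \<boxdot> N) g t) h = lact (M \<boxdot> N) g (ract (M \<boxdot> N) t h)"
      by (rule tensor_ext[where t = t and P = "M \<boxtimes> N", OF _ _ _ _ _ _ t])
        (simp_all add: TS_swap[where s = "comult H g" and t = "comult H h"]) }
  show "TS H (M \<boxdot> N) (M \<boxdot> N) (lcoact (M \<boxdot> N) t) (\<lambda>a x. counit H a \<odot>\<^bsub>M \<boxdot> N\<^esub> x) = t"
    by (rule tensor_ext[where t = t and P = "M \<boxtimes> N", OF _ _ _ _ _ _ t])
      (simp_all add: smult_assoc coact_counit)
  show "TS (M \<boxdot> N) H (M \<boxdot> N) (rcoact (M \<boxdot> N) t) (\<lambda>x b. counit H b \<odot>\<^bsub>M \<boxdot> N\<^esub> x) = t"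
    by (rule tensor_ext[where t = t and P = "M \<boxtimes> N", OF _ _ _ _ _ _ t])
      (simp_all add: smult_assoc coact_counit)
  show "TS H (M \<boxdot> N) (H \<boxtimes> H \<boxtimes> (M \<boxdot> N)) (lcoact (M \<boxdot> N) t) (\<lambda>a x.
         TS H H (H \<boxtimes> H \<boxtimes> (M \<boxdot> N)) (comult H a) (\<lambda>a1 a2. pr H (H \<boxtimes> (M \<boxdot> N)) a1 (pr H (M \<boxdot> N) a2 x)))
       = TS H (M \<boxdot> N) (H \<boxtimes> H \<boxtimes> (M \<boxdot> N)) (lcoact (M \<boxdot> N) t) (\<lambda>a x. pr H (H \<boxtimes> (M \<boxdot> N)) a (lcoact (M \<boxdot> N) x))"
    by (rule tensor_ext[where t = t and P = "H \<boxtimes> H \<boxtimes> M \<boxtimes> N", OF _ _ _ _ _ _ t])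
      (simp_all add: lcoact_coassoc TS_swap[where s = "lcoact N x" and t = "comult H y" for x y]
        TS_swap[where s = "lcoact N n" and t = "lcoact M b" for n b])
  show "TS (M \<boxdot> N) H ((M \<boxdot> N) \<boxtimes> H \<boxtimes> H) (rcoact (M \<boxdot> N) t) (\<lambda>x b.
         TS (M \<boxdot> N) H ((M \<boxdot> N) \<boxtimes> H \<boxtimes> H) (rcoact (M \<boxdot> N) x) (\<lambda>y a. pr (M \<boxdot> N) (H \<boxtimes> H) y (pr H H a b)))
       = TS (M \<boxdot> N) H ((M \<boxdot> N) \<boxtimes> H \<boxtimes> H) (rcoact (M \<boxdot> N) t) (\<lambda>x b. pr (M \<boxdot> N) (H \<boxtimes> H) x (comult H b))"
    by (rule tensor_ext[where t = t and P = "(M \<boxtimes> N) \<boxtimes> H \<boxtimes> H", OF _ _ _ _ _ _ t])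
      (simp_all add: rcoact_coassoc TS_swap[where s = "rcoact N x" and t = "comult H y" for x y]
        TS_swap[where s = "rcoact N n" and t = "rcoact M b" for n b])
  show "TS (M \<boxdot> N) H (H \<boxtimes> (M \<boxdot> N) \<boxtimes> H) (rcoact (M \<boxdot> N) t) (\<lambda>x b.
         TS H (M \<boxdot> N) (H \<boxtimes> (M \<boxdot> N) \<boxtimes> H) (lcoact (M \<boxdot> N) x) (\<lambda>a y. pr H ((M \<boxdot> N) \<boxtimes> H) a (pr (M \<boxdot> N) H y b)))
       = TS H (M \<boxdot> N) (H \<boxtimes> (M \<boxdot> N) \<boxtimes> H) (lcoact (M \<boxdot> N) t) (\<lambda>a x. pr H ((M \<boxdot> N) \<boxtimes> H) a (rcoact (M \<boxdot> N) x))"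
    by (rule tensor_ext[where t = t and P = "H \<boxtimes> (M \<boxtimes> N) \<boxtimes> H", OF _ _ _ _ _ _ t])
      (simp_all add: coact_bicomodule TS_swap[where s = "lcoact N x" and t = "rcoact M y" for x y]
        TS_swap[where s = "rcoact N n" and t = "lcoact M b" for n b])
  fix h assume h [simp]: "h \<in> carrier H"
  show "rcoact (M \<boxdot> N) (lact (M \<boxdot> N) h t)
       = TS (M \<boxdot> N) H ((M \<boxdot> N) \<boxtimes> H) (rcoact (M \<boxdot> N) t) (\<lambda>x b. pr (M \<boxdot> N) H (lact (M \<boxdot> N) h x) b)"
    by (rule tensor_ext[where t = t and P = "(M \<boxtimes> N) \<boxtimes> H", OF _ _ _ _ _ _ t])
      (simp_all add: TS_swap[where s = "rcoact L x" and t = "comult H h" for L x])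
  show "lcoact (M \<boxdot> N) (ract (M \<boxdot> N) t h)
       = TS H (M \<boxdot> N) (H \<boxtimes> (M \<boxdot> N)) (lcoact (M \<boxdot> N) t) (\<lambda>a x. pr H (M \<boxdot> N) a (ract (M \<boxdot> N) x h))"
    by (rule tensor_ext[where t = t and P = "H \<boxtimes> (M \<boxtimes> N)", OF _ _ _ _ _ _ t])
      (simp_all add: TS_swap[where s = "lcoact L x" and t = "comult H h" for L x])
  show "TS H H (H \<boxtimes> (M \<boxdot> N)) (comult H h) (\<lambda>h1 h2.
         TS H (M \<boxdot> N) (H \<boxtimes> (M \<boxdot> N)) (lcoact (M \<boxdot> N) (lact (M \<boxdot> N) h1 t)) (\<lambda>a x. pr H (M \<boxdot> N) (a \<otimes>\<^bsub>H\<^esub> h2) x))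
       = TS H H (H \<boxtimes> (M \<boxdot> N)) (comult H h) (\<lambda>h1 h2.
           TS H (M \<boxdot> N) (H \<boxtimes> (M \<boxdot> N)) (lcoact (M \<boxdot> N) t) (\<lambda>a x. pr H (M \<boxdot> N) (h1 \<otimes>\<^bsub>H\<^esub> a) (lact (M \<boxdot> N) h2 x)))"
    by (rule tensor_ext[where t = t and P = "H \<boxtimes> (M \<boxtimes> N)", OF _ _ _ _ _ _ t])
      (simp_all add: lcoact_lact_tensor)
  show "TS H H ((M \<boxdot> N) \<boxtimes> H) (comult H h) (\<lambda>h1 h2.
         TS (M \<boxdot> N) H ((M \<boxdot> N) \<boxtimes> H) (rcoact (M \<boxdot> N) (ract (M \<boxdot> N) t h2)) (\<lambda>x b. pr (M \<boxdot> N) H x (h1 \<otimes>\<^bsub>H\<^esub> b)))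
       = TS H H ((M \<boxdot> N) \<boxtimes> H) (comult H h) (\<lambda>h1 h2.
           TS (M \<boxdot> N) H ((M \<boxdot> N) \<boxtimes> H) (rcoact (M \<boxdot> N) t) (\<lambda>x b. pr (M \<boxdot> N) H (ract (M \<boxdot> N) x h1) (b \<otimes>\<^bsub>H\<^esub> h2)))"
    by (rule tensor_ext[where t = t and P = "(M \<boxtimes> N) \<boxtimes> H", OF _ _ _ _ _ _ t])
      (simp_all add: rcoact_ract_tensor)
qed

section \<open>The unit object\<close>

lemma ground_ext:
  assumes P: "module K P" and f: "lin K (ground K) P f" and g: "lin K (ground K) P g"
    and eq: "f \<one>\<^bsub>K\<^esub> = g \<one>\<^bsub>K\<^esub>" and x: "x \<in> carrier K"
  shows "f x = g x"
proof -
  interpret cring K by (rule cring_K)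
  have "h x = x \<odot>\<^bsub>P\<^esub> h \<one>\<^bsub>K\<^esub>" if "lin K (ground K) P h" for h
    using lin_smult[OF that, of x "\<one>\<^bsub>K\<^esub>"] x by (simp add: carrier_ground del: carrier_K_iff)
  from this[OF f] this[OF g] show ?thesis using eq by simp
qed

lemma scalar_simps:
  "\<one>\<^bsub>K\<^esub> \<in> carrier (ground K)"
  "a \<in> carrier K \<Longrightarrow> b \<in> carrier K \<Longrightarrow> a \<otimes>\<^bsub>K\<^esub> b \<in> carrier (ground K)"
  "a \<in> carrier K \<Longrightarrow> \<one>\<^bsub>K\<^esub> \<otimes>\<^bsub>K\<^esub> a = a" "a \<in> carrier K \<Longrightarrow> a \<otimes>\<^bsub>K\<^esub> \<one>\<^bsub>K\<^esub> = a"
  "module K P \<Longrightarrow> p \<in> carrier P \<Longrightarrow> \<one>\<^bsub>K\<^esub> \<odot>\<^bsub>P\<^esub> p = p"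
  "a \<in> carrier K \<Longrightarrow> b \<in> carrier K \<Longrightarrow> c \<in> carrier K \<Longrightarrow> (a \<otimes>\<^bsub>K\<^esub> b) \<otimes>\<^bsub>K\<^esub> c = a \<otimes>\<^bsub>K\<^esub> (b \<otimes>\<^bsub>K\<^esub> c)"
proof -
  interpret cring K by (rule cring_K)
  show "\<one>\<^bsub>K\<^esub> \<in> carrier (ground K)"
    "a \<in> carrier K \<Longrightarrow> b \<in> carrier K \<Longrightarrow> a \<otimes>\<^bsub>K\<^esub> b \<in> carrier (ground K)"
    "a \<in> carrier K \<Longrightarrow> \<one>\<^bsub>K\<^esub> \<otimes>\<^bsub>K\<^esub> a = a" "a \<in> carrier K \<Longrightarrow> a \<otimes>\<^bsub>K\<^esub> \<one>\<^bsub>K\<^esub> = a"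
    "a \<in> carrier K \<Longrightarrow> b \<in> carrier K \<Longrightarrow> c \<in> carrier K \<Longrightarrow> (a \<otimes>\<^bsub>K\<^esub> b) \<otimes>\<^bsub>K\<^esub> c = a \<otimes>\<^bsub>K\<^esub> (b \<otimes>\<^bsub>K\<^esub> c)"
    by (simp_all add: carrier_ground m_assoc del: carrier_K_iff)
qed (rule module.smult_one)

declare scalar_simps [simp]

lemma pure_ground:
  assumes "module K M" "m \<in> carrier M" "a \<in> carrier K" "b \<in> carrier K"
  shows "pr M (ground K) m (a \<otimes>\<^bsub>K\<^esub> b) = a \<odot>\<^bsub>M \<boxtimes> ground K\<^esub> pr M (ground K) m b"
    "pr (ground K) M (a \<otimes>\<^bsub>K\<^esub> b) m = a \<odot>\<^bsub>ground K \<boxtimes> M\<^esub> pr (ground K) M b m"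
  using pure_smult1[of "ground K" M b m a] pure_smult2[of M "ground K" m b a] assms by simp_all

text \<open>Restricted to scalars of the form \<open>counit H h\<close>: as a rewrite rule for
  arbitrary scalars it would apply to its own result at the scalar one.\<close>

lemma pure_counit:
  assumes "module K M" "m \<in> carrier M" "h \<in> carrier H"
  shows "pr M (ground K) m (counit H h) = counit H h \<odot>\<^bsub>M \<boxtimes> ground K\<^esub> pr M (ground K) m \<one>\<^bsub>K\<^esub>"
    "pr (ground K) M (counit H h) m = counit H h \<odot>\<^bsub>ground K \<boxtimes> M\<^esub> pr (ground K) M \<one>\<^bsub>K\<^esub> m"
  using pure_ground[of M m "counit H h" "\<one>\<^bsub>K\<^esub>"] assms by simp_all

abbreviation U where "U \<equiv> lr_unit K H"

lemma lr_unit_ops [simp]: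
  "lact U h x = counit H h \<otimes>\<^bsub>K\<^esub> x" "ract U x h = x \<otimes>\<^bsub>K\<^esub> counit H h"
  "lcoact U x = pr H (ground K) \<one>\<^bsub>H\<^esub> x" "rcoact U x = pr (ground K) H x \<one>\<^bsub>H\<^esub>"
  by (simp_all add: lr_unit_def module.extend_def lr_module.fields_def)

lemma lr_unit_preobj [simp]: "preobj U"
  unfolding preobj_def bilin_def by (simp add: lin_eqI[OF _ _ lr_unit_ops(1)] lin_eqI[OF _ _ lr_unit_ops(2)]
   lin_eqI[OF _ _ lr_unit_ops(3)] lin_eqI[OF _ _ lr_unit_ops(4)])

lemma lr_unit_obj [simp]: "obj U"
proof (rule lr_objectI)
  note [simp] = sweedler_simps pure_ground pure_counit comult_counit
  show "preobj U" by simp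
  fix x assume "x \<in> carrier U"
  then have x [simp]: "x \<in> carrier (ground K)" by simp
  show "lact U \<one>\<^bsub>H\<^esub> x = x" "ract U x \<one>\<^bsub>H\<^esub> = x" by simp_all
  show "TS H U U (lcoact U x) (\<lambda>a x. counit H a \<odot>\<^bsub>U\<^esub> x) = x" by simp
  show "TS U H U (rcoact U x) (\<lambda>x b. counit H b \<odot>\<^bsub>U\<^esub> x) = x" by simp
  show "TS H U (H \<boxtimes> H \<boxtimes> U) (lcoact U x) (\<lambda>a x.
         TS H H (H \<boxtimes> H \<boxtimes> U) (comult H a) (\<lambda>a1 a2. pr H (H \<boxtimes> U) a1 (pr H U a2 x)))
       = TS H U (H \<boxtimes> H \<boxtimes> U) (lcoact U x) (\<lambda>a x. pr H (H \<boxtimes> U) a (lcoact U x))" by simp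
  show "TS U H (U \<boxtimes> H \<boxtimes> H) (rcoact U x) (\<lambda>x b.
         TS U H (U \<boxtimes> H \<boxtimes> H) (rcoact U x) (\<lambda>y a. pr U (H \<boxtimes> H) y (pr H H a b)))
       = TS U H (U \<boxtimes> H \<boxtimes> H) (rcoact U x) (\<lambda>x b. pr U (H \<boxtimes> H) x (comult H b))" by simp
  show "TS U H (H \<boxtimes> U \<boxtimes> H) (rcoact U x) (\<lambda>x b.
         TS H U (H \<boxtimes> U \<boxtimes> H) (lcoact U x) (\<lambda>a y. pr H (U \<boxtimes> H) a (pr U H y b)))
       = TS H U (H \<boxtimes> U \<boxtimes> H) (lcoact U x) (\<lambda>a x. pr H (U \<boxtimes> H) a (rcoact U x))" by simp
  fix h assume [simp]: "h \<in> carrier H"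
  show "rcoact U (lact U h x) = TS U H (U \<boxtimes> H) (rcoact U x) (\<lambda>x b. pr U H (lact U h x) b)" by simp
  show "lcoact U (ract U x h) = TS H U (H \<boxtimes> U) (lcoact U x) (\<lambda>a x. pr H U a (ract U x h))" by simp
  show "TS H H (H \<boxtimes> U) (comult H h) (\<lambda>h1 h2.
         TS H U (H \<boxtimes> U) (lcoact U (lact U h1 x)) (\<lambda>a x. pr H U (a \<otimes>\<^bsub>H\<^esub> h2) x))
       = TS H H (H \<boxtimes> U) (comult H h) (\<lambda>h1 h2.
           TS H U (H \<boxtimes> U) (lcoact U x) (\<lambda>a x. pr H U (h1 \<otimes>\<^bsub>H\<^esub> a) (lact U h2 x)))" by simp
  show "TS H H (U \<boxtimes> H) (comult H h) (\<lambda>h1 h2.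
         TS U H (U \<boxtimes> H) (rcoact U (ract U x h2)) (\<lambda>x b. pr U H x (h1 \<otimes>\<^bsub>H\<^esub> b)))
       = TS H H (U \<boxtimes> H) (comult H h) (\<lambda>h1 h2.
           TS U H (U \<boxtimes> H) (rcoact U x) (\<lambda>x b. pr U H (ract U x h1) (b \<otimes>\<^bsub>H\<^esub> h2)))"
    \<comment> \<open>Both sides are linear in \<open>x\<close>, so x = 1 suffices. There the counit
      axiom reduces each of them to 1 \<otimes> h.\<close>
    by (rule ground_ext[where x = x and P = "ground K \<boxtimes> H"]) simp_all
  fix g assume [simp]: "g \<in> carrier H"
  show "lact U (g \<otimes>\<^bsub>H\<^esub> h) x = lact U g (lact U h x)"
    "ract U x (g \<otimes>\<^bsub>H\<^esub> h) = ract U (ract U x g) h"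
    "ract U (lact U g x) h = lact U g (ract U x h)" by simp_all
qed

section \<open>Morphisms\<close>

abbreviation mor where "mor M N f \<equiv> lr_morphism K H M N f"

lemma lr_morphismI:
  assumes "lin K M N f" "preobj M"
    and "\<And>h m. h \<in> carrier H \<Longrightarrow> m \<in> carrier M \<Longrightarrow> f (lact M h m) = lact N h (f m)"
    and "\<And>h m. h \<in> carrier H \<Longrightarrow> m \<in> carrier M \<Longrightarrow> f (ract M m h) = ract N (f m) h"
    and "\<And>m. m \<in> carrier M \<Longrightarrow> lcoact N (f m) = LS M (H \<boxtimes> N) m (\<lambda>a x. pr H N a (f x))"
    and "\<And>m. m \<in> carrier M \<Longrightarrow> rcoact N (f m) = RS M (N \<boxtimes> H) m (\<lambda>x b. pr N H (f x) b)"
  shows "mor M N f"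
  using assms lin_closed[OF assms(1)] by (simp add: lr_morphism_def tsum_coact)

lemma mor_lin: "mor M N f \<Longrightarrow> lin K M N f"
  by (simp add: lr_morphism_def)

lemma mor_simps:
  assumes f: "mor M N f" and M: "preobj M"
  shows "same_module P N \<Longrightarrow> m \<in> carrier M \<Longrightarrow> f m \<in> carrier P"
    "same_module P N \<Longrightarrow> lin K X M g \<Longrightarrow> lin K X P (\<lambda>x. f (g x))"
    "h \<in> carrier H \<Longrightarrow> m \<in> carrier M \<Longrightarrow> f (lact M h m) = lact N h (f m)"
    "h \<in> carrier H \<Longrightarrow> m \<in> carrier M \<Longrightarrow> f (ract M m h) = ract N (f m) h"
    "m \<in> carrier M \<Longrightarrow> lcoact N (f m) = LS M (H \<boxtimes> N) m (\<lambda>a x. pr H N a (f x))"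
    "m \<in> carrier M \<Longrightarrow> rcoact N (f m) = RS M (N \<boxtimes> H) m (\<lambda>x b. pr N H (f x) b)"
  using f M lin_closed[OF mor_lin[OF f]] lin_comp[OF mor_lin[OF f]]
  by (simp_all add: lr_morphism_def tsum_coact same_moduleD)

lemma mor_TS:
  assumes f: "mor M N f" and MN: "module K M" "module K N" and P: "same_module P M"
    and g: "\<And>a b. a \<in> carrier A \<Longrightarrow> b \<in> carrier B \<Longrightarrow> g a b \<in> carrier M"
  shows "f (TS A B P t (\<lambda>a b. g a b)) = TS A B N t (\<lambda>a b. f (g a b))"
  unfolding same_moduleD[OF P] by (rule lin_TS[OF MN mor_lin[OF f]]) (rule g)

text \<open>Arrows store maps restricted to the carrier; this transfers the morphism property to the
  restriction.\<close>

lemma mor_cong: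
  assumes eq: "\<And>m. m \<in> carrier M \<Longrightarrow> f m = g m" and M: "preobj M" and f: "mor M N f"
  shows "mor M N g"
proof -
  note [simp] = mor_simps[OF f M] eq[symmetric] M
  show ?thesis
    by (rule lr_morphismI) (simp_all add: lin_eqI[OF mor_lin[OF f]])
qed

lemma mor_id: "obj M \<Longrightarrow> mor M M (\<lambda>x. x)"
  by (rule lr_morphismI) (simp_all add: tensor_expand)

lemma mor_comp:
  assumes f: "mor M N f" and g: "mor N P g" and [simp]: "preobj M" "preobj N" "preobj P"
  shows "mor M P (\<lambda>x. g (f x))"
proof -
  note [simp] = mor_simps[OF f] mor_simps[OF g] mor_TS[OF f] mor_TS[OF g] sweedler_simps
  show ?thesis
    by (rule lr_morphismI) (simp_all add: lin_comp[OF mor_lin[OF g] mor_lin[OF f]])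
qed

text \<open>For the associator, the unitors and the braiding it thus suffices to give the inverse as
  a map and to check the two composites; linearity and colinearity are verified in one direction
  only.\<close>

lemma mor_inverse:
  assumes f: "mor M N f" and [simp]: "preobj M" "preobj N"
    and g: "\<And>y. y \<in> carrier N \<Longrightarrow> g y \<in> carrier M"
    and gf: "\<And>x. x \<in> carrier M \<Longrightarrow> g (f x) = x" and fg: "\<And>y. y \<in> carrier N \<Longrightarrow> f (g y) = y"
  shows "mor N M g"
proof -
  note [simp] = mor_simps[OF f] g gf fg
  have lin [simp]: "lin K N M g"
  proof (rule linI)
    fix x y assume [simp]: "x \<in> carrier N" "y \<in> carrier N"
    show "g x \<in> carrier M" by simp
    \<comment> \<open>The same term is evaluated twice: here by cancelling \<open>g\<close> after
      \<open>f\<close>, next by expanding \<open>f\<close> over the sum. \<open>gf\<close> is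
      removed from the second call, where it would make this fact trivial. Scalars and actions are
      treated alike.\<close>
    have "g (f (g x \<oplus>\<^bsub>M\<^esub> g y)) = g x \<oplus>\<^bsub>M\<^esub> g y" by simp
    then show "g (x \<oplus>\<^bsub>N\<^esub> y) = g x \<oplus>\<^bsub>M\<^esub> g y" by (simp add: lin_add[OF mor_lin[OF f]] del: gf)
    fix a assume a: "a \<in> carrier K"
    then have [simp]: "a \<in> carrier (ground K)" by simp
    have "g (f (a \<odot>\<^bsub>M\<^esub> g x)) = a \<odot>\<^bsub>M\<^esub> g x" by simp
    then show "g (a \<odot>\<^bsub>N\<^esub> x) = a \<odot>\<^bsub>M\<^esub> g x" by (simp add: lin_smult[OF mor_lin[OF f]] del: gf)
  qed
  have lin' [simp]: "lin K X M (\<lambda>x. g (k x))" if "lin K X N k" for X k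
    using lin_comp[OF lin that] .
  show ?thesis
  proof (rule lr_morphismI)
    fix y assume [simp]: "y \<in> carrier N"
    { fix h assume [simp]: "h \<in> carrier H"
      have "g (f (lact M h (g y))) = lact M h (g y)" "g (f (ract M (g y) h)) = ract M (g y) h"
        by (simp_all del: mor_simps(3,4)[OF f])
      then show "g (lact N h y) = lact M h (g y)" "g (ract N y h) = ract M (g y) h"
        by (simp_all del: gf) }
    \<comment> \<open>Colinearity of \<open>f\<close> at \<open>g y\<close>, followed by
      \<open>g\<close> on the second factor. It is unfolded by hand because \<open>fg\<close> would
      first reduce \<open>f (g y)\<close> to \<open>y\<close>.\<close>
    have "LS N (H \<boxtimes> M) (f (g y)) (\<lambda>a x. pr H M a (g x)) = lcoact M (g y)"
      unfolding mor_simps(5)[OF f \<open>preobj M\<close> g[OF \<open>y \<in> carrier N\<close>]]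
      by (simp add: sweedler_simps tensor_expand)
    then show "lcoact M (g y) = LS N (H \<boxtimes> M) y (\<lambda>a x. pr H M a (g x))" by simp
    have "RS N (M \<boxtimes> H) (f (g y)) (\<lambda>x b. pr M H (g x) b) = rcoact M (g y)"
      unfolding mor_simps(6)[OF f \<open>preobj M\<close> g[OF \<open>y \<in> carrier N\<close>]]
      by (simp add: sweedler_simps tensor_expand)
    then show "rcoact M (g y) = RS N (M \<boxtimes> H) y (\<lambda>x b. pr M H (g x) b)" by simp
  qed simp_all
qed

definition tmap :: "'u lr_module \<Rightarrow> 'u lr_module \<Rightarrow> 'u lr_module \<Rightarrow> 'u lr_module \<Rightarrow>
    ('u \<Rightarrow> 'u) \<Rightarrow> ('u \<Rightarrow> 'u) \<Rightarrow> 'u \<Rightarrow> 'u" where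
  "tmap M M' N N' f g t = TS M N (M' \<boxtimes> N') t (\<lambda>m n. pr M' N' (f m) (g n))"

lemma mor_tmap:
  assumes f: "mor M M' f" and g: "mor N N' g"
    and [simp]: "preobj M" "preobj N" "preobj M'" "preobj N'"
  shows "mor (M \<boxdot> N) (M' \<boxdot> N') (tmap M M' N N' f g)"
proof -
  note [simp] = mor_simps[OF f] mor_simps[OF g] mor_TS[OF f] mor_TS[OF g] sweedler_simps lr_tensor_pure
  show ?thesis
    unfolding tmap_def[abs_def]
  proof (rule lr_morphismI)
    fix t assume "t \<in> carrier (M \<boxdot> N)"
    then have t: "t \<in> carrier (M \<boxtimes> N)" by simp
    show "lcoact (M' \<boxdot> N') (TS M N (M' \<boxtimes> N') t (\<lambda>m n. pr M' N' (f m) (g n)))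
      = LS (M \<boxdot> N) (H \<boxtimes> (M' \<boxdot> N')) t (\<lambda>a t. pr H (M' \<boxdot> N') a (TS M N (M' \<boxtimes> N') t (\<lambda>m n. pr M' N' (f m) (g n))))"
      by (rule tensor_ext[where t = t and P = "H \<boxtimes> M' \<boxtimes> N'", OF _ _ _ _ _ _ t]) simp_all
    show "rcoact (M' \<boxdot> N') (TS M N (M' \<boxtimes> N') t (\<lambda>m n. pr M' N' (f m) (g n)))
      = RS (M \<boxdot> N) ((M' \<boxdot> N') \<boxtimes> H) t (\<lambda>t a. pr (M' \<boxdot> N') H (TS M N (M' \<boxtimes> N') t (\<lambda>m n. pr M' N' (f m) (g n))) a)"
      by (rule tensor_ext[where t = t and P = "(M' \<boxtimes> N') \<boxtimes> H", OF _ _ _ _ _ _ t]) simp_all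
    fix h assume [simp]: "h \<in> carrier H"
    show "TS M N (M' \<boxtimes> N') (lact (M \<boxdot> N) h t) (\<lambda>m n. pr M' N' (f m) (g n))
      = lact (M' \<boxdot> N') h (TS M N (M' \<boxtimes> N') t (\<lambda>m n. pr M' N' (f m) (g n)))"
      by (rule tensor_ext[where t = t and P = "M' \<boxtimes> N'", OF _ _ _ _ _ _ t]) simp_all
    show "TS M N (M' \<boxtimes> N') (ract (M \<boxdot> N) t h) (\<lambda>m n. pr M' N' (f m) (g n))
      = ract (M' \<boxdot> N') (TS M N (M' \<boxtimes> N') t (\<lambda>m n. pr M' N' (f m) (g n))) h"
      by (rule tensor_ext[where t = t and P = "M' \<boxtimes> N'", OF _ _ _ _ _ _ t]) simp_all
  qed simp_all
qed

end

text \<open>Identifies an exhibited inverse with the one chosen by description, so that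
  \<open>Assoc_inv\<close> in the second hexagon becomes an explicit regrouping of factors.\<close>

lemma (in category) inv_arrow_eq:
  assumes "A \<in> Ob C" "B \<in> Ob C" and g: "inverse_arrows C A B f g"
  shows "inv_arrow C A B f = g"
  unfolding inv_arrow_def
proof (rule the_equality)
  show "inverse_arrows C A B f g" by (rule g)
  fix g' assume g': "inverse_arrows C A B f g'"
  have "g' = g' \<bullet> (f \<bullet> g)"
    using g g' assms Comp_Id[of B A g'] by (simp add: inverse_arrows_def)
  also have "\<dots> = (g' \<bullet> f) \<bullet> g"
    using g g' assms Comp_assoc[of B A B A g f g'] by (simp add: inverse_arrows_def)
  also have "\<dots> = g"
    using g g' assms Id_Comp[of B A g] by (simp add: inverse_arrows_def)
  finally show "g' = g" .
qed

section \<open>Arrows, associators and unitors\<close>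

context bialgebra_lr
begin

abbreviation C where "C \<equiv> LR K H"

lemma arrow_eqI: "(\<And>x. x \<in> carrier M \<Longrightarrow> f x = g x) \<Longrightarrow> arrow M N f = arrow M N g"
  by (auto simp: arrow_def restrict_def)

lemma arrow_in_hom:
  assumes "mor M N f" "preobj M"
  shows "arrow M N f \<in> lr_hom K H M N"
proof -
  have "mor M N (restrict f (carrier M))"
    by (rule mor_cong[OF _ assms(2,1)]) simp
  then show ?thesis by (simp add: lr_hom_def arrow_def)
qed

text \<open>Extensionality makes every arrow an \<open>arrow M N f\<close>. Equations between arrows
  thereby become equations between maps, through \<open>comp_arrow\<close> and
  \<open>tensA_arrow\<close>.\<close>

lemma lr_homE:
  assumes "\<phi> \<in> lr_hom K H M N"
  obtains f where "mor M N f" "\<phi> = arrow M N f"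
proof
  show "mor M N (fn \<phi>)" using assms by (simp add: lr_hom_def)
  show "\<phi> = arrow M N (fn \<phi>)"
    using assms by (simp add: lr_hom_def arrow_def extensional_restrict)
qed

lemma LR_simps:
  "Ob C = {M. obj M}" "Hom C = lr_hom K H" "Id C M = arrow M M (\<lambda>m. m)"
  "TensO C M N = M \<boxdot> N" "Unit C = U"
  by (simp_all add: LR_def)

lemma comp_arrow:
  assumes "\<And>x. x \<in> carrier M \<Longrightarrow> f x \<in> carrier N'"
  shows "arrow N' P g \<bullet>\<^bsub>C\<^esub> arrow M N f = arrow M P (\<lambda>x. g (f x))"
proof -
  have "arrow N' P g \<bullet>\<^bsub>C\<^esub> arrow M N f
    = arrow M P (\<lambda>x. restrict g (carrier N') (restrict f (carrier M) x))"
    by (simp only: LR_def arrow_def o_def monoidal_category.simps category.simps lr_arrow.simps)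
  also have "\<dots> = arrow M P (\<lambda>x. g (f x))"
    by (rule arrow_eqI) (simp add: assms)
  finally show ?thesis .
qed

lemma tensA_arrow:
  assumes "\<And>x. x \<in> carrier M \<Longrightarrow> f x \<in> carrier M'" "\<And>x. x \<in> carrier N \<Longrightarrow> g x \<in> carrier N'"
    "module K M'" "module K N'"
  shows "arrow M M' f \<odot>\<^sub>a\<^bsub>C\<^esub> arrow N N' g = arrow (M \<boxdot> N) (M' \<boxdot> N')
    (\<lambda>t. TS M N (M' \<boxtimes> N') t (\<lambda>m n. pr M' N' (f m) (g n)))"
proof -
  have "arrow M M' f \<odot>\<^sub>a\<^bsub>C\<^esub> arrow N N' g = arrow (M \<boxdot> N) (M' \<boxdot> N')
    (\<lambda>t. tsum (M' \<boxtimes> N') t (\<lambda>m n. pr M' N' (restrict f (carrier M) m) (restrict g (carrier N) n)))"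
    by (simp add: LR_def arrow_def)
  also have "\<dots> = arrow (M \<boxdot> N) (M' \<boxdot> N')
    (\<lambda>t. TS M N (M' \<boxtimes> N') t (\<lambda>m n. pr M' N' (f m) (g n)))"
    by (rule arrow_eqI, simp, subst tsum_TS[where M = M and N = N]) (simp_all add: assms)
  finally show ?thesis .
qed

lemma assoc_arrow:
  assumes "module K L" "module K M" "module K N"
  shows "Assoc C L M N = arrow ((L \<boxdot> M) \<boxdot> N) (L \<boxdot> (M \<boxdot> N))
       (\<lambda>t. TS (L \<boxtimes> M) N (L \<boxtimes> M \<boxtimes> N) t (\<lambda>s n. TS L M (L \<boxtimes> M \<boxtimes> N) s (\<lambda>l m.
          pr L (M \<boxtimes> N) l (pr M N m n))))"
  unfolding LR_def monoidal_category.simps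
  by (rule arrow_eqI) (simp add: assms tsum_TS[where M = "L \<boxtimes> M" and N = N] tsum_TS[where M = L and N = M])

lemma unit_arrow:
  assumes "module K M"
  shows "Lunit C M = arrow (U \<boxdot> M) M (\<lambda>t. TS (ground K) M M t (\<lambda>a m. a \<odot>\<^bsub>M\<^esub> m))"
    "Runit C M = arrow (M \<boxdot> U) M (\<lambda>t. TS M (ground K) M t (\<lambda>m a. a \<odot>\<^bsub>M\<^esub> m))"
  unfolding LR_def monoidal_category.simps
  by (rule arrow_eqI, simp add: assms tsum_TS[where M = "ground K" and N = M] tsum_TS[where N = "ground K" and M = M])+

lemma inverse_arrowsI:
  assumes f: "mor M N f" and M: "preobj M" and N: "preobj N"
    and g: "\<And>y. y \<in> carrier N \<Longrightarrow> g y \<in> carrier M"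
    and gf: "\<And>x. x \<in> carrier M \<Longrightarrow> g (f x) = x" and fg: "\<And>y. y \<in> carrier N \<Longrightarrow> f (g y) = y"
  shows "inverse_arrows C M N (arrow M N f) (arrow N M g)"
proof -
  have "mor N M g" by (rule mor_inverse[OF f M N g gf fg])
  then show ?thesis
    unfolding inverse_arrows_def LR_simps
    using f M N g gf fg mor_simps(1)[OF f M same_module_refl]
    by (auto simp: comp_arrow intro!: arrow_in_hom arrow_eqI)
qed

lemma tensor_ext3:
  assumes m: "module K L" "module K M" "module K N" "module K P"
    and f: "lin K ((L \<boxtimes> M) \<boxtimes> N) P f" and g: "lin K ((L \<boxtimes> M) \<boxtimes> N) P g"
    and eq: "\<And>l m n. l \<in> carrier L \<Longrightarrow> m \<in> carrier M \<Longrightarrow> n \<in> carrier N \<Longrightarrow>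
      f (pr (L \<boxtimes> M) N (pr L M l m) n) = g (pr (L \<boxtimes> M) N (pr L M l m) n)"
    and t: "t \<in> carrier ((L \<boxtimes> M) \<boxtimes> N)"
  shows "f t = g t"
proof (rule tensor_ext[OF _ _ _ f g _ t])
  fix s n assume s: "s \<in> carrier (L \<boxtimes> M)" and n: "n \<in> carrier N"
  show "f (pr (L \<boxtimes> M) N s n) = g (pr (L \<boxtimes> M) N s n)"
    proof (rule tensor_ext[where P = P and t = s and f = "\<lambda>s. f (pr (L \<boxtimes> M) N s n)" and g = "\<lambda>s. g (pr (L \<boxtimes> M) N s n)"])
      show "lin K (L \<boxtimes> M) P (\<lambda>s. f (pr (L \<boxtimes> M) N s n))" by (rule lin_comp[OF f]) (use m n in simp)
      show "lin K (L \<boxtimes> M) P (\<lambda>s. g (pr (L \<boxtimes> M) N s n))" by (rule lin_comp[OF g]) (use m n in simp)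
    qed (use m n s eq in simp_all)
qed (use m in simp_all)

lemma tensor_ext3':
  assumes m: "module K L" "module K M" "module K N" "module K P"
    and f: "lin K (L \<boxtimes> (M \<boxtimes> N)) P f" and g: "lin K (L \<boxtimes> (M \<boxtimes> N)) P g"
    and eq: "\<And>l m n. l \<in> carrier L \<Longrightarrow> m \<in> carrier M \<Longrightarrow> n \<in> carrier N \<Longrightarrow>
      f (pr L (M \<boxtimes> N) l (pr M N m n)) = g (pr L (M \<boxtimes> N) l (pr M N m n))"
    and t: "t \<in> carrier (L \<boxtimes> (M \<boxtimes> N))"
  shows "f t = g t"
proof (rule tensor_ext[OF _ _ _ f g _ t])
  fix l s assume l: "l \<in> carrier L" and s: "s \<in> carrier (M \<boxtimes> N)"
  show "f (pr L (M \<boxtimes> N) l s) = g (pr L (M \<boxtimes> N) l s)"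
    proof (rule tensor_ext[where P = P and t = s and f = "\<lambda>s. f (pr L (M \<boxtimes> N) l s)" and g = "\<lambda>s. g (pr L (M \<boxtimes> N) l s)"])
      show "lin K (M \<boxtimes> N) P (\<lambda>s. f (pr L (M \<boxtimes> N) l s))" by (rule lin_comp[OF f]) (use m l in simp)
      show "lin K (M \<boxtimes> N) P (\<lambda>s. g (pr L (M \<boxtimes> N) l s))" by (rule lin_comp[OF g]) (use m l in simp)
    qed (use m l s eq in simp_all)
qed (use m in simp_all)

text \<open>The associator respects the actions by coassociativity of \<open>comult\<close>, and the
  coactions by associativity of the product of \<open>H\<close>.\<close>

lemma assoc_inverse:
  assumes [simp]: "obj L" "obj M" "obj N"
  shows "inverse_arrows C ((L \<boxdot> M) \<boxdot> N) (L \<boxdot> (M \<boxdot> N)) (Assoc C L M N)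
    (arrow (L \<boxdot> (M \<boxdot> N)) ((L \<boxdot> M) \<boxdot> N)
       (\<lambda>t. TS L (M \<boxtimes> N) ((L \<boxtimes> M) \<boxtimes> N) t (\<lambda>l s. TS M N ((L \<boxtimes> M) \<boxtimes> N) s (\<lambda>m n.
          pr (L \<boxtimes> M) N (pr L M l m) n))))"
proof -
  note [simp] = sweedler_simps lr_tensor_pure
  let ?P = "L \<boxtimes> M \<boxtimes> N"
  define f where "f = (\<lambda>t. TS (L \<boxtimes> M) N ?P t (\<lambda>s n. TS L M ?P s (\<lambda>l m.
          pr L (M \<boxtimes> N) l (pr M N m n))))"
  have f: "mor ((L \<boxdot> M) \<boxdot> N) (L \<boxdot> (M \<boxdot> N)) f"
  proof (rule lr_morphismI)
    fix t assume "t \<in> carrier ((L \<boxdot> M) \<boxdot> N)"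
    then have t: "t \<in> carrier ((L \<boxtimes> M) \<boxtimes> N)" by simp
    note ext = tensor_ext3[where t = t, OF _ _ _ _ _ _ _ t]
    show "lcoact (L \<boxdot> (M \<boxdot> N)) (f t)
      = LS ((L \<boxdot> M) \<boxdot> N) (H \<boxtimes> (L \<boxdot> (M \<boxdot> N))) t (\<lambda>a x. pr H (L \<boxdot> (M \<boxdot> N)) a (f x))"
      unfolding f_def by (rule ext[where P = "H \<boxtimes> ?P"]) simp_all
    show "rcoact (L \<boxdot> (M \<boxdot> N)) (f t)
      = RS ((L \<boxdot> M) \<boxdot> N) ((L \<boxdot> (M \<boxdot> N)) \<boxtimes> H) t (\<lambda>x a. pr (L \<boxdot> (M \<boxdot> N)) H (f x) a)"
      unfolding f_def by (rule ext[where P = "?P \<boxtimes> H"]) simp_all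
    fix h assume [simp]: "h \<in> carrier H"
    show "f (lact ((L \<boxdot> M) \<boxdot> N) h t) = lact (L \<boxdot> (M \<boxdot> N)) h (f t)"
      unfolding f_def by (rule ext[where P = ?P]) (simp_all add: comult_coassoc)
    show "f (ract ((L \<boxdot> M) \<boxdot> N) t h) = ract (L \<boxdot> (M \<boxdot> N)) (f t) h"
      unfolding f_def by (rule ext[where P = ?P]) (simp_all add: comult_coassoc)
  qed (simp_all add: f_def)
  show ?thesis
    unfolding assoc_arrow[OF obj_module obj_module obj_module, OF obj_preobj obj_preobj obj_preobj, OF assms]
      f_def[symmetric]
  proof (rule inverse_arrowsI[OF f])
    fix t assume "t \<in> carrier ((L \<boxdot> M) \<boxdot> N)"
    then have t: "t \<in> carrier ((L \<boxtimes> M) \<boxtimes> N)" by simp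
    show "TS L (M \<boxtimes> N) ((L \<boxtimes> M) \<boxtimes> N) (f t) (\<lambda>l s. TS M N ((L \<boxtimes> M) \<boxtimes> N) s (\<lambda>m n.
          pr (L \<boxtimes> M) N (pr L M l m) n)) = t"
      unfolding f_def by (rule tensor_ext3[where t = t and P = "(L \<boxtimes> M) \<boxtimes> N", OF _ _ _ _ _ _ _ t]) simp_all
  next
    fix t assume "t \<in> carrier (L \<boxdot> (M \<boxdot> N))"
    then have t: "t \<in> carrier ?P" by simp
    show "f (TS L (M \<boxtimes> N) ((L \<boxtimes> M) \<boxtimes> N) t (\<lambda>l s. TS M N ((L \<boxtimes> M) \<boxtimes> N) s (\<lambda>m n.
          pr (L \<boxtimes> M) N (pr L M l m) n))) = t"
      unfolding f_def by (rule tensor_ext3'[where t = t and P = "?P", OF _ _ _ _ _ _ _ t]) simp_all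
  qed simp_all
qed

text \<open>Folds a scalar back into the ground factor. This closes the round trip through the unit,
  which ends with the scalar in front of a pure tensor.\<close>

lemma pure_one:
  assumes "module K M" "m \<in> carrier M" "b \<in> carrier (ground K)"
  shows "b \<odot>\<^bsub>M \<boxtimes> ground K\<^esub> pr M (ground K) m \<one>\<^bsub>K\<^esub> = pr M (ground K) m b"
    "b \<odot>\<^bsub>ground K \<boxtimes> M\<^esub> pr (ground K) M \<one>\<^bsub>K\<^esub> m = pr (ground K) M b m"
  using pure_ground[of M m b "\<one>\<^bsub>K\<^esub>"] assms by simp_all

lemma coact_smult:
  assumes "preobj M" "same_module P M" "m \<in> carrier M" "a \<in> carrier (ground K)"
  shows "lcoact M (a \<odot>\<^bsub>P\<^esub> m) = a \<odot>\<^bsub>H \<boxtimes> M\<^esub> lcoact M m" "rcoact M (a \<odot>\<^bsub>P\<^esub> m) = a \<odot>\<^bsub>M \<boxtimes> H\<^esub> rcoact M m"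
  unfolding same_moduleD[OF assms(2)]
  by (rule lin_smult[where f = "lcoact M"] lin_smult[where f = "rcoact M"];
      simp add: assms obj_lin_lcoact obj_lin_rcoact)+

text \<open>The unitors respect the actions by the counit axiom of \<open>H\<close>, and the
  coactions because \<open>H\<close> coacts on the unit by its one.\<close>

lemma unit_inverse:
  assumes M [simp]: "obj M"
  shows "inverse_arrows C (U \<boxdot> M) M (Lunit C M) (arrow M (U \<boxdot> M) (\<lambda>m. pr (ground K) M \<one>\<^bsub>K\<^esub> m))"
    "inverse_arrows C (M \<boxdot> U) M (Runit C M) (arrow M (M \<boxdot> U) (\<lambda>m. pr M (ground K) m \<one>\<^bsub>K\<^esub>))"
proof -
  note [simp] = sweedler_simps lr_tensor_pure smult_assoc comult_counit coact_smult tensor_expand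
  have f: "mor (U \<boxdot> M) M (\<lambda>t. TS (ground K) M M t (\<lambda>a m. a \<odot>\<^bsub>M\<^esub> m))" (is "mor _ _ ?f")
  proof (rule lr_morphismI)
    fix t assume "t \<in> carrier (U \<boxdot> M)"
    then have t: "t \<in> carrier (ground K \<boxtimes> M)" by simp
    note ext = tensor_ext[where t = t, OF _ _ _ _ _ _ t]
    show "lcoact M (?f t) = LS (U \<boxdot> M) (H \<boxtimes> M) t (\<lambda>a x. pr H M a (?f x))"
      by (rule ext[where P = "H \<boxtimes> M"]) simp_all
    show "rcoact M (?f t) = RS (U \<boxdot> M) (M \<boxtimes> H) t (\<lambda>x a. pr M H (?f x) a)"
      by (rule ext[where P = "M \<boxtimes> H"]) simp_all
    fix h assume [simp]: "h \<in> carrier H"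
    show "?f (lact (U \<boxdot> M) h t) = lact M h (?f t)"
      by (rule ext[where P = M]) simp_all
    show "?f (ract (U \<boxdot> M) t h) = ract M (?f t) h"
      by (rule ext[where P = M]) simp_all
  qed simp_all
  have g: "mor (M \<boxdot> U) M (\<lambda>t. TS M (ground K) M t (\<lambda>m a. a \<odot>\<^bsub>M\<^esub> m))" (is "mor _ _ ?g")
  proof (rule lr_morphismI)
    fix t assume "t \<in> carrier (M \<boxdot> U)"
    then have t: "t \<in> carrier (M \<boxtimes> ground K)" by simp
    note ext = tensor_ext[where t = t, OF _ _ _ _ _ _ t]
    show "lcoact M (?g t) = LS (M \<boxdot> U) (H \<boxtimes> M) t (\<lambda>a x. pr H M a (?g x))"
      by (rule ext[where P = "H \<boxtimes> M"]) simp_all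
    show "rcoact M (?g t) = RS (M \<boxdot> U) (M \<boxtimes> H) t (\<lambda>x a. pr M H (?g x) a)"
      by (rule ext[where P = "M \<boxtimes> H"]) simp_all
    fix h assume [simp]: "h \<in> carrier H"
    show "?g (lact (M \<boxdot> U) h t) = lact M h (?g t)"
      by (rule ext[where P = M]) simp_all
    show "?g (ract (M \<boxdot> U) t h) = ract M (?g t) h"
      by (rule ext[where P = M]) simp_all
  qed simp_all
  note u = unit_arrow[OF obj_module, OF obj_preobj, OF M]
  show "inverse_arrows C (U \<boxdot> M) M (Lunit C M) (arrow M (U \<boxdot> M) (\<lambda>m. pr (ground K) M \<one>\<^bsub>K\<^esub> m))"
    unfolding u
  proof (rule inverse_arrowsI[OF f])
    fix t assume "t \<in> carrier (U \<boxdot> M)"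
    then have t: "t \<in> carrier (ground K \<boxtimes> M)" by simp
    show "pr (ground K) M \<one>\<^bsub>K\<^esub> (?f t) = t"
      by (rule tensor_ext[where t = t and P = "ground K \<boxtimes> M", OF _ _ _ _ _ _ t]) (simp_all add: pure_one)
  qed simp_all
  show "inverse_arrows C (M \<boxdot> U) M (Runit C M) (arrow M (M \<boxdot> U) (\<lambda>m. pr M (ground K) m \<one>\<^bsub>K\<^esub>))"
    unfolding u
  proof (rule inverse_arrowsI[OF g])
    fix t assume "t \<in> carrier (M \<boxdot> U)"
    then have t: "t \<in> carrier (M \<boxtimes> ground K)" by simp
    show "pr M (ground K) (?g t) \<one>\<^bsub>K\<^esub> = t"
      by (rule tensor_ext[where t = t and P = "M \<boxtimes> ground K", OF _ _ _ _ _ _ t]) (simp_all add: pure_one)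
  qed simp_all
qed

section \<open>The monoidal category\<close>

lemma LR_category: "category C"
proof (rule category.intro; unfold LR_simps mem_Collect_eq)
  fix A assume A: "obj A"
  then show "arrow A A (\<lambda>m. m) \<in> lr_hom K H A A"
    by (simp add: arrow_in_hom mor_id)
next
  fix A B D f g assume o [simp]: "obj A" "obj B" "obj D"
    and "f \<in> lr_hom K H A B" "g \<in> lr_hom K H B D"
  then obtain f' g' where f: "mor A B f'" "f = arrow A B f'" and g: "mor B D g'" "g = arrow B D g'"
    by (elim lr_homE)
  show "g \<bullet>\<^bsub>C\<^esub> f \<in> lr_hom K H A D"
    using mor_comp[OF f(1) g(1)] by (simp add: f g comp_arrow arrow_in_hom mor_simps[OF f(1)])
next
  fix A B f assume o [simp]: "obj A" "obj B" and "f \<in> lr_hom K H A B"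
  then obtain f' where f: "mor A B f'" "f = arrow A B f'" by (elim lr_homE)
  show "f \<bullet>\<^bsub>C\<^esub> arrow A A (\<lambda>m. m) = f" "arrow B B (\<lambda>m. m) \<bullet>\<^bsub>C\<^esub> f = f"
    by (simp_all add: f comp_arrow mor_simps[OF f(1)])
next
  fix A B D E f g h assume o [simp]: "obj A" "obj B" "obj D" "obj E"
    and "f \<in> lr_hom K H A B" "g \<in> lr_hom K H B D" "h \<in> lr_hom K H D E"
  then obtain f' g' h' where f: "mor A B f'" "f = arrow A B f'" and g: "mor B D g'" "g = arrow B D g'"
    and h: "mor D E h'" "h = arrow D E h'"
    by (elim lr_homE)
  show "(h \<bullet>\<^bsub>C\<^esub> g) \<bullet>\<^bsub>C\<^esub> f = h \<bullet>\<^bsub>C\<^esub> (g \<bullet>\<^bsub>C\<^esub> f)"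
    by (simp add: f g h comp_arrow mor_simps[OF f(1)] mor_simps[OF g(1)])
next
  fix A B A' B' f assume "f \<in> lr_hom K H A B" "f \<in> lr_hom K H A' B'"
  then show "A = A' \<and> B = B'" by (auto simp: lr_hom_def)
qed

lemma iso_arrowI: "inverse_arrows C A B f g \<Longrightarrow> iso_arrow C A B f"
  by (auto simp: iso_arrow_def)

lemma tens_arrow_hom:
  assumes "mor M M' f" "mor N N' g" "preobj M" "preobj N" "preobj M'" "preobj N'"
  shows "arrow M M' f \<odot>\<^sub>a\<^bsub>C\<^esub> arrow N N' g \<in> lr_hom K H (M \<boxdot> N) (M' \<boxdot> N')"
proof -
  have "arrow M M' f \<odot>\<^sub>a\<^bsub>C\<^esub> arrow N N' g = arrow (M \<boxdot> N) (M' \<boxdot> N') (tmap M M' N N' f g)"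
    using assms by (simp add: tensA_arrow tmap_def[abs_def] mor_simps[OF assms(1)] mor_simps[OF assms(2)])
  then show ?thesis using mor_tmap[OF assms] assms by (simp add: arrow_in_hom)
qed

text \<open>\<open>TS\<close> and its rules ask nothing of the outermost tensor, so in the
  naturality squares, the pentagon and the triangle both composites normalize to the same function
  of an arbitrary argument. The law for identities does need the argument in the carrier, because it
  rests on \<open>tensor_expand\<close>.\<close>

lemma LR_monoidal: "monoidal_category C"
proof (rule monoidal_category.intro[OF LR_category], rule monoidal_category_axioms.intro;
    unfold LR_simps mem_Collect_eq)
  note [simp] = sweedler_simps comp_arrow tensA_arrow assoc_arrow unit_arrow tensor_expand
  show "obj U" by simp
  show "obj (M \<boxdot> N)" if "obj M" "obj N" for M N using that by simp
  show "iso_arrow C ((L \<boxdot> M) \<boxdot> N) (L \<boxdot> M \<boxdot> N) (Assoc C L M N)" if "obj L" "obj M" "obj N" for L M N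
    using assoc_inverse[OF that] by (rule iso_arrowI)
  show "iso_arrow C (U \<boxdot> M) M (Lunit C M)" "iso_arrow C (M \<boxdot> U) M (Runit C M)" if "obj M" for M
    using unit_inverse[OF that] by (auto intro: iso_arrowI simp del: unit_arrow)
  show "arrow M M (\<lambda>m. m) \<odot>\<^sub>a\<^bsub>C\<^esub> arrow N N (\<lambda>m. m) = arrow (M \<boxdot> N) (M \<boxdot> N) (\<lambda>m. m)"
    if [simp]: "obj M" "obj N" for M N
    by simp (rule arrow_eqI, simp)
  { fix M M' N N' f g assume [simp]: "obj M" "obj M'" "obj N" "obj N'"
      and "f \<in> lr_hom K H M M'" "g \<in> lr_hom K H N N'"
    then obtain f' g' where f: "mor M M' f'" "f = arrow M M' f'" and g: "mor N N' g'" "g = arrow N N' g'"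
      by (elim lr_homE)
    show "f \<odot>\<^sub>a\<^bsub>C\<^esub> g \<in> lr_hom K H (M \<boxdot> N) (M' \<boxdot> N')"
      unfolding f(2) g(2) by (rule tens_arrow_hom[OF f(1) g(1)]) simp_all }
  { fix M M' M'' N N' N'' f1 f2 g1 g2 assume [simp]: "obj M" "obj M'" "obj M''" "obj N" "obj N'" "obj N''"
      and "f1 \<in> lr_hom K H M M'" "f2 \<in> lr_hom K H M' M''" "g1 \<in> lr_hom K H N N'" "g2 \<in> lr_hom K H N' N''"
    then obtain f1' g1' f2' g2' where f: "mor M M' f1'" "f1 = arrow M M' f1'" "mor M' M'' f2'" "f2 = arrow M' M'' f2'"
      and g: "mor N N' g1'" "g1 = arrow N N' g1'" "mor N' N'' g2'" "g2 = arrow N' N'' g2'"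
      by (elim lr_homE)
    note [simp] = mor_simps[OF f(1)] mor_simps[OF f(3)] mor_simps[OF g(1)] mor_simps[OF g(3)]
      mor_TS[OF f(1)] mor_TS[OF f(3)] mor_TS[OF g(1)] mor_TS[OF g(3)]
    show "(f2 \<bullet>\<^bsub>C\<^esub> f1) \<odot>\<^sub>a\<^bsub>C\<^esub> (g2 \<bullet>\<^bsub>C\<^esub> g1) = (f2 \<odot>\<^sub>a\<^bsub>C\<^esub> g2) \<bullet>\<^bsub>C\<^esub> (f1 \<odot>\<^sub>a\<^bsub>C\<^esub> g1)"
      unfolding f g by simp }
  { fix L M N L' M' N' f g h assume [simp]: "obj L" "obj M" "obj N" "obj L'" "obj M'" "obj N'"
      and "f \<in> lr_hom K H L L'" "g \<in> lr_hom K H M M'" "h \<in> lr_hom K H N N'"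
    then obtain f' g' h' where f: "mor L L' f'" "f = arrow L L' f'" and g: "mor M M' g'" "g = arrow M M' g'"
      and h: "mor N N' h'" "h = arrow N N' h'"
      by (elim lr_homE)
    note [simp] = mor_simps[OF f(1)] mor_simps[OF g(1)] mor_simps[OF h(1)]
      mor_TS[OF f(1)] mor_TS[OF g(1)] mor_TS[OF h(1)]
    show "Assoc C L' M' N' \<bullet>\<^bsub>C\<^esub> ((f \<odot>\<^sub>a\<^bsub>C\<^esub> g) \<odot>\<^sub>a\<^bsub>C\<^esub> h) = (f \<odot>\<^sub>a\<^bsub>C\<^esub> (g \<odot>\<^sub>a\<^bsub>C\<^esub> h)) \<bullet>\<^bsub>C\<^esub> Assoc C L M N"
      unfolding f g h by simp }
  { fix M M' f assume [simp]: "obj M" "obj M'" and "f \<in> lr_hom K H M M'"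
    then obtain f' where f: "mor M M' f'" "f = arrow M M' f'" by (elim lr_homE)
    note [simp] = mor_simps[OF f(1)] mor_TS[OF f(1)] lin_smult[OF mor_lin[OF f(1)]]
      tensA_arrow[where M = U and M' = U and f = "\<lambda>m. m", simplified]
      tensA_arrow[where N = U and N' = U and g = "\<lambda>m. m", simplified]
    show "Lunit C M' \<bullet>\<^bsub>C\<^esub> (arrow U U (\<lambda>m. m) \<odot>\<^sub>a\<^bsub>C\<^esub> f) = f \<bullet>\<^bsub>C\<^esub> Lunit C M"
      "Runit C M' \<bullet>\<^bsub>C\<^esub> (f \<odot>\<^sub>a\<^bsub>C\<^esub> arrow U U (\<lambda>m. m)) = f \<bullet>\<^bsub>C\<^esub> Runit C M"
      unfolding f by simp_all }
  { fix L M N Q assume [simp]: "obj L" "obj M" "obj N" "obj Q"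
    show "(arrow L L (\<lambda>m. m) \<odot>\<^sub>a\<^bsub>C\<^esub> Assoc C M N Q) \<bullet>\<^bsub>C\<^esub> Assoc C L (M \<boxdot> N) Q \<bullet>\<^bsub>C\<^esub> (Assoc C L M N \<odot>\<^sub>a\<^bsub>C\<^esub> arrow Q Q (\<lambda>m. m))
        = Assoc C L M (N \<boxdot> Q) \<bullet>\<^bsub>C\<^esub> Assoc C (L \<boxdot> M) N Q"
      by simp }
  { fix M N assume [simp]: "obj M" "obj N"
    show "(arrow M M (\<lambda>m. m) \<odot>\<^sub>a\<^bsub>C\<^esub> Lunit C N) \<bullet>\<^bsub>C\<^esub> Assoc C M U N = Runit C M \<odot>\<^sub>a\<^bsub>C\<^esub> arrow N N (\<lambda>m. m)"
      by simp }
qed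

section \<open>The braiding\<close>

definition braid :: "'u lr_module \<Rightarrow> 'u lr_module \<Rightarrow> 'u \<Rightarrow> 'u" where
  "braid M N t = TS M N (N \<boxtimes> M) t (\<lambda>m n. LS M (N \<boxtimes> M) m (\<lambda>a x. RS N (N \<boxtimes> M) n (\<lambda>y b.
     pr N M (lact N a y) (ract M x b))))"

lemma lr_braid_pure_eq:
  assumes "obj M" "obj N" "m \<in> carrier M" "n \<in> carrier N"
  shows "lr_braid_pure K M N m n = LS M (N \<boxtimes> M) m (\<lambda>a x. RS N (N \<boxtimes> M) n (\<lambda>y b.
     pr N M (lact N a y) (ract M x b)))"
  using assms by (simp add: lr_braid_pure_def tsum_coact)

lemma lr_braid_arrow:
  assumes "obj M" "obj N"
  shows "lr_braid K H M N = arrow (M \<boxdot> N) (N \<boxdot> M) (braid M N)"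
  unfolding lr_braid_def braid_def[abs_def]
  by (rule arrow_eqI) (simp add: assms tsum_TS[where M = M and N = N] lr_braid_pure_eq)

lemma mor_braid:
  assumes [simp]: "obj M" "obj N"
  shows "mor (M \<boxdot> N) (N \<boxdot> M) (braid M N)"
proof (rule lr_morphismI)
  note [simp] = sweedler_simps lr_tensor_pure
  fix t assume "t \<in> carrier (M \<boxdot> N)"
  then have t: "t \<in> carrier (M \<boxtimes> N)" by simp
  note ext = tensor_ext[where t = t, OF _ _ _ _ _ _ t]
  show "lcoact (N \<boxdot> M) (braid M N t)
    = LS (M \<boxdot> N) (H \<boxtimes> (N \<boxdot> M)) t (\<lambda>a x. pr H (N \<boxdot> M) a (braid M N x))"
  proof -
    \<comment> \<open>By the Long condition the left coaction of m^(0) \<cdot> n^<1> is that of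
      m^(0). With h = m^(-1), coassociativity makes its component h_2, while h_1 acts on n^<0>: this
      is one side of the Yetter-Drinfeld condition for N at h. The bicomodule axiom of N then
      exchanges its two coactions.\<close>
    have Y: "DS (H \<boxtimes> N \<boxtimes> M) x (\<lambda>h1 h2. LS N (H \<boxtimes> N \<boxtimes> M) (lact N h1 y) (\<lambda>a u.
        pr H (N \<boxtimes> M) (a \<otimes>\<^bsub>H\<^esub> h2) (pr N M u (ract M c d))))
      = DS (H \<boxtimes> N \<boxtimes> M) x (\<lambda>h1 h2. LS N (H \<boxtimes> N \<boxtimes> M) y (\<lambda>a u.
        pr H (N \<boxtimes> M) (h1 \<otimes>\<^bsub>H\<^esub> a) (pr N M (lact N h2 u) (ract M c d))))"
      if "x \<in> carrier H" "y \<in> carrier N" "c \<in> carrier M" "d \<in> carrier H" for x y c d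
      using lcoact_lact[where M = N and m = y and h = x and P = "H \<boxtimes> N \<boxtimes> M" and
          G = "\<lambda>a u. pr H (N \<boxtimes> M) a (pr N M u (ract M c d))"] that by simp
    show ?thesis
      unfolding braid_def
      by (rule ext[where P = "H \<boxtimes> N \<boxtimes> M"])
        (simp_all add: Y lcoact_coassoc[symmetric] coact_bicomodule[symmetric]
          TS_swap[where s = "lcoact N x" and t = "lcoact M y" for x y]
          TS_swap[where s = "rcoact N x" and t = "lcoact M y" for x y]
          TS_swap[where s = "comult H x" and t = "rcoact N y" for x y])
  qed
  show "rcoact (N \<boxdot> M) (braid M N t)
    = RS (M \<boxdot> N) ((N \<boxdot> M) \<boxtimes> H) t (\<lambda>x a. pr (N \<boxdot> M) H (braid M N x) a)"
  proof -
    \<comment> \<open>The mirror image with h = n^<1>: the Long condition is that of N, while the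
      Yetter-Drinfeld condition and the bicomodule axiom are those of M.\<close>
    have Y: "DS ((N \<boxtimes> M) \<boxtimes> H) x (\<lambda>h1 h2. RS M ((N \<boxtimes> M) \<boxtimes> H) (ract M y h2) (\<lambda>u b.
        pr (N \<boxtimes> M) H (pr N M (lact N d c) u) (h1 \<otimes>\<^bsub>H\<^esub> b)))
      = DS ((N \<boxtimes> M) \<boxtimes> H) x (\<lambda>h1 h2. RS M ((N \<boxtimes> M) \<boxtimes> H) y (\<lambda>u b.
        pr (N \<boxtimes> M) H (pr N M (lact N d c) (ract M u h1)) (b \<otimes>\<^bsub>H\<^esub> h2)))"
      if "x \<in> carrier H" "y \<in> carrier M" "c \<in> carrier N" "d \<in> carrier H" for x y c d
      using rcoact_ract[where M = M and m = y and h = x and P = "(N \<boxtimes> M) \<boxtimes> H" and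
          G = "\<lambda>u b. pr (N \<boxtimes> M) H (pr N M (lact N d c) u) b"] that by simp
    show ?thesis
      unfolding braid_def
      by (rule ext[where P = "(N \<boxtimes> M) \<boxtimes> H"])
        (simp_all add: Y rcoact_coassoc coact_bicomodule
          TS_swap[where s = "rcoact M x" and t = "rcoact N y" for x y]
          TS_swap[where s = "rcoact N x" and t = "lcoact M y" for x y]
          TS_swap[where s = "rcoact M x" and t = "comult H y" for x y])
  qed
  fix h assume [simp]: "h \<in> carrier H"
  show "braid M N (lact (M \<boxdot> N) h t) = lact (N \<boxdot> M) h (braid M N t)"
  proof -
    have Y: "DS (N \<boxtimes> M) h (\<lambda>h1 h2. LS M (N \<boxtimes> M) (lact M h1 m) (\<lambda>a x. RS N (N \<boxtimes> M) n (\<lambda>y b.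
        pr N M (lact N a (lact N h2 y)) (ract M x b))))
      = DS (N \<boxtimes> M) h (\<lambda>h1 h2. LS M (N \<boxtimes> M) m (\<lambda>a x. RS N (N \<boxtimes> M) n (\<lambda>y b.
        pr N M (lact N h1 (lact N a y)) (lact M h2 (ract M x b)))))"
      if "m \<in> carrier M" "n \<in> carrier N" for m n
      using lcoact_lact[where M = M and m = m and h = h and P = "N \<boxtimes> M" and
          G = "\<lambda>a x. RS N (N \<boxtimes> M) n (\<lambda>y b. pr N M (lact N a y) (ract M x b))"] that by simp
    show ?thesis
      unfolding braid_def
      by (rule ext[where P = "N \<boxtimes> M"])
        (simp_all add: Y TS_swap[where s = "lcoact M x" and t = "comult H h" for x]
          TS_swap[where s = "rcoact N x" and t = "comult H h" for x])
  qed
  show "braid M N (ract (M \<boxdot> N) t h) = ract (N \<boxdot> M) (braid M N t) h"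
  proof -
    have Y: "DS (N \<boxtimes> M) h (\<lambda>h1 h2. RS N (N \<boxtimes> M) (ract N n h2) (\<lambda>y b. LS M (N \<boxtimes> M) m (\<lambda>a x.
        pr N M (lact N a y) (ract M (ract M x h1) b))))
      = DS (N \<boxtimes> M) h (\<lambda>h1 h2. RS N (N \<boxtimes> M) n (\<lambda>y b. LS M (N \<boxtimes> M) m (\<lambda>a x.
        pr N M (lact N a (ract N y h1)) (ract M (ract M x b) h2))))"
      if "m \<in> carrier M" "n \<in> carrier N" for m n
      using rcoact_ract[where M = N and m = n and h = h and P = "N \<boxtimes> M" and
          G = "\<lambda>y b. LS M (N \<boxtimes> M) m (\<lambda>a x. pr N M (lact N a y) (ract M x b))"] that by simp
    show ?thesis
      unfolding braid_def
      by (rule ext[where P = "N \<boxtimes> M"])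
        (simp_all add: Y TS_swap[where s = "lcoact M x" and t = "comult H h" for x]
          TS_swap[where s = "lcoact M x" and t = "rcoact N y" for x y]
          TS_swap[where s = "rcoact N x" and t = "comult H h" for x])
  qed
qed (simp_all add: braid_def[abs_def])

lemma braid_pure:
  assumes "obj M" "obj N" "m \<in> carrier M" "n \<in> carrier N"
  shows "fn (lr_braid K H M N) (pr M N m n) = LS M (N \<boxtimes> M) m (\<lambda>a x. RS N (N \<boxtimes> M) n (\<lambda>y b.
     pr N M (lact N a y) (ract M x b)))"
  using assms by (simp add: lr_braid_arrow arrow_def braid_def TS_pure)

lemma Assoc_inv_arrow:
  assumes "obj L" "obj M" "obj N"
  shows "inv_arrow C ((L \<boxdot> M) \<boxdot> N) (L \<boxdot> M \<boxdot> N) (Assoc C L M N)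
    = arrow (L \<boxdot> (M \<boxdot> N)) ((L \<boxdot> M) \<boxdot> N)
       (\<lambda>t. TS L (M \<boxtimes> N) ((L \<boxtimes> M) \<boxtimes> N) t (\<lambda>l s. TS M N ((L \<boxtimes> M) \<boxtimes> N) s (\<lambda>m n.
          pr (L \<boxtimes> M) N (pr L M l m) n)))"
  by (rule category.inv_arrow_eq[OF LR_category _ _ assoc_inverse[OF assms]])
    (simp_all add: LR_simps assms)

lemma LR_prebraided: "prebraided_category C (lr_braid K H)"
proof (rule prebraided_category.intro[OF LR_monoidal], rule prebraided_category_axioms.intro;
    unfold LR_simps mem_Collect_eq)
  note [simp] = sweedler_simps comp_arrow tensA_arrow assoc_arrow unit_arrow tensor_expand lr_braid_arrow
    lr_tensor_pure coact_counit
  fix M N assume [simp]: "obj M" "obj N"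
  show "lr_braid K H M N \<in> lr_hom K H (M \<boxdot> N) (N \<boxdot> M)"
    by (simp add: arrow_in_hom mor_braid)
  { fix M' N' f g assume [simp]: "obj M'" "obj N'"
      and "f \<in> lr_hom K H M M'" "g \<in> lr_hom K H N N'"
    then obtain f' g' where f: "mor M M' f'" "f = arrow M M' f'" and g: "mor N N' g'" "g = arrow N N' g'"
      by (elim lr_homE)
    note [simp] = mor_simps[OF f(1)] mor_simps[OF g(1)] mor_TS[OF f(1)] mor_TS[OF g(1)]
      mor_simps(3,4)[OF f(1), symmetric] mor_simps(3,4)[OF g(1), symmetric]
    \<comment> \<open>Linearity is turned around: on the left-hand side the actions are moved inside
      the two maps, where they already are on the right.\<close>
    note [simp del] = mor_simps(3,4)[OF f(1)] mor_simps(3,4)[OF g(1)]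
    show "lr_braid K H M' N' \<bullet>\<^bsub>C\<^esub> (f \<odot>\<^sub>a\<^bsub>C\<^esub> g) = (g \<odot>\<^sub>a\<^bsub>C\<^esub> f) \<bullet>\<^bsub>C\<^esub> lr_braid K H M N"
      unfolding f g by (simp add: braid_def[abs_def]) }
  { fix P assume [simp]: "obj P"
    \<comment> \<open>The second braiding coacts on m^(0) \<cdot> n^<1>. The Long condition
      \<open>lcoact_ract\<close> takes this action out of the coaction, and then only
      coassociativity on M is left.\<close>
    show "Assoc C N P M \<bullet>\<^bsub>C\<^esub> lr_braid K H M (N \<boxdot> P) \<bullet>\<^bsub>C\<^esub> Assoc C M N P
        = (arrow N N (\<lambda>m. m) \<odot>\<^sub>a\<^bsub>C\<^esub> lr_braid K H M P) \<bullet>\<^bsub>C\<^esub> Assoc C N M P \<bullet>\<^bsub>C\<^esub> (lr_braid K H M N \<odot>\<^sub>a\<^bsub>C\<^esub> arrow P P (\<lambda>m. m))"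
      by (simp add: braid_def[abs_def] lcoact_coassoc[symmetric]
          TS_swap[where s = "rcoact N x" and t = "lcoact M y" for x y]
          TS_swap[where s = "rcoact L x" and t = "comult H y" for L x y])
    \<comment> \<open>The second braiding coacts from the right on the result n^(-1) \<cdot> p^<0>
      of the first; here \<open>rcoact_lact\<close> separates action and coaction.\<close>
    show "inv_arrow C ((P \<boxdot> M) \<boxdot> N) (P \<boxdot> M \<boxdot> N) (Assoc C P M N) \<bullet>\<^bsub>C\<^esub> lr_braid K H (M \<boxdot> N) P \<bullet>\<^bsub>C\<^esub>
          inv_arrow C ((M \<boxdot> N) \<boxdot> P) (M \<boxdot> N \<boxdot> P) (Assoc C M N P)
        = (lr_braid K H M P \<odot>\<^sub>a\<^bsub>C\<^esub> arrow N N (\<lambda>m. m)) \<bullet>\<^bsub>C\<^esub>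
          inv_arrow C ((M \<boxdot> P) \<boxdot> N) (M \<boxdot> P \<boxdot> N) (Assoc C M P N) \<bullet>\<^bsub>C\<^esub> (arrow M M (\<lambda>m. m) \<odot>\<^sub>a\<^bsub>C\<^esub> lr_braid K H N P)"
      by (simp add: braid_def[abs_def] Assoc_inv_arrow rcoact_coassoc del: assoc_arrow
          add: TS_swap[where s = "rcoact P x" and t = "lcoact M y" for x y]
          TS_swap[where s = "lcoact N x" and t = "lcoact M y" for x y]) }
  \<comment> \<open>The unit coacts by 1, so a single coaction remains, and its H-component acts on
    the unit through the counit. The counit axiom of that coaction finishes both cases.\<close>
  show "Runit C M \<bullet>\<^bsub>C\<^esub> lr_braid K H U M = Lunit C M"
    by (simp add: braid_def[abs_def] smult_assoc)
  show "Lunit C M \<bullet>\<^bsub>C\<^esub> lr_braid K H M U = Runit C M"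
    by (simp add: braid_def[abs_def] smult_assoc)
qed

section \<open>The inverse braiding from a skew antipode\<close>

definition braid_inv :: "('u \<Rightarrow> 'u) \<Rightarrow> 'u lr_module \<Rightarrow> 'u lr_module \<Rightarrow> 'u \<Rightarrow> 'u" where
  "braid_inv T M N t = TS N M (M \<boxtimes> N) t (\<lambda>n m. LS M (M \<boxtimes> N) m (\<lambda>a x. RS N (M \<boxtimes> N) n (\<lambda>y b.
     pr M N (ract M x (T b)) (lact N (T a) y))))"

context
  fixes T assumes T: "skew_antipode K H T"
begin

lemma T_lin: "lin K H H T"
  using T by (simp only: skew_antipode_def)

lemma T_simps [simp]: "h \<in> carrier H \<Longrightarrow> T h \<in> carrier H"
  "lin K X H g \<Longrightarrow> lin K X H (\<lambda>x. T (g x))"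
  using lin_closed[OF T_lin] lin_comp[OF T_lin] by blast+

lemma skew_antipode_TS:
  assumes h: "h \<in> carrier H" and P: "module K P" and G: "lin K H P G"
  shows "DS P h (\<lambda>h1 h2. G (T h2 \<otimes>\<^bsub>H\<^esub> h1)) = counit H h \<odot>\<^bsub>P\<^esub> G \<one>\<^bsub>H\<^esub>"
    "DS P h (\<lambda>h1 h2. G (h2 \<otimes>\<^bsub>H\<^esub> T h1)) = counit H h \<odot>\<^bsub>P\<^esub> G \<one>\<^bsub>H\<^esub>"
proof -
  have "tsum H (comult H h) (\<lambda>h1 h2. T h2 \<otimes>\<^bsub>H\<^esub> h1) = counit H h \<odot>\<^bsub>H\<^esub> \<one>\<^bsub>H\<^esub>"
    "tsum H (comult H h) (\<lambda>h1 h2. h2 \<otimes>\<^bsub>H\<^esub> T h1) = counit H h \<odot>\<^bsub>H\<^esub> \<one>\<^bsub>H\<^esub>"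
    using T h by (simp_all only: skew_antipode_def)
  then have "G (DS H h (\<lambda>h1 h2. T h2 \<otimes>\<^bsub>H\<^esub> h1)) = G (counit H h \<odot>\<^bsub>H\<^esub> \<one>\<^bsub>H\<^esub>)"
    "G (DS H h (\<lambda>h1 h2. h2 \<otimes>\<^bsub>H\<^esub> T h1)) = G (counit H h \<odot>\<^bsub>H\<^esub> \<one>\<^bsub>H\<^esub>)"
    using h by (simp_all add: tsum_comult)
  then show "DS P h (\<lambda>h1 h2. G (T h2 \<otimes>\<^bsub>H\<^esub> h1)) = counit H h \<odot>\<^bsub>P\<^esub> G \<one>\<^bsub>H\<^esub>"
    "DS P h (\<lambda>h1 h2. G (h2 \<otimes>\<^bsub>H\<^esub> T h1)) = counit H h \<odot>\<^bsub>P\<^esub> G \<one>\<^bsub>H\<^esub>"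
    using h P by (simp_all add: lin_TS[OF module_H P G] lin_smult[OF G])
qed

lemma lr_braid_inv_arrow:
  assumes "obj M" "obj N"
  shows "lr_braid_inv K H T M N = arrow (N \<boxdot> M) (M \<boxdot> N) (braid_inv T M N)"
proof -
  have "lr_braid_inv_pure K T M N n m = LS M (M \<boxtimes> N) m (\<lambda>a x. RS N (M \<boxtimes> N) n (\<lambda>y b.
     pr M N (ract M x (T b)) (lact N (T a) y)))" if "m \<in> carrier M" "n \<in> carrier N" for m n
    using assms that by (simp add: lr_braid_inv_pure_def tsum_coact)
  then show ?thesis
    unfolding lr_braid_inv_def braid_inv_def[abs_def]
    by (intro arrow_eqI) (simp add: assms tsum_TS[where M = N and N = M])
qed

lemma braid_inv_pure:
  assumes "obj M" "obj N" "m \<in> carrier M" "n \<in> carrier N"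
  shows "fn (lr_braid_inv K H T M N) (pr N M n m) = LS M (M \<boxtimes> N) m (\<lambda>a x. RS N (M \<boxtimes> N) n (\<lambda>y b.
     pr M N (ract M x (T b)) (lact N (T a) y)))"
  using assms by (simp add: lr_braid_inv_arrow arrow_def braid_inv_def TS_pure)

lemma braid_inverse:
  assumes [simp]: "obj M" "obj N"
  shows "inverse_arrows C (M \<boxdot> N) (N \<boxdot> M) (lr_braid K H M N) (lr_braid_inv K H T M N)"
  unfolding lr_braid_arrow[OF assms] lr_braid_inv_arrow[OF assms]
proof (rule inverse_arrowsI[OF mor_braid[OF assms]])
  note [simp] = sweedler_simps lr_tensor_pure coact_counit comult_counit
  show "braid_inv T M N t \<in> carrier (M \<boxdot> N)" for t
    by (simp add: braid_inv_def)
  { fix t assume "t \<in> carrier (M \<boxdot> N)"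
    then have t: "t \<in> carrier (M \<boxtimes> N)" by simp
    \<comment> \<open>In the first identity \<open>h\<close> stands for the H-component of the left
      coaction of m, in the second for that of the right coaction of n. The counits which they leave
      are absorbed by \<open>coact_counit\<close>.\<close>
    have S: "DS (M \<boxtimes> N) h (\<lambda>h1 h2. pr M N v (lact N (T h2) (lact N h1 u))) = counit H h \<odot>\<^bsub>M \<boxtimes> N\<^esub> pr M N v u"
      "DS (M \<boxtimes> N) h (\<lambda>h1 h2. pr M N (ract M (ract M v h2) (T h1)) u) = counit H h \<odot>\<^bsub>M \<boxtimes> N\<^esub> pr M N v u"
      if "h \<in> carrier H" "v \<in> carrier M" "u \<in> carrier N" for h v u
      using skew_antipode_TS(1)[where G = "\<lambda>x. pr M N v (lact N x u)" and P = "M \<boxtimes> N" and h = h]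
        skew_antipode_TS(2)[where G = "\<lambda>x. pr M N (ract M v x) u" and P = "M \<boxtimes> N" and h = h] that
      by simp_all
    show "braid_inv T M N (braid M N t) = t"
      unfolding braid_inv_def braid_def
      by (rule tensor_ext[where t = t and P = "M \<boxtimes> N", OF _ _ _ _ _ _ t])
        (simp_all add: S lcoact_coassoc[symmetric] rcoact_coassoc
          TS_swap[where s = "rcoact N x" and t = "lcoact M y" for x y]) }
  { fix t assume "t \<in> carrier (N \<boxdot> M)"
    then have t: "t \<in> carrier (N \<boxtimes> M)" by simp
    \<comment> \<open>The same two coactions, but now T has acted first, so the two skew antipode
      identities trade places.\<close>
    have S: "DS (N \<boxtimes> M) h (\<lambda>h1 h2. pr N M (lact N h2 (lact N (T h1) u)) v) = counit H h \<odot>\<^bsub>N \<boxtimes> M\<^esub> pr N M u v"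
      "DS (N \<boxtimes> M) h (\<lambda>h1 h2. pr N M u (ract M (ract M v (T h2)) h1)) = counit H h \<odot>\<^bsub>N \<boxtimes> M\<^esub> pr N M u v"
      if "h \<in> carrier H" "v \<in> carrier M" "u \<in> carrier N" for h v u
      using skew_antipode_TS(2)[where G = "\<lambda>x. pr N M (lact N x u) v" and P = "N \<boxtimes> M" and h = h]
        skew_antipode_TS(1)[where G = "\<lambda>x. pr N M u (ract M v x)" and P = "N \<boxtimes> M" and h = h] that
      by simp_all
    show "braid M N (braid_inv T M N t) = t"
      unfolding braid_inv_def braid_def
      by (rule tensor_ext[where t = t and P = "N \<boxtimes> M", OF _ _ _ _ _ _ t])
        (simp_all add: S lcoact_coassoc[symmetric] rcoact_coassoc
          TS_swap[where s = "rcoact N x" and t = "lcoact M y" for x y]) }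
qed simp_all

lemma LR_braided: "braided_category C (lr_braid K H)"
  by (rule braided_category.intro[OF LR_prebraided], rule braided_category_axioms.intro)
    (auto simp: LR_simps intro: iso_arrowI braid_inverse)

end

end

theorem proposition2p1:
  fixes K :: "'u::infinite ring" and H :: "'u bialg"
  assumes "bialgebra K H"
  shows "prebraided_category (LR K H) (lr_braid K H)
    \<and> (\<forall>M \<in> Ob (LR K H). \<forall>N \<in> Ob (LR K H). \<forall>m \<in> carrier M. \<forall>n \<in> carrier N.
         fn (lr_braid K H M N) (pure K M N m n)
         = tsum (tensor K N M) (lcoact M m) (\<lambda>a m0.
             tsum (tensor K N M) (rcoact N n) (\<lambda>n0 b.
               pure K N M (lact N a n0) (ract M m0 b))))
    \<and> (\<forall>T. skew_antipode K H T \<longrightarrow>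
         braided_category (LR K H) (lr_braid K H)
         \<and> (\<forall>M \<in> Ob (LR K H). \<forall>N \<in> Ob (LR K H).
              inverse_arrows (LR K H) (TensO (LR K H) M N) (TensO (LR K H) N M)
                (lr_braid K H M N) (lr_braid_inv K H T M N)
              \<and> (\<forall>m \<in> carrier M. \<forall>n \<in> carrier N.
                   fn (lr_braid_inv K H T M N) (pure K N M n m)
                   = tsum (tensor K M N) (lcoact M m) (\<lambda>a m0.
                       tsum (tensor K M N) (rcoact N n) (\<lambda>n0 b.
                         pure K M N (ract M m0 (T b)) (lact N (T a) n0))))))"
proof -
  interpret bialgebra_lr K H using assms by (rule bialgebra_lr.intro)
  show ?thesis
    by (auto simp: LR_simps LR_prebraided LR_braided braid_inverse braid_pure braid_inv_pure tsum_coact T_simps)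
qed

end
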